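(* Let $\pi:(M,\varphi,\xi,\eta,g)\to(N,J,g')$ be a contact-complex Riemannian submersion. Let $\tilde X$ be a vector field on $M$, decomposed as $\tilde X=X+V$ with $X=h\tilde X$ horizontal and $V=v\tilde X$ vertical. Then at every point of $M$ $$\delta\Phi(\tilde X)=\delta'\Omega(X')+\hat\delta\hat\Phi(V)+g(H,\varphi X)+\tfrac12\, g(\mathrm{Tr}\,B^{h},V),$$ where $X'=d\pi(X)$ (and $\delta'\Omega(X')$ is evaluated at the image point under $\pi$), $\delta,\hat\delta,\delta'$ are the codifferentials on $M$, on the fibre through the point (with the induced metric), and on $N$, respectively, $\Phi,\hat\Phi,\Omega$ are the corresponding fundamental 2-forms, $H$ is the mean curvature vector field of the fibre, and $\mathrm{Tr}\,B^{h}$ is the trace of the restriction of the tensor $B$ to the horizontal distribution.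
   Context: All manifolds and maps are $C^\infty$. An almost contact metric manifold $(M,\varphi,\xi,\eta,g)$ has a $(1,1)$-tensor field $\varphi$, a vector field $\xi$, a 1-form $\eta$ and a Riemannian metric $g$ with $\varphi^2=-I+\eta\otimes\xi$, $\eta(\xi)=1$, $g(\varphi X,\varphi Y)=g(X,Y)-\eta(X)\eta(Y)$; its fundamental 2-form is $\Phi(X,Y)=g(X,\varphi Y)$. For an almost Hermitian manifold $(N,J,g')$ the fundamental 2-form is $\Omega(X',Y')=g'(X',JY')$. A contact-complex Riemannian submersion is a (surjective) Riemannian submersion $\pi:M\to N$ from an almost contact metric manifold onto an almost Hermitian manifold such that $J\circ d\pi=d\pi\circ\varphi$. The vertical distribution is $\mathcal V=\ker d\pi$, the horizontal distribution $\mathcal H$ is its orthogonal complement, and $v,h$ are the orthogonal projections onto $\mathcal V,\mathcal H$. It is known that $\xi$ is vertical and that $\mathcal V,\mathcal H$ are $\varphi$-invariant, so each fibre inherits an almost contact metric structure, with fundamental 2-form $\hat\Phi$. With $\nabla$ the Levi-Civita connection of $g$, the tensor $B$ is $$B(\tilde X,\tilde Y)=v\nabla_{h\tilde X}\varphi h\tilde Y-v\nabla_{\varphi h\tilde X}h\tilde Y+h\nabla_{h\tilde X}\varphi v\tilde Y-h\nabla_{\varphi h\tilde X}v\tilde Y,$$ and $\mathrm{Tr}\,B^h=\sum_a B(E_a,E_a)$ over a local orthonormal frame $(E_a)$ of $\mathcal H$. The mean curvature vector field is the unnormalized trace of the second fundamental form of the fibres, $H=\sum_b h\nabla_{W_b}W_b$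 over a local orthonormal frame $(W_b)$ of $\mathcal V$. The codifferential of a 2-form $\omega$ on a Riemannian manifold is $(\delta\omega)(Z)=-\sum_k(\nabla_{e_k}\omega)(e_k,Z)$ over a local orthonormal frame $(e_k)$. *)

theory Defs
  imports "HOL-Analysis.Analysis"
begin

section \<open>Smooth functions between Euclidean spaces\<close>

primrec Ck_on :: "nat \<Rightarrow> ('a::euclidean_space \<Rightarrow> 'b::real_normed_vector) \<Rightarrow> 'a set \<Rightarrow> bool" where
  "Ck_on 0 f S \<longleftrightarrow> continuous_on S f"
| "Ck_on (Suc k) f S \<longleftrightarrow> (\<forall>x\<in>S. f differentiable (at x)) \<and>
     (\<forall>v. Ck_on k (\<lambda>x. frechet_derivative f (at x) v) S)"

text \<open>Only used for open \<open>S\<close>.\<close>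

definition smooth_on :: "'a::euclidean_space set \<Rightarrow> ('a \<Rightarrow> 'b::real_normed_vector) \<Rightarrow> bool" where
  "smooth_on S f \<longleftrightarrow> (\<forall>k. Ck_on k f S)"


section \<open>Smooth manifolds\<close>

text \<open>
  A manifold is given by a smooth atlas (not necessarily maximal).  Its underlying set, the union
  of the chart domains, may be a proper subset of the ambient type and carries the subspace
  topology; in this way a fibre of a map is again a manifold over the same type.  The model space,
  and hence the dimension, is the type \<open>'a\<close>.
\<close>

type_synonym ('m, 'a) chart = "'m set \<times> ('m \<Rightarrow> 'a)"
type_synonym ('m, 'a) atlas = "('m, 'a) chart set"

definition points :: "('m, 'a) atlas \<Rightarrow> 'm set" where
  "points M = (\<Union>(U, c)\<in>M. U)"

definition open_in :: "('m::topological_space, 'a) atlas \<Rightarrow> 'm set \<Rightarrow> bool" where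
  "open_in M W \<longleftrightarrow> openin (top_of_set (points M)) W"

definition smooth_manifold ::
    "('m::{second_countable_topology, t2_space}, 'a::euclidean_space) atlas \<Rightarrow> bool" where
  "smooth_manifold M \<longleftrightarrow>
     (\<forall>(U, c)\<in>M. open_in M U \<and> open (c ` U) \<and> homeomorphism U (c ` U) c (inv_into U c)) \<and>
     (\<forall>(U, c)\<in>M. \<forall>(V, d)\<in>M. smooth_on (c ` (U \<inter> V)) (d \<circ> inv_into U c))"

definition smooth_fun ::
    "('m, 'a::euclidean_space) atlas \<Rightarrow> 'm set \<Rightarrow> ('m \<Rightarrow> 'c::real_normed_vector) \<Rightarrow> bool" where
  "smooth_fun M W f \<longleftrightarrow> (\<forall>(U, c)\<in>M. smooth_on (c ` (U \<inter> W)) (f \<circ> inv_into U c))"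

definition smooth_map ::
    "('m::topological_space, 'a::euclidean_space) atlas \<Rightarrow> ('n::topological_space, 'b::euclidean_space) atlas
      \<Rightarrow> ('m \<Rightarrow> 'n) \<Rightarrow> bool" where
  "smooth_map M N \<pi> \<longleftrightarrow> continuous_on (points M) \<pi> \<and> \<pi> ` points M \<subseteq> points N \<and>
     (\<forall>(U, c)\<in>M. \<forall>(V, d)\<in>N. smooth_on (c ` (U \<inter> \<pi> -` V)) (d \<circ> \<pi> \<circ> inv_into U c))"


section \<open>Tangent vectors, differentials and vector fields\<close>

text \<open>
  At each point \<open>p\<close> a chart around \<open>p\<close> is fixed once and for all, and the tangent space at \<open>p\<close> is
  identified with the model space \<open>'a\<close> by means of this chart: a vector \<open>v :: 'a\<close>, regarded as a
  tangent vector at \<open>p\<close>, is the velocity at \<open>p\<close> of the curve with coordinate expression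
  \<open>t \<mapsto> c p + t v\<close>.  There is no continuity in \<open>p\<close> of this identification; smoothness
  of a vector field is smoothness of its components with respect to every chart of the atlas.
\<close>

definition chart_at :: "('m, 'a) atlas \<Rightarrow> 'm \<Rightarrow> ('m, 'a) chart" where
  "chart_at M p = (SOME C. C \<in> M \<and> p \<in> fst C)"

text \<open>The derivative \<open>v f\<close> of a (vector-valued) function \<open>f\<close> along the tangent vector \<open>v\<close> at \<open>p\<close>.\<close>

definition dfun ::
    "('m, 'a::euclidean_space) atlas \<Rightarrow> 'm \<Rightarrow> ('m \<Rightarrow> 'c::real_normed_vector) \<Rightarrow> 'a \<Rightarrow> 'c" where
  "dfun M p f v = (case chart_at M p of (U, c) \<Rightarrow>
     frechet_derivative (f \<circ> inv_into U c) (at (c p)) v)"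

definition mdiff ::
    "('m, 'a::euclidean_space) atlas \<Rightarrow> ('n, 'b::euclidean_space) atlas \<Rightarrow> ('m \<Rightarrow> 'n) \<Rightarrow> 'm \<Rightarrow> 'a \<Rightarrow> 'b" where
  "mdiff M N \<pi> p v = dfun M p (snd (chart_at N (\<pi> p)) \<circ> \<pi>) v"

text \<open>\<open>dfun M q c (X q)\<close> is the component vector of \<open>X q\<close> in the chart \<open>c\<close>.\<close>

definition smooth_vf ::
    "('m, 'a::euclidean_space) atlas \<Rightarrow> 'm set \<Rightarrow> ('m \<Rightarrow> 'a) \<Rightarrow> bool" where
  "smooth_vf M W X \<longleftrightarrow> (\<forall>(U, c)\<in>M. smooth_fun M (U \<inter> W) (\<lambda>q. dfun M q c (X q)))"

definition smooth_fun_near ::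
    "('m::topological_space, 'a::euclidean_space) atlas \<Rightarrow> 'm \<Rightarrow> ('m \<Rightarrow> 'c::real_normed_vector) \<Rightarrow> bool" where
  "smooth_fun_near M p f \<longleftrightarrow> (\<exists>W. open_in M W \<and> p \<in> W \<and> smooth_fun M W f)"

definition smooth_vf_near ::
    "('m::topological_space, 'a::euclidean_space) atlas \<Rightarrow> 'm \<Rightarrow> ('m \<Rightarrow> 'a) \<Rightarrow> bool" where
  "smooth_vf_near M p X \<longleftrightarrow> (\<exists>W. open_in M W \<and> p \<in> W \<and> smooth_vf M W X)"

definition extension ::
    "('m::topological_space, 'a::euclidean_space) atlas \<Rightarrow> 'm \<Rightarrow> 'a \<Rightarrow> 'm \<Rightarrow> 'a" where
  "extension M p v = (SOME X. smooth_vf_near M p X \<and> X p = v)"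

definition embedded_submanifold ::
    "('m::{second_countable_topology, t2_space}, 'f::euclidean_space) atlas
      \<Rightarrow> ('m, 'a::euclidean_space) atlas \<Rightarrow> bool" where
  "embedded_submanifold F M \<longleftrightarrow> smooth_manifold F \<and> smooth_map F M id \<and>
     (\<forall>p\<in>points F. inj (mdiff F M id p))"


section \<open>Riemannian metrics and the Levi-Civita connection\<close>

definition riemannian_metric ::
    "('m::topological_space, 'a::euclidean_space) atlas \<Rightarrow> ('m \<Rightarrow> 'a \<Rightarrow> 'a \<Rightarrow> real) \<Rightarrow> bool" where
  "riemannian_metric M g \<longleftrightarrow>
     (\<forall>p\<in>points M. bilinear (g p) \<and> (\<forall>u v. g p u v = g p v u) \<and> (\<forall>v. v \<noteq> 0 \<longrightarrow> 0 < g p v v)) \<and>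
     (\<forall>W X Y. open_in M W \<longrightarrow> smooth_vf M W X \<longrightarrow> smooth_vf M W Y \<longrightarrow>
        smooth_fun M W (\<lambda>p. g p (X p) (Y p)))"

text \<open>
  A connection \<open>D\<close> is written \<open>D p v Y\<close> for the derivative at \<open>p\<close>, along the tangent vector \<open>v\<close>
  at \<open>p\<close>, of a vector field \<open>Y\<close> which is smooth near \<open>p\<close>; thus \<open>\<nabla>\<^sub>X Y\<close> is
  \<open>\<lambda>p. D p (X p) Y\<close>.  The third condition says that it acts on local vector fields.
\<close>

definition affine_connection ::
    "('m::topological_space, 'a::euclidean_space) atlas \<Rightarrow> ('m \<Rightarrow> 'a \<Rightarrow> ('m \<Rightarrow> 'a) \<Rightarrow> 'a) \<Rightarrow> bool" where
  "affine_connection M D \<longleftrightarrow>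
     (\<forall>W X Y. open_in M W \<longrightarrow> smooth_vf M W X \<longrightarrow> smooth_vf M W Y \<longrightarrow>
        smooth_vf M W (\<lambda>p. D p (X p) Y)) \<and>
     (\<forall>p\<in>points M. \<forall>Y. smooth_vf_near M p Y \<longrightarrow> linear (\<lambda>v. D p v Y)) \<and>
     (\<forall>p\<in>points M. \<forall>v Y Z W. smooth_vf_near M p Y \<longrightarrow> smooth_vf_near M p Z \<longrightarrow>
        open_in M W \<longrightarrow> p \<in> W \<longrightarrow> (\<forall>q\<in>W. Y q = Z q) \<longrightarrow> D p v Y = D p v Z) \<and>
     (\<forall>p\<in>points M. \<forall>v Y Z. smooth_vf_near M p Y \<longrightarrow> smooth_vf_near M p Z \<longrightarrow>
        D p v (\<lambda>q. Y q + Z q) = D p v Y + D p v Z) \<and>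
     (\<forall>p\<in>points M. \<forall>v f Y. smooth_fun_near M p f \<longrightarrow> smooth_vf_near M p Y \<longrightarrow>
        D p v (\<lambda>q. f q *\<^sub>R Y q) = dfun M p f v *\<^sub>R Y p + f p *\<^sub>R D p v Y)"

text \<open>
  Vanishing torsion, \<open>\<nabla>\<^sub>X Y - \<nabla>\<^sub>Y X = [X, Y]\<close>, is expressed by the action of both
  sides on functions, where \<open>[X, Y] f = X (Y f) - Y (X f)\<close>.
\<close>

definition torsion_free ::
    "('m::topological_space, 'a::euclidean_space) atlas \<Rightarrow> ('m \<Rightarrow> 'a \<Rightarrow> ('m \<Rightarrow> 'a) \<Rightarrow> 'a) \<Rightarrow> bool" where
  "torsion_free M D \<longleftrightarrow>
     (\<forall>p\<in>points M. \<forall>X Y. \<forall>f :: 'm \<Rightarrow> real.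
        smooth_vf_near M p X \<longrightarrow> smooth_vf_near M p Y \<longrightarrow> smooth_fun_near M p f \<longrightarrow>
        dfun M p f (D p (X p) Y - D p (Y p) X) =
          dfun M p (\<lambda>q. dfun M q f (Y q)) (X p) - dfun M p (\<lambda>q. dfun M q f (X q)) (Y p))"

definition metric_connection ::
    "('m::topological_space, 'a::euclidean_space) atlas \<Rightarrow> ('m \<Rightarrow> 'a \<Rightarrow> 'a \<Rightarrow> real)
      \<Rightarrow> ('m \<Rightarrow> 'a \<Rightarrow> ('m \<Rightarrow> 'a) \<Rightarrow> 'a) \<Rightarrow> bool" where
  "metric_connection M g D \<longleftrightarrow>
     (\<forall>p\<in>points M. \<forall>v Y Z. smooth_vf_near M p Y \<longrightarrow> smooth_vf_near M p Z \<longrightarrow>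
        dfun M p (\<lambda>q. g q (Y q) (Z q)) v = g p (D p v Y) (Z p) + g p (Y p) (D p v Z))"

definition levi_civita ::
    "('m::topological_space, 'a::euclidean_space) atlas \<Rightarrow> ('m \<Rightarrow> 'a \<Rightarrow> 'a \<Rightarrow> real)
      \<Rightarrow> ('m \<Rightarrow> 'a \<Rightarrow> ('m \<Rightarrow> 'a) \<Rightarrow> 'a) \<Rightarrow> bool" where
  "levi_civita M g D \<longleftrightarrow> affine_connection M D \<and> torsion_free M D \<and> metric_connection M g D"


section \<open>Local orthonormal frames and the codifferential\<close>

text \<open>Here \<open>S q\<close> is a subspace of the tangent space at \<open>q\<close>, for every \<open>q\<close>, of dimension \<open>r\<close>.\<close>

definition orthonormal_frame ::
    "('m, 'a::euclidean_space) atlas \<Rightarrow> ('m \<Rightarrow> 'a \<Rightarrow> 'a \<Rightarrow> real) \<Rightarrow> ('m \<Rightarrow> 'a set) \<Rightarrow> nat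
      \<Rightarrow> 'm set \<Rightarrow> (nat \<Rightarrow> 'm \<Rightarrow> 'a) \<Rightarrow> bool" where
  "orthonormal_frame M g S r W E \<longleftrightarrow>
     (\<forall>i<r. smooth_vf M W (E i)) \<and>
     (\<forall>q\<in>W. (\<forall>i<r. \<forall>j<r. g q (E i q) (E j q) = (if i = j then 1 else 0)) \<and>
       span ((\<lambda>i. E i q) ` {..<r}) = S q)"

definition local_frame ::
    "('m::topological_space, 'a::euclidean_space) atlas \<Rightarrow> ('m \<Rightarrow> 'a \<Rightarrow> 'a \<Rightarrow> real) \<Rightarrow> ('m \<Rightarrow> 'a set)
      \<Rightarrow> 'm \<Rightarrow> nat \<Rightarrow> 'm \<Rightarrow> 'a" where
  "local_frame M g S p =
     (SOME E. \<exists>W. open_in M W \<and> p \<in> W \<and> orthonormal_frame M g S (dim (S p)) W E)"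

definition frame_sum ::
    "('m::topological_space, 'a::euclidean_space) atlas \<Rightarrow> ('m \<Rightarrow> 'a \<Rightarrow> 'a \<Rightarrow> real) \<Rightarrow> ('m \<Rightarrow> 'a set)
      \<Rightarrow> 'm \<Rightarrow> (('m \<Rightarrow> 'a) \<Rightarrow> 'c::comm_monoid_add) \<Rightarrow> 'c" where
  "frame_sum M g S p T = (\<Sum>i<dim (S p). T (local_frame M g S p i))"

text \<open>
  \<open>(\<nabla>\<^sub>u \<omega>)(v, w) = u (\<omega>(Y, Z)) - \<omega>(\<nabla>\<^sub>u Y, w) - \<omega>(v, \<nabla>\<^sub>u Z)\<close> for tangent vectors
  \<open>u, v, w\<close> at \<open>p\<close> and any local vector fields \<open>Y, Z\<close> extending \<open>v, w\<close>.
\<close>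

definition cov_deriv_form ::
    "('m::topological_space, 'a::euclidean_space) atlas \<Rightarrow> ('m \<Rightarrow> 'a \<Rightarrow> ('m \<Rightarrow> 'a) \<Rightarrow> 'a)
      \<Rightarrow> ('m \<Rightarrow> 'a \<Rightarrow> 'a \<Rightarrow> real) \<Rightarrow> 'm \<Rightarrow> 'a \<Rightarrow> 'a \<Rightarrow> 'a \<Rightarrow> real" where
  "cov_deriv_form M D \<omega> p u v w =
     (let Y = extension M p v; Z = extension M p w
      in dfun M p (\<lambda>q. \<omega> q (Y q) (Z q)) u - \<omega> p (D p u Y) w - \<omega> p v (D p u Z))"

definition codifferential ::
    "('m::topological_space, 'a::euclidean_space) atlas \<Rightarrow> ('m \<Rightarrow> 'a \<Rightarrow> 'a \<Rightarrow> real)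
      \<Rightarrow> ('m \<Rightarrow> 'a \<Rightarrow> ('m \<Rightarrow> 'a) \<Rightarrow> 'a) \<Rightarrow> ('m \<Rightarrow> 'a \<Rightarrow> 'a \<Rightarrow> real) \<Rightarrow> 'm \<Rightarrow> 'a \<Rightarrow> real" where
  "codifferential M g D \<omega> p z =
     - frame_sum M g (\<lambda>_. UNIV) p (\<lambda>e. cov_deriv_form M D \<omega> p (e p) (e p) z)"


section \<open>Almost contact metric and almost Hermitian manifolds\<close>

definition smooth_endomorphism ::
    "('m::topological_space, 'a::euclidean_space) atlas \<Rightarrow> ('m \<Rightarrow> 'a \<Rightarrow> 'a) \<Rightarrow> bool" where
  "smooth_endomorphism M \<phi> \<longleftrightarrow> (\<forall>p\<in>points M. linear (\<phi> p)) \<and>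
     (\<forall>W X. open_in M W \<longrightarrow> smooth_vf M W X \<longrightarrow> smooth_vf M W (\<lambda>p. \<phi> p (X p)))"

definition smooth_1form ::
    "('m::topological_space, 'a::euclidean_space) atlas \<Rightarrow> ('m \<Rightarrow> 'a \<Rightarrow> real) \<Rightarrow> bool" where
  "smooth_1form M \<eta> \<longleftrightarrow> (\<forall>p\<in>points M. linear (\<eta> p)) \<and>
     (\<forall>W X. open_in M W \<longrightarrow> smooth_vf M W X \<longrightarrow> smooth_fun M W (\<lambda>p. \<eta> p (X p)))"

definition almost_contact_metric ::
    "('m::{second_countable_topology, t2_space}, 'a::euclidean_space) atlas \<Rightarrow> ('m \<Rightarrow> 'a \<Rightarrow> 'a)
      \<Rightarrow> ('m \<Rightarrow> 'a) \<Rightarrow> ('m \<Rightarrow> 'a \<Rightarrow> real) \<Rightarrow> ('m \<Rightarrow> 'a \<Rightarrow> 'a \<Rightarrow> real) \<Rightarrow> bool" where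
  "almost_contact_metric M \<phi> \<xi> \<eta> g \<longleftrightarrow>
     smooth_manifold M \<and> smooth_endomorphism M \<phi> \<and> smooth_vf M (points M) \<xi> \<and> smooth_1form M \<eta> \<and>
     riemannian_metric M g \<and>
     (\<forall>p\<in>points M. (\<forall>v. \<phi> p (\<phi> p v) = - v + \<eta> p v *\<^sub>R \<xi> p) \<and> \<eta> p (\<xi> p) = 1 \<and>
        (\<forall>u v. g p (\<phi> p u) (\<phi> p v) = g p u v - \<eta> p u * \<eta> p v))"

definition almost_hermitian ::
    "('n::{second_countable_topology, t2_space}, 'b::euclidean_space) atlas \<Rightarrow> ('n \<Rightarrow> 'b \<Rightarrow> 'b)
      \<Rightarrow> ('n \<Rightarrow> 'b \<Rightarrow> 'b \<Rightarrow> real) \<Rightarrow> bool" where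
  "almost_hermitian N J g \<longleftrightarrow>
     smooth_manifold N \<and> smooth_endomorphism N J \<and> riemannian_metric N g \<and>
     (\<forall>q\<in>points N. (\<forall>v. J q (J q v) = - v) \<and> (\<forall>u v. g q (J q u) (J q v) = g q u v))"

definition fundamental_form ::
    "('m \<Rightarrow> 'a \<Rightarrow> 'a \<Rightarrow> real) \<Rightarrow> ('m \<Rightarrow> 'a \<Rightarrow> 'a) \<Rightarrow> 'm \<Rightarrow> 'a \<Rightarrow> 'a \<Rightarrow> real" where
  "fundamental_form g \<phi> p u v = g p u (\<phi> p v)"


section \<open>Contact-complex Riemannian submersions\<close>

definition vertical ::
    "('m, 'a::euclidean_space) atlas \<Rightarrow> ('n, 'b::euclidean_space) atlas \<Rightarrow> ('m \<Rightarrow> 'n) \<Rightarrow> 'm \<Rightarrow> 'a set" where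
  "vertical M N \<pi> p = {v. mdiff M N \<pi> p v = 0}"

definition horizontal ::
    "('m, 'a::euclidean_space) atlas \<Rightarrow> ('m \<Rightarrow> 'a \<Rightarrow> 'a \<Rightarrow> real) \<Rightarrow> ('n, 'b::euclidean_space) atlas
      \<Rightarrow> ('m \<Rightarrow> 'n) \<Rightarrow> 'm \<Rightarrow> 'a set" where
  "horizontal M g N \<pi> p = {u. \<forall>v\<in>vertical M N \<pi> p. g p u v = 0}"

definition vproj ::
    "('m, 'a::euclidean_space) atlas \<Rightarrow> ('m \<Rightarrow> 'a \<Rightarrow> 'a \<Rightarrow> real) \<Rightarrow> ('n, 'b::euclidean_space) atlas
      \<Rightarrow> ('m \<Rightarrow> 'n) \<Rightarrow> 'm \<Rightarrow> 'a \<Rightarrow> 'a" where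
  "vproj M g N \<pi> p u = (THE w. w \<in> vertical M N \<pi> p \<and> u - w \<in> horizontal M g N \<pi> p)"

definition hproj ::
    "('m, 'a::euclidean_space) atlas \<Rightarrow> ('m \<Rightarrow> 'a \<Rightarrow> 'a \<Rightarrow> real) \<Rightarrow> ('n, 'b::euclidean_space) atlas
      \<Rightarrow> ('m \<Rightarrow> 'n) \<Rightarrow> 'm \<Rightarrow> 'a \<Rightarrow> 'a" where
  "hproj M g N \<pi> p u = (THE w. w \<in> horizontal M g N \<pi> p \<and> u - w \<in> vertical M N \<pi> p)"

definition riemannian_submersion ::
    "('m::topological_space, 'a::euclidean_space) atlas \<Rightarrow> ('m \<Rightarrow> 'a \<Rightarrow> 'a \<Rightarrow> real)
      \<Rightarrow> ('n::topological_space, 'b::euclidean_space) atlas \<Rightarrow> ('n \<Rightarrow> 'b \<Rightarrow> 'b \<Rightarrow> real) \<Rightarrow> ('m \<Rightarrow> 'n) \<Rightarrow> bool" where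
  "riemannian_submersion M g N g' \<pi> \<longleftrightarrow>
     smooth_map M N \<pi> \<and> \<pi> ` points M = points N \<and>
     (\<forall>p\<in>points M. surj (mdiff M N \<pi> p) \<and>
        (\<forall>u\<in>horizontal M g N \<pi> p. \<forall>v\<in>horizontal M g N \<pi> p.
           g' (\<pi> p) (mdiff M N \<pi> p u) (mdiff M N \<pi> p v) = g p u v))"

definition contact_complex_submersion ::
    "('m::{second_countable_topology, t2_space}, 'a::euclidean_space) atlas
      \<Rightarrow> ('m \<Rightarrow> 'a \<Rightarrow> 'a) \<Rightarrow> ('m \<Rightarrow> 'a) \<Rightarrow> ('m \<Rightarrow> 'a \<Rightarrow> real) \<Rightarrow> ('m \<Rightarrow> 'a \<Rightarrow> 'a \<Rightarrow> real)
      \<Rightarrow> ('n::{second_countable_topology, t2_space}, 'b::euclidean_space) atlas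
      \<Rightarrow> ('n \<Rightarrow> 'b \<Rightarrow> 'b) \<Rightarrow> ('n \<Rightarrow> 'b \<Rightarrow> 'b \<Rightarrow> real) \<Rightarrow> ('m \<Rightarrow> 'n) \<Rightarrow> bool" where
  "contact_complex_submersion M \<phi> \<xi> \<eta> g N J g' \<pi> \<longleftrightarrow>
     almost_contact_metric M \<phi> \<xi> \<eta> g \<and> almost_hermitian N J g' \<and>
     riemannian_submersion M g N g' \<pi> \<and>
     (\<forall>p\<in>points M. \<forall>v. J (\<pi> p) (mdiff M N \<pi> p v) = mdiff M N \<pi> p (\<phi> p v))"

definition tensor_B ::
    "('m, 'a::euclidean_space) atlas \<Rightarrow> ('m \<Rightarrow> 'a \<Rightarrow> 'a) \<Rightarrow> ('m \<Rightarrow> 'a \<Rightarrow> 'a \<Rightarrow> real)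
      \<Rightarrow> ('m \<Rightarrow> 'a \<Rightarrow> ('m \<Rightarrow> 'a) \<Rightarrow> 'a) \<Rightarrow> ('n, 'b::euclidean_space) atlas \<Rightarrow> ('m \<Rightarrow> 'n)
      \<Rightarrow> ('m \<Rightarrow> 'a) \<Rightarrow> ('m \<Rightarrow> 'a) \<Rightarrow> 'm \<Rightarrow> 'a" where
  "tensor_B M \<phi> g D N \<pi> X Y p =
     (let h = hproj M g N \<pi>; v = vproj M g N \<pi> in
        v p (D p (h p (X p)) (\<lambda>q. \<phi> q (h q (Y q))))
      - v p (D p (\<phi> p (h p (X p))) (\<lambda>q. h q (Y q)))
      + h p (D p (h p (X p)) (\<lambda>q. \<phi> q (v q (Y q))))
      - h p (D p (\<phi> p (h p (X p))) (\<lambda>q. v q (Y q))))"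

definition trace_Bh ::
    "('m::topological_space, 'a::euclidean_space) atlas \<Rightarrow> ('m \<Rightarrow> 'a \<Rightarrow> 'a) \<Rightarrow> ('m \<Rightarrow> 'a \<Rightarrow> 'a \<Rightarrow> real)
      \<Rightarrow> ('m \<Rightarrow> 'a \<Rightarrow> ('m \<Rightarrow> 'a) \<Rightarrow> 'a) \<Rightarrow> ('n, 'b::euclidean_space) atlas \<Rightarrow> ('m \<Rightarrow> 'n) \<Rightarrow> 'm \<Rightarrow> 'a" where
  "trace_Bh M \<phi> g D N \<pi> p =
     frame_sum M g (horizontal M g N \<pi>) p (\<lambda>E. tensor_B M \<phi> g D N \<pi> E E p)"

definition mean_curvature ::
    "('m::topological_space, 'a::euclidean_space) atlas \<Rightarrow> ('m \<Rightarrow> 'a \<Rightarrow> 'a \<Rightarrow> real)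
      \<Rightarrow> ('m \<Rightarrow> 'a \<Rightarrow> ('m \<Rightarrow> 'a) \<Rightarrow> 'a) \<Rightarrow> ('n, 'b::euclidean_space) atlas \<Rightarrow> ('m \<Rightarrow> 'n) \<Rightarrow> 'm \<Rightarrow> 'a" where
  "mean_curvature M g D N \<pi> p =
     frame_sum M g (vertical M N \<pi>) p (\<lambda>E. hproj M g N \<pi> p (D p (E p) E))"


section \<open>Structures induced on a submanifold\<close>

text \<open>
  The tangent spaces of a submanifold \<open>F\<close> are mapped into those of \<open>M\<close> by the differential of the
  inclusion.  \<open>restrict_vector\<close> is the inverse of this map on its image.
\<close>

definition restrict_vector ::
    "('m, 'f::euclidean_space) atlas \<Rightarrow> ('m, 'a::euclidean_space) atlas \<Rightarrow> 'm \<Rightarrow> 'a \<Rightarrow> 'f" where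
  "restrict_vector F M p = inv (mdiff F M id p)"

definition induced_metric ::
    "('m, 'f::euclidean_space) atlas \<Rightarrow> ('m, 'a::euclidean_space) atlas \<Rightarrow> ('m \<Rightarrow> 'a \<Rightarrow> 'a \<Rightarrow> real)
      \<Rightarrow> 'm \<Rightarrow> 'f \<Rightarrow> 'f \<Rightarrow> real" where
  "induced_metric F M g p u v = g p (mdiff F M id p u) (mdiff F M id p v)"

text \<open>For submanifolds whose tangent spaces are invariant under \<open>\<phi>\<close>.\<close>

definition induced_endomorphism ::
    "('m, 'f::euclidean_space) atlas \<Rightarrow> ('m, 'a::euclidean_space) atlas \<Rightarrow> ('m \<Rightarrow> 'a \<Rightarrow> 'a)
      \<Rightarrow> 'm \<Rightarrow> 'f \<Rightarrow> 'f" where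
  "induced_endomorphism F M \<phi> p u = restrict_vector F M p (\<phi> p (mdiff F M id p u))"

end

theory Submission
  imports Defs
begin

text \<open>
  Since \<open>\<phi>\<close> is skew, \<open>(\<nabla>\<^sub>u \<Phi>)(v, w) = g((\<nabla>\<^sub>u \<phi>) w, v) = - g((\<nabla>\<^sub>u \<phi>) v, w)\<close> is tensorial, and its trace over
  \<open>u = v\<close> splits into a trace over \<open>\<H>\<close> and one over \<open>\<V>\<close>, each evaluated on a horizontal and on a
  vertical vector \<open>w\<close>.  By the Koszul formula the two pure terms are the codifferentials of the base
  and of the fibre.  In the term over \<open>\<V>\<close> with \<open>w\<close> horizontal, the symmetry of the second fundamental
  form against the skewness of \<open>\<phi>\<close> leaves only the mean curvature.  In the term over \<open>\<H>\<close> with \<open>w\<close>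
  vertical, \<open>v \<nabla>\<^sub>X Y\<close> is alternating in horizontal \<open>X, Y\<close>, so that \<open>v \<nabla>\<^sub>E \<phi>E\<close> is half of \<open>B(E, E)\<close>.
\<close>

section \<open>Calculus of smooth functions on Euclidean spaces\<close>

text \<open>Two features of the definitions shape the development. The identification of the tangent
  space at \<open>p\<close> with the model space jumps with \<open>p\<close>, so all smoothness is
  handled by germs (\<open>smooth_fun_near\<close>, \<open>smooth_vf_near\<close>, the filter
  \<open>nearby\<close>) and components in one fixed chart. Extensions and frames are arbitrary
  choices, so both their existence and the independence of the choice have to be secured, although
  the connections are known by their axioms only. Base and fibre are compared with \<open>M\<close>
  in opposite directions: the submersion starts from \<open>M\<close> and is isometric on horizontal
  vectors, the inclusion of the fibre ends in \<open>M\<close> and is isometric everywhere. What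
  both share is the identity g(u, w) = g'(df u, df w) for arbitrary u as soon as w lies in the
  distinguished distribution. The freedom in u matters: the bracket of two basic fields may have a
  vertical part, and the Koszul formula pairs it with a horizontal vector, which does not see that
  part.\<close>

lemma Ck_on_cong:
  assumes "open S" "Ck_on k f S" "\<And>x. x \<in> S \<Longrightarrow> f x = g x"
  shows "Ck_on k g S"
  using assms(2,3)
proof (induction k arbitrary: f g)
  case 0
  then show ?case using continuous_on_cong[OF refl, of S f g] by simp
next
  case (Suc k)
  have f: "(f has_derivative frechet_derivative f (at x)) (at x)" if "x \<in> S" for x
    using Suc.prems(1) that by (simp add: frechet_derivative_works)
  have g: "(g has_derivative frechet_derivative f (at x)) (at x)" if "x \<in> S" for x
    by (rule has_derivative_transform_within_open[OF f[OF that] assms(1) that]) (use Suc.prems in auto)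
  have "Ck_on k (\<lambda>x. frechet_derivative g (at x) v) S" for v
  proof (rule Suc.IH)
    show "Ck_on k (\<lambda>x. frechet_derivative f (at x) v) S" using Suc.prems(1) by simp
    show "frechet_derivative f (at x) v = frechet_derivative g (at x) v" if "x \<in> S" for x
      by (rule fun_cong[OF frechet_derivative_at[OF g[OF that]]])
  qed
  then show ?case using g by (auto simp: differentiable_def)
qed

text \<open>\<open>frechet_derivative\<close> is a choice; this rule puts an explicit derivative in
  its place, so each closure property below only has to exhibit one.\<close>

lemma Ck_on_Suc_has_derivative:
  assumes "open S" "\<And>x. x \<in> S \<Longrightarrow> (f has_derivative f' x) (at x)"
    and "\<And>v. Ck_on k (\<lambda>x. f' x v) S"
  shows "Ck_on (Suc k) f S"
proof -
  have "Ck_on k (\<lambda>x. frechet_derivative f (at x) v) S" for v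
    by (rule Ck_on_cong[OF assms(1) assms(3)[of v]])
      (rule fun_cong[OF frechet_derivative_at[OF assms(2)]])
  then show ?thesis using assms(2) by (auto simp: differentiable_def)
qed

lemma Ck_on_SucD:
  assumes "Ck_on (Suc k) f S"
  shows "Ck_on k f S"
  using assms
proof (induction k arbitrary: f)
  case 0
  then show ?case
    by (simp add: continuous_at_imp_continuous_on differentiable_imp_continuous_within)
next
  case (Suc k)
  then show ?case by simp
qed

lemma Ck_on_subset:
  assumes "Ck_on k f T" "S \<subseteq> T"
  shows "Ck_on k f S"
  using assms(1)
  by (induction k arbitrary: f) (use assms(2) continuous_on_subset in auto)

text \<open>Every clause of \<open>Ck_on\<close> is tested point by point. This leads back from
  germs to smoothness on a whole open set, the form in which the definitions on atlases are
  stated.\<close>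

lemma Ck_on_local:
  assumes "\<And>x. x \<in> S \<Longrightarrow> \<exists>T. open T \<and> x \<in> T \<and> Ck_on k f T"
  shows "Ck_on k f S"
  using assms
proof (induction k arbitrary: f)
  case 0
  then show ?case
    by (metis Ck_on.simps(1) continuous_at_imp_continuous_on continuous_on_eq_continuous_at)
next
  case (Suc k)
  have "f differentiable (at x)" if "x \<in> S" for x
    using Suc.prems[OF that] by auto
  moreover have "Ck_on k (\<lambda>x. frechet_derivative f (at x) v) S" for v
    by (rule Suc.IH) (use Suc.prems in fastforce)
  ultimately show ?case by simp
qed

lemma Ck_on_const: "Ck_on k (\<lambda>x. c) S"
  by (induction k arbitrary: c) simp_all

lemma Ck_on_bounded_linear_compose:
  assumes "open S" "bounded_linear L" "Ck_on k f S"
  shows "Ck_on k (\<lambda>x. L (f x)) S"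
  using assms(3)
proof (induction k arbitrary: f)
  case 0
  then show ?case using bounded_linear.continuous_on[OF assms(2)] by simp
next
  case (Suc k)
  then show ?case
    by (intro Ck_on_Suc_has_derivative[OF assms(1),
          where f' = "\<lambda>x v. L (frechet_derivative f (at x) v)"])
      (auto simp: frechet_derivative_works intro!: bounded_linear.has_derivative[OF assms(2)])
qed

lemma Ck_on_add:
  assumes "open S" "Ck_on k f S" "Ck_on k g S"
  shows "Ck_on k (\<lambda>x. f x + g x) S"
  using assms(2,3)
proof (induction k arbitrary: f g)
  case 0
  then show ?case by (simp add: continuous_on_add)
next
  case (Suc k)
  then show ?case
    by (intro Ck_on_Suc_has_derivative[OF assms(1),
          where f' = "\<lambda>x v. frechet_derivative f (at x) v + frechet_derivative g (at x) v"])
      (auto simp: frechet_derivative_works intro!: has_derivative_add)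
qed

lemma Ck_on_sum:
  assumes "open S" "\<And>i. i \<in> I \<Longrightarrow> Ck_on k (f i) S"
  shows "Ck_on k (\<lambda>x. \<Sum>i\<in>I. f i x) S"
  using assms(2)
  by (induction I rule: infinite_finite_induct) (auto simp: Ck_on_const intro!: Ck_on_add[OF assms(1)])

lemma Ck_on_bilinear:
  assumes "open S" "bounded_bilinear B" "Ck_on k f S" "Ck_on k g S"
  shows "Ck_on k (\<lambda>x. B (f x) (g x)) S"
  using assms(3,4)
proof (induction k arbitrary: f g)
  case 0
  then show ?case by (simp add: bounded_bilinear.continuous_on[OF assms(2)])
next
  case (Suc k)
  show ?case
  proof (rule Ck_on_Suc_has_derivative[OF assms(1),
      where f' = "\<lambda>x v. B (f x) (frechet_derivative g (at x) v) + B (frechet_derivative f (at x) v) (g x)"])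
    fix x assume "x \<in> S"
    then show "((\<lambda>x. B (f x) (g x)) has_derivative
        (\<lambda>v. B (f x) (frechet_derivative g (at x) v) + B (frechet_derivative f (at x) v) (g x))) (at x)"
      using Suc.prems
      by (auto simp: frechet_derivative_works intro!: bounded_bilinear.FDERIV[OF assms(2)])
  next
    fix v
    show "Ck_on k (\<lambda>x. B (f x) (frechet_derivative g (at x) v) + B (frechet_derivative f (at x) v) (g x)) S"
      by (rule Ck_on_add[OF assms(1)]; rule Suc.IH)
        (use Suc.prems Ck_on_SucD[OF Suc.prems(1)] Ck_on_SucD[OF Suc.prems(2)] in auto)
  qed
qed

lemma linear_expand:
  fixes L :: "'a::euclidean_space \<Rightarrow> 'b::real_vector"
  assumes "linear L"
  shows "L v = (\<Sum>b\<in>Basis. (v \<bullet> b) *\<^sub>R L b)"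
proof -
  have "L v = L (\<Sum>b\<in>Basis. (v \<bullet> b) *\<^sub>R b)" by (simp add: euclidean_representation)
  then show ?thesis by (simp add: linear_sum[OF assms] linear_scale[OF assms])
qed

text \<open>The chain rule produces g'(f x) in the direction f'(x) v, which varies with x, while
  \<open>Ck_on\<close> controls derivatives in constant directions only. Expanding that direction
  over \<open>Basis\<close> leaves products of functions to which the induction hypothesis
  applies.\<close>

lemma Ck_on_compose:
  fixes f :: "'a::euclidean_space \<Rightarrow> 'b::euclidean_space"
  assumes "open S" "open T" "f ` S \<subseteq> T" "Ck_on k f S" "Ck_on k g T"
  shows "Ck_on k (\<lambda>x. g (f x)) S"
  using assms(4,5)
proof (induction k arbitrary: g)
  case 0
  then show ?case using continuous_on_compose2[OF _ _ assms(3)] by simp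
next
  case (Suc k)
  let ?f' = "\<lambda>x. frechet_derivative f (at x)" and ?g' = "\<lambda>y. frechet_derivative g (at y)"
  show ?case
  proof (rule Ck_on_Suc_has_derivative[OF assms(1), where f' = "\<lambda>x v. \<Sum>j\<in>Basis. (?f' x v \<bullet> j) *\<^sub>R ?g' (f x) j"])
    fix x assume x: "x \<in> S"
    have f: "(f has_derivative ?f' x) (at x)"
      using Suc.prems x by (simp add: frechet_derivative_works)
    have g: "(g has_derivative ?g' (f x)) (at (f x))"
      using Suc.prems x assms(3) by (auto simp: frechet_derivative_works)
    have "?g' (f x) (?f' x v) = (\<Sum>j\<in>Basis. (?f' x v \<bullet> j) *\<^sub>R ?g' (f x) j)" for v
      by (rule linear_expand[OF has_derivative_linear[OF g]])
    then show "((\<lambda>x. g (f x)) has_derivative (\<lambda>v. \<Sum>j\<in>Basis. (?f' x v \<bullet> j) *\<^sub>R ?g' (f x) j)) (at x)"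
      using diff_chain_at[OF f g] by (simp add: o_def)
  next
    fix v
    have f': "Ck_on k (\<lambda>x. ?f' x v) S" and g': "\<And>j. Ck_on k (\<lambda>y. ?g' y j) T"
      using Suc.prems by simp_all
    show "Ck_on k (\<lambda>x. \<Sum>j\<in>Basis. (?f' x v \<bullet> j) *\<^sub>R ?g' (f x) j) S"
    proof (rule Ck_on_sum[OF assms(1)])
      fix j :: 'b
      have "Ck_on k (\<lambda>x. ?f' x v \<bullet> j) S"
        by (rule Ck_on_bounded_linear_compose[OF assms(1) bounded_linear_inner_left f'])
      moreover have "Ck_on k (\<lambda>x. ?g' (f x) j) S"
        by (rule Suc.IH[OF Ck_on_SucD[OF Suc.prems(1)] g'])
      ultimately show "Ck_on k (\<lambda>x. (?f' x v \<bullet> j) *\<^sub>R ?g' (f x) j) S"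
        by (rule Ck_on_bilinear[OF assms(1) bounded_bilinear_scaleR])
    qed
  qed
qed

text \<open>The derivative is a polynomial in the function itself, so the induction feeds on its own
  hypothesis. The same holds for \<open>sqrt\<close> below with the help of this lemma; together
  they give the normalising factor of Gram-Schmidt.\<close>

lemma Ck_on_inverse: "Ck_on k (inverse :: real \<Rightarrow> real) {0<..}"
proof (induction k)
  case 0
  show ?case by (auto intro!: continuous_intros)
next
  case (Suc k)
  show ?case
  proof (rule Ck_on_Suc_has_derivative[where f' = "\<lambda>x v. - (inverse x * v * inverse x)"])
    show "Ck_on k (\<lambda>x. - (inverse x * v * inverse x)) {0<..}" for v :: real
      by (intro Ck_on_bounded_linear_compose[OF _ bounded_linear_minus[OF bounded_linear_ident]]
          Ck_on_bilinear[OF _ bounded_bilinear_mult] Suc.IH Ck_on_const) auto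
  qed (auto intro!: has_derivative_inverse')
qed

lemma Ck_on_sqrt: "Ck_on k sqrt {0<..}"
proof (induction k)
  case 0
  show ?case by (auto intro!: continuous_intros)
next
  case (Suc k)
  show ?case
  proof (rule Ck_on_Suc_has_derivative[where f' = "\<lambda>x v. (inverse (sqrt x) * (1/2)) * v"])
    fix x :: real assume "x \<in> {0<..}"
    then have "(sqrt has_real_derivative inverse (sqrt x) * (1/2)) (at x)"
      using DERIV_real_sqrt[of x] by simp
    then show "(sqrt has_derivative (\<lambda>v. (inverse (sqrt x) * (1/2)) * v)) (at x)"
      unfolding has_field_derivative_def .
  next
    show "Ck_on k (\<lambda>x. (inverse (sqrt x) * (1/2)) * v) {0<..}" for v
      by (intro Ck_on_bilinear[OF _ bounded_bilinear_mult] Ck_on_const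
          Ck_on_compose[OF _ _ _ Suc.IH Ck_on_inverse]) auto
  qed auto
qed


section \<open>Germs of smooth functions on Euclidean space\<close>

definition smooth_at :: "('a::euclidean_space \<Rightarrow> 'b::real_normed_vector) \<Rightarrow> 'a \<Rightarrow> bool" where
  "smooth_at f x \<longleftrightarrow> (\<exists>S. open S \<and> x \<in> S \<and> smooth_on S f)"

lemma smooth_on_subset: "smooth_on T f \<Longrightarrow> S \<subseteq> T \<Longrightarrow> smooth_on S f"
  by (auto simp: smooth_on_def intro: Ck_on_subset)

lemma smooth_on_iff_smooth_at:
  assumes "open S"
  shows "smooth_on S f \<longleftrightarrow> (\<forall>x\<in>S. smooth_at f x)"
proof
  show "smooth_on S f \<Longrightarrow> \<forall>x\<in>S. smooth_at f x"
    using assms by (auto simp: smooth_at_def)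
  assume *: "\<forall>x\<in>S. smooth_at f x"
  show "smooth_on S f"
    unfolding smooth_on_def
  proof
    show "Ck_on k f S" for k
      by (rule Ck_on_local) (use * in \<open>auto simp: smooth_at_def smooth_on_def\<close>)
  qed
qed

text \<open>The reason why \<open>smooth_at\<close> demands smoothness on a neighbourhood: the
  property is then open in the point and inherited by directional derivatives.\<close>

lemma smooth_at_eventually: "smooth_at f x \<Longrightarrow> \<forall>\<^sub>F y in nhds x. smooth_at f y"
  unfolding smooth_at_def eventually_nhds by blast

lemma smooth_at_cong:
  assumes "smooth_at f x" "\<forall>\<^sub>F y in nhds x. f y = g y"
  shows "smooth_at g x"
proof -
  obtain S T where "open S" "x \<in> S" "smooth_on S f" "open T" "x \<in> T" "\<forall>y\<in>T. f y = g y"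
    using assms unfolding smooth_at_def eventually_nhds by blast
  then have "open (S \<inter> T)" "x \<in> S \<inter> T" "smooth_on (S \<inter> T) f" "\<forall>y\<in>S \<inter> T. f y = g y"
    by (auto intro: smooth_on_subset)
  moreover from this have "smooth_on (S \<inter> T) g"
    unfolding smooth_on_def using Ck_on_cong[of "S \<inter> T" _ f g] by blast
  ultimately show ?thesis
    unfolding smooth_at_def by blast
qed

lemma smooth_at_differentiable: "smooth_at f x \<Longrightarrow> f differentiable (at x)"
  by (metis Ck_on.simps(2) smooth_at_def smooth_on_def)

lemma smooth_at_continuous: "smooth_at f x \<Longrightarrow> isCont f x"
  using smooth_at_differentiable differentiable_imp_continuous_within by blast

lemma smooth_at_const: "smooth_at (\<lambda>x. c) x"
  unfolding smooth_at_def smooth_on_def using Ck_on_const open_UNIV by blast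

lemma smooth_at_frechet_derivative:
  "smooth_at f x \<Longrightarrow> smooth_at (\<lambda>x. frechet_derivative f (at x) v) x"
  unfolding smooth_at_def smooth_on_def by (metis Ck_on.simps(2))

lemma smooth_at_bilinear:
  assumes "bounded_bilinear B" "smooth_at f x" "smooth_at g x"
  shows "smooth_at (\<lambda>x. B (f x) (g x)) x"
proof -
  obtain S T where "open S" "x \<in> S" "smooth_on S f" "open T" "x \<in> T" "smooth_on T g"
    using assms(2,3) unfolding smooth_at_def by blast
  then have "open (S \<inter> T)" "x \<in> S \<inter> T" "smooth_on (S \<inter> T) f" "smooth_on (S \<inter> T) g"
    by (auto intro: smooth_on_subset)
  then show ?thesis
    using Ck_on_bilinear[OF _ assms(1), of "S \<inter> T" _ f g] unfolding smooth_at_def smooth_on_def by blast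
qed

lemma smooth_at_compose:
  fixes f :: "'a::euclidean_space \<Rightarrow> 'b::euclidean_space"
  assumes "smooth_at f x" "smooth_at g (f x)"
  shows "smooth_at (\<lambda>x. g (f x)) x"
proof -
  obtain S T where S: "open S" "x \<in> S" "smooth_on S f" and T: "open T" "f x \<in> T" "smooth_on T g"
    using assms unfolding smooth_at_def by blast
  have "continuous_on S f"
    using S(3) unfolding smooth_on_def by (metis Ck_on.simps(1))
  then have "open (S \<inter> f -` T)"
    using S(1) T(1) continuous_open_preimage by blast
  moreover have "smooth_on (S \<inter> f -` T) f"
    using S(3) smooth_on_subset by blast
  ultimately have "smooth_on (S \<inter> f -` T) (\<lambda>x. g (f x))"
    using T Ck_on_compose[of "S \<inter> f -` T" T f _ g] by (auto simp: smooth_on_def)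
  with \<open>open (S \<inter> f -` T)\<close> S(2) T(2) show ?thesis
    unfolding smooth_at_def by blast
qed

lemma smooth_at_bounded_linear:
  assumes "bounded_linear L" "smooth_at f x"
  shows "smooth_at (\<lambda>x. L (f x)) x"
  using assms(2) Ck_on_bounded_linear_compose[OF _ assms(1), of _ _ f]
  unfolding smooth_at_def smooth_on_def by blast

lemma smooth_at_add:
  assumes "smooth_at f x" "smooth_at g x"
  shows "smooth_at (\<lambda>x. f x + g x) x"
proof -
  obtain S T where "open S" "x \<in> S" "smooth_on S f" "open T" "x \<in> T" "smooth_on T g"
    using assms unfolding smooth_at_def by blast
  then have "open (S \<inter> T)" "x \<in> S \<inter> T" "smooth_on (S \<inter> T) f" "smooth_on (S \<inter> T) g"
    by (auto intro: smooth_on_subset)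
  then show ?thesis
    using Ck_on_add[of "S \<inter> T" _ f g] unfolding smooth_at_def smooth_on_def by blast
qed

lemma smooth_at_inverse_sqrt:
  assumes "0 < x"
  shows "smooth_at (\<lambda>x. inverse (sqrt x)) x"
proof (rule smooth_at_compose[where f = sqrt])
  show "smooth_at sqrt x"
    unfolding smooth_at_def smooth_on_def
    using Ck_on_sqrt assms by (intro exI[of _ "{0<..}"]) auto
  show "smooth_at inverse (sqrt x)"
    unfolding smooth_at_def smooth_on_def
    using Ck_on_inverse assms by (intro exI[of _ "{0<..}"]) auto
qed

section \<open>Smoothness and derivatives at a point of a manifold\<close>

text \<open>A filter that includes the point \<open>p\<close> itself. Identities between local
  fields become \<open>eventually\<close> statements, and \<open>nearby_self\<close> specialises
  them to \<open>p\<close>.\<close>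

definition nearby :: "('m::topological_space, 'a) atlas \<Rightarrow> 'm \<Rightarrow> 'm filter" where
  "nearby M p = nhdsin (top_of_set (points M)) p"

lemma eventually_nearby:
  "p \<in> points M \<Longrightarrow>
    eventually P (nearby M p) \<longleftrightarrow> (\<exists>W. open_in M W \<and> p \<in> W \<and> (\<forall>q\<in>W. P q))"
  by (auto simp: nearby_def open_in_def eventually_nhdsin)

lemma open_in_subset_points: "open_in M W \<Longrightarrow> W \<subseteq> points M"
  unfolding open_in_def using openin_subset by fastforce

lemma open_in_Int: "open_in M V \<Longrightarrow> open_in M W \<Longrightarrow> open_in M (V \<inter> W)"
  unfolding open_in_def by blast

lemma nearby_self: "p \<in> points M \<Longrightarrow> eventually P (nearby M p) \<Longrightarrow> P p"
  by (auto simp: eventually_nearby)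

lemma open_in_nearby: "open_in M W \<Longrightarrow> p \<in> W \<Longrightarrow> \<forall>\<^sub>F q in nearby M p. q \<in> W"
  using eventually_nearby[of p M] open_in_subset_points by blast

lemma nearby_points: "p \<in> points M \<Longrightarrow> \<forall>\<^sub>F q in nearby M p. q \<in> points M"
  by (rule open_in_nearby) (simp_all add: open_in_def)

context
  fixes M :: "('m::{second_countable_topology, t2_space}, 'a::euclidean_space) atlas"
  assumes M: "smooth_manifold M"
begin

lemma chart_facts:
  assumes "(U, c) \<in> M"
  shows "open_in M U" "open (c ` U)" "inj_on c U" "U \<subseteq> points M"
    and "homeomorphism U (c ` U) c (inv_into U c)"
proof -
  show 1: "open_in M U" and "open (c ` U)" and h: "homeomorphism U (c ` U) c (inv_into U c)"
    using M assms unfolding smooth_manifold_def by blast+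
  show "inj_on c U"
    using h by (metis homeomorphism_def inj_on_inverseI)
  show "U \<subseteq> points M" by (rule open_in_subset_points[OF 1])
qed

lemma chart_inv: "(U, c) \<in> M \<Longrightarrow> q \<in> U \<Longrightarrow> inv_into U c (c q) = q"
  using chart_facts(3) by simp

lemma chart_image_open:
  assumes "(U, c) \<in> M" "open_in M W"
  shows "open (c ` (U \<inter> W))"
proof -
  have "openin (top_of_set (points M)) (U \<inter> W)"
    using open_in_Int[OF chart_facts(1)[OF assms(1)] assms(2)] by (simp add: open_in_def)
  then have "openin (top_of_set U) (U \<inter> W)"
    by (rule openin_subset_trans) (use chart_facts(4)[OF assms(1)] in auto)
  then have "openin (top_of_set (c ` U)) (c ` (U \<inter> W))"
    by (rule homeomorphism_imp_open_map[OF chart_facts(5)[OF assms(1)]])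
  then show ?thesis
    using chart_facts(2)[OF assms(1)] openin_open_trans by blast
qed

lemma chart_preimage_open:
  assumes "(U, c) \<in> M" "open T"
  shows "open_in M (U \<inter> c -` T)"
proof -
  have "openin (top_of_set U) (U \<inter> c -` T)"
    using chart_facts(5)[OF assms(1)] assms(2)
    by (simp add: homeomorphism_def continuous_openin_preimage_gen)
  then show ?thesis
    using chart_facts(1)[OF assms(1)] unfolding open_in_def by (rule openin_trans)
qed

text \<open>A chart is a homeomorphism from an open set onto an open set, so it carries
  neighbourhoods to neighbourhoods. Every local statement on the manifold is moved to the model
  space by this equivalence.\<close>

lemma nearby_chart_iff:
  assumes "(U, c) \<in> M" "p \<in> U"
  shows "eventually P (nearby M p) \<longleftrightarrow> (\<forall>\<^sub>F x in nhds (c p). P (inv_into U c x))"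
proof
  have p: "p \<in> points M" using chart_facts(4)[OF assms(1)] assms(2) by blast
  show "\<forall>\<^sub>F x in nhds (c p). P (inv_into U c x)" if ev: "eventually P (nearby M p)"
  proof -
    obtain W where W: "open_in M W" "p \<in> W" "\<forall>q\<in>W. P q"
      using ev unfolding eventually_nearby[OF p] by blast
    have "\<forall>x\<in>c ` (U \<inter> W). P (inv_into U c x)"
      using W chart_inv[OF assms(1)] by auto
    then show ?thesis
      unfolding eventually_nhds using chart_image_open[OF assms(1) W(1)] W(2) assms(2) by blast
  qed
  show "eventually P (nearby M p)" if ev: "\<forall>\<^sub>F x in nhds (c p). P (inv_into U c x)"
  proof -
    obtain T where T: "open T" "c p \<in> T" "\<forall>x\<in>T. P (inv_into U c x)"
      using ev by (auto simp: eventually_nhds)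
    have "\<forall>q\<in>U \<inter> c -` T. P q"
      using T chart_inv[OF assms(1)] by force
    then show ?thesis
      using chart_preimage_open[OF assms(1) T(1)] T(2) assms(2) p
      by (subst eventually_nearby) blast+
  qed
qed

lemma chart_near:
  assumes "(U, c) \<in> M" "p \<in> U"
  shows "\<forall>\<^sub>F x in nhds (c p). inv_into U c x \<in> U \<and> c (inv_into U c x) = x"
proof -
  have "\<forall>\<^sub>F x in nhds (c p). x \<in> c ` U"
    using chart_facts(2)[OF assms(1)] assms(2) eventually_nhds_in_open by blast
  then show ?thesis
    by eventually_elim (simp add: inv_into_into f_inv_into_f)
qed

lemma smooth_transition:
  assumes "(U, c) \<in> M" "(V, d) \<in> M" "p \<in> U" "p \<in> V"
  shows "smooth_at (d \<circ> inv_into U c) (c p)"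
proof -
  have "smooth_on (c ` (U \<inter> V)) (d \<circ> inv_into U c)"
    using M assms unfolding smooth_manifold_def by blast
  moreover have "open (c ` (U \<inter> V))"
    using chart_image_open[OF assms(1) chart_facts(1)[OF assms(2)]] .
  ultimately show ?thesis
    using assms unfolding smooth_at_def by blast
qed

lemma smooth_at_transition:
  assumes "(U, c) \<in> M" "(V, d) \<in> M" "p \<in> U" "p \<in> V" "smooth_at (f \<circ> inv_into U c) (c p)"
  shows "smooth_at (f \<circ> inv_into V d) (d p)"
proof (rule smooth_at_cong)
  show "smooth_at (\<lambda>x. (f \<circ> inv_into U c) ((c \<circ> inv_into V d) x)) (d p)"
    by (rule smooth_at_compose[OF smooth_transition[OF assms(2,1,4,3)]])
      (use assms(5) in \<open>simp add: chart_inv[OF assms(2,4)] o_def\<close>)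
  have "\<forall>\<^sub>F q in nearby M p. q \<in> U"
    using open_in_nearby chart_facts(1) assms by blast
  then show "\<forall>\<^sub>F x in nhds (d p). (f \<circ> inv_into U c) ((c \<circ> inv_into V d) x) = (f \<circ> inv_into V d) x"
    unfolding nearby_chart_iff[OF assms(2,4)]
    by eventually_elim (simp add: chart_inv[OF assms(1)])
qed

text \<open>Transition maps are smooth, so a test in a single chart around \<open>p\<close> decides
  smoothness in all charts of the atlas.\<close>

lemma smooth_fun_near_iff:
  assumes "(U, c) \<in> M" "p \<in> U"
  shows "smooth_fun_near M p f \<longleftrightarrow> smooth_at (f \<circ> inv_into U c) (c p)"
proof
  assume "smooth_fun_near M p f"
  then obtain W where "open_in M W" "p \<in> W" "smooth_fun M W f"
    unfolding smooth_fun_near_def by blast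
  then have "smooth_on (c ` (U \<inter> W)) (f \<circ> inv_into U c)" "open (c ` (U \<inter> W))" "c p \<in> c ` (U \<inter> W)"
    using assms chart_image_open unfolding smooth_fun_def by blast+
  then show "smooth_at (f \<circ> inv_into U c) (c p)"
    unfolding smooth_at_def by blast
next
  assume "smooth_at (f \<circ> inv_into U c) (c p)"
  then have "\<forall>\<^sub>F x in nhds (c p). smooth_at (f \<circ> inv_into U c) x"
    by (rule smooth_at_eventually)
  then obtain T where T: "open T" "c p \<in> T" "\<forall>x\<in>T. smooth_at (f \<circ> inv_into U c) x"
    by (auto simp: eventually_nhds)
  have "smooth_fun M (U \<inter> c -` T) f"
    unfolding smooth_fun_def
  proof (clarify)
    fix V d assume V: "(V, d) \<in> M"
    have "\<forall>x\<in>d ` (V \<inter> (U \<inter> c -` T)). smooth_at (f \<circ> inv_into V d) x"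
      using smooth_at_transition[OF assms(1) V] T(3) by blast
    then show "smooth_on (d ` (V \<inter> (U \<inter> c -` T))) (f \<circ> inv_into V d)"
      using smooth_on_iff_smooth_at[OF chart_image_open[OF V chart_preimage_open[OF assms(1) T(1)]]]
      by blast
  qed
  then show "smooth_fun_near M p f"
    unfolding smooth_fun_near_def using chart_preimage_open[OF assms(1) T(1)] T(2) assms(2) by blast
qed

lemma chart_atE:
  assumes "p \<in> points M"
  obtains U c where "chart_at M p = (U, c)" "(U, c) \<in> M" "p \<in> U"
proof -
  have "\<exists>C. C \<in> M \<and> p \<in> fst C"
    using assms by (force simp: points_def)
  then have "chart_at M p \<in> M \<and> p \<in> fst (chart_at M p)"
    unfolding chart_at_def by (rule someI_ex)
  then show ?thesis
    using that by (metis prod.collapse)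
qed

lemma smooth_fun_near_eventually:
  "p \<in> points M \<Longrightarrow> smooth_fun_near M p f \<Longrightarrow> \<forall>\<^sub>F q in nearby M p. smooth_fun_near M q f"
  unfolding smooth_fun_near_def by (auto simp: eventually_nearby)

lemma smooth_fun_iff:
  assumes "open_in M W"
  shows "smooth_fun M W f \<longleftrightarrow> (\<forall>q\<in>W. smooth_fun_near M q f)"
proof
  show "smooth_fun M W f \<Longrightarrow> \<forall>q\<in>W. smooth_fun_near M q f"
    using assms unfolding smooth_fun_near_def by blast
  assume *: "\<forall>q\<in>W. smooth_fun_near M q f"
  show "smooth_fun M W f"
    unfolding smooth_fun_def
  proof clarify
    fix U c assume U: "(U, c) \<in> M"
    then have "\<forall>x\<in>c ` (U \<inter> W). smooth_at (f \<circ> inv_into U c) x"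
      using * smooth_fun_near_iff[OF U] by blast
    then show "smooth_on (c ` (U \<inter> W)) (f \<circ> inv_into U c)"
      using smooth_on_iff_smooth_at[OF chart_image_open[OF U assms]] by blast
  qed
qed

lemma smooth_chart: "(U, c) \<in> M \<Longrightarrow> p \<in> U \<Longrightarrow> smooth_fun_near M p c"
  using smooth_fun_near_iff smooth_transition by blast

section \<open>Algebra of smooth germs and their derivatives along tangent vectors\<close>

context
  fixes p :: 'm
  assumes p: "p \<in> points M"
begin

lemma smooth_fun_near_cong:
  assumes "smooth_fun_near M p f" "\<forall>\<^sub>F q in nearby M p. f q = g q"
  shows "smooth_fun_near M p g"
proof -
  obtain U c where U: "(U, c) \<in> M" "p \<in> U" using chart_atE[OF p] by blast
  show ?thesis
    using smooth_at_cong[of "f \<circ> inv_into U c" "c p" "g \<circ> inv_into U c"] assms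
    unfolding smooth_fun_near_iff[OF U] nearby_chart_iff[OF U] by simp
qed

lemma smooth_fun_near_const: "smooth_fun_near M p (\<lambda>q. k)"
  by (rule chart_atE[OF p]) (simp add: smooth_fun_near_iff smooth_at_const o_def)

lemma smooth_fun_near_bilinear:
  assumes "bounded_bilinear B" "smooth_fun_near M p f" "smooth_fun_near M p g"
  shows "smooth_fun_near M p (\<lambda>q. B (f q) (g q))"
  by (rule chart_atE[OF p])
    (use smooth_at_bilinear[OF assms(1)] assms(2,3) in \<open>simp add: smooth_fun_near_iff o_def\<close>)

lemmas smooth_fun_near_mult = smooth_fun_near_bilinear[OF bounded_bilinear_mult]
lemmas smooth_fun_near_scaleR = smooth_fun_near_bilinear[OF bounded_bilinear_scaleR]

lemma smooth_fun_near_linear: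
  assumes "bounded_linear L" "smooth_fun_near M p f"
  shows "smooth_fun_near M p (\<lambda>q. L (f q))"
  by (rule chart_atE[OF p])
    (use smooth_at_bounded_linear[OF assms(1)] assms(2) in \<open>simp add: smooth_fun_near_iff o_def\<close>)

lemma smooth_fun_near_add:
  assumes "smooth_fun_near M p f" "smooth_fun_near M p g"
  shows "smooth_fun_near M p (\<lambda>q. f q + g q)"
  by (rule chart_atE[OF p]) (use assms in \<open>simp add: smooth_fun_near_iff smooth_at_add o_def\<close>)

lemma smooth_fun_near_sum:
  assumes "\<And>i. i \<in> I \<Longrightarrow> smooth_fun_near M p (f i)"
  shows "smooth_fun_near M p (\<lambda>q. \<Sum>i\<in>I. f i q)"
  using assms
  by (induction I rule: infinite_finite_induct) (auto simp: smooth_fun_near_const intro!: smooth_fun_near_add)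

lemma smooth_fun_near_compose:
  fixes f :: "'m \<Rightarrow> 'c::euclidean_space"
  assumes "smooth_fun_near M p f" "smooth_at h (f p)"
  shows "smooth_fun_near M p (\<lambda>q. h (f q))"
proof -
  obtain U c where U: "(U, c) \<in> M" "p \<in> U" using chart_atE[OF p] by blast
  show ?thesis
    using smooth_at_compose[of "f \<circ> inv_into U c" "c p" h] assms
    by (simp add: smooth_fun_near_iff[OF U] chart_inv[OF U] o_def)
qed

lemma smooth_fun_near_continuous:
  assumes "smooth_fun_near M p f" "open S" "f p \<in> S"
  shows "\<forall>\<^sub>F q in nearby M p. f q \<in> S"
proof -
  obtain U c where U: "(U, c) \<in> M" "p \<in> U" using chart_atE[OF p] by blast
  have "isCont (f \<circ> inv_into U c) (c p)"
    using assms(1) smooth_at_continuous unfolding smooth_fun_near_iff[OF U] by blast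
  then have "((f \<circ> inv_into U c) \<longlongrightarrow> f p) (nhds (c p))"
    using tendsto_at_iff_tendsto_nhds[of "f \<circ> inv_into U c" "c p"] chart_inv[OF U]
    by (simp add: isCont_def)
  then have "\<forall>\<^sub>F x in nhds (c p). (f \<circ> inv_into U c) x \<in> S"
    using assms(2,3) by (rule topological_tendstoD)
  then show ?thesis by (simp add: nearby_chart_iff[OF U])
qed

lemma has_derivative_dfun:
  assumes "chart_at M p = (U, c)" "smooth_fun_near M p f"
  shows "((f \<circ> inv_into U c) has_derivative dfun M p f) (at (c p))"
proof -
  have "(U, c) \<in> M" "p \<in> U" using chart_atE[OF p] assms(1) by auto
  then have "(f \<circ> inv_into U c) differentiable at (c p)"
    using assms(2) smooth_at_differentiable smooth_fun_near_iff by blast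
  moreover have "dfun M p f = frechet_derivative (f \<circ> inv_into U c) (at (c p))"
    using assms(1) by (auto simp: dfun_def)
  ultimately show ?thesis
    by (simp add: frechet_derivative_works)
qed

lemma dfun_eqI:
  assumes "chart_at M p = (U, c)" "((f \<circ> inv_into U c) has_derivative L) (at (c p))"
  shows "dfun M p f = L"
  using frechet_derivative_at[OF assms(2)] assms(1) by (auto simp: dfun_def)

lemma linear_dfun: "smooth_fun_near M p f \<Longrightarrow> linear (dfun M p f)"
  by (rule chart_atE[OF p]) (blast dest: has_derivative_dfun has_derivative_linear)

lemma dfun_cong:
  assumes "smooth_fun_near M p f" "\<forall>\<^sub>F q in nearby M p. f q = g q"
  shows "dfun M p g = dfun M p f"
proof -
  obtain U c where U: "chart_at M p = (U, c)" "(U, c) \<in> M" "p \<in> U" using chart_atE[OF p] by blast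
  have ev: "\<forall>\<^sub>F x in nhds (c p). (f \<circ> inv_into U c) x = (g \<circ> inv_into U c) x"
    using assms(2) by (simp add: nearby_chart_iff[OF U(2,3)])
  have "((g \<circ> inv_into U c) has_derivative dfun M p f) (at (c p))"
    by (rule has_derivative_transform_eventually[OF has_derivative_dfun[OF U(1) assms(1)]])
      (use ev eventually_nhds_x_imp_x[OF ev] eventually_nhds_conv_at in auto)
  then show ?thesis by (rule dfun_eqI[OF U(1)])
qed

lemma dfun_const: "dfun M p (\<lambda>q. k) v = 0"
  by (rule chart_atE[OF p]) (simp add: dfun_def o_def)

lemma dfun_bounded_linear:
  assumes "bounded_linear L" "smooth_fun_near M p f"
  shows "dfun M p (\<lambda>q. L (f q)) v = L (dfun M p f v)"
proof -
  obtain U c where U: "chart_at M p = (U, c)" "(U, c) \<in> M" "p \<in> U" using chart_atE[OF p] by blast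
  have "(((\<lambda>q. L (f q)) \<circ> inv_into U c) has_derivative (\<lambda>v. L (dfun M p f v))) (at (c p))"
    using bounded_linear.has_derivative[OF assms(1) has_derivative_dfun[OF U(1) assms(2)]]
    by (simp add: o_def)
  from dfun_eqI[OF U(1) this] show ?thesis by simp
qed

text \<open>The chain rule through the transition from the chart fixed at \<open>p\<close> to an
  arbitrary chart \<open>d\<close>. It undoes the discontinuous choice of \<open>chart_at\<close>:
  the tangent vector enters through its components in \<open>d\<close> alone, and \<open>d\<close>
  can be kept while \<open>p\<close> moves.\<close>

lemma dfun_chart:
  assumes "(V, d) \<in> M" "p \<in> V" "smooth_fun_near M p f"
  shows "dfun M p f v = frechet_derivative (f \<circ> inv_into V d) (at (d p)) (dfun M p d v)"
proof -
  obtain U c where U: "chart_at M p = (U, c)" "(U, c) \<in> M" "p \<in> U" using chart_atE[OF p] by blast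
  have d: "((d \<circ> inv_into U c) has_derivative dfun M p d) (at (c p))"
    by (rule has_derivative_dfun[OF U(1) smooth_chart[OF assms(1,2)]])
  have f: "((f \<circ> inv_into V d) has_derivative frechet_derivative (f \<circ> inv_into V d) (at (d p))) (at (d p))"
    using smooth_at_differentiable[OF assms(3)[unfolded smooth_fun_near_iff[OF assms(1,2)]]]
    by (simp add: frechet_derivative_works)
  have "\<forall>\<^sub>F q in nearby M p. q \<in> V"
    using open_in_nearby chart_facts(1) assms by blast
  then have ev: "\<forall>\<^sub>F x in nhds (c p). ((f \<circ> inv_into V d) \<circ> (d \<circ> inv_into U c)) x = (f \<circ> inv_into U c) x"
    unfolding nearby_chart_iff[OF U(2,3)]
    by eventually_elim (simp add: chart_inv[OF assms(1)])
  have "(((f \<circ> inv_into V d) \<circ> (d \<circ> inv_into U c)) has_derivative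
      frechet_derivative (f \<circ> inv_into V d) (at (d p)) \<circ> dfun M p d) (at (c p))"
    by (rule diff_chain_at[OF d]) (use f chart_inv[OF U(2,3)] in simp)
  then have "((f \<circ> inv_into U c) has_derivative
      frechet_derivative (f \<circ> inv_into V d) (at (d p)) \<circ> dfun M p d) (at (c p))"
    by (rule has_derivative_transform_eventually)
      (use ev eventually_nhds_x_imp_x[OF ev] eventually_nhds_conv_at in auto)
  from dfun_eqI[OF U(1) this] show ?thesis by simp
qed

lemma dfun_chart_self:
  assumes "chart_at M p = (U, c)"
  shows "dfun M p c v = v"
proof -
  have U: "(U, c) \<in> M" "p \<in> U" using chart_atE[OF p] assms by auto
  have ev: "\<forall>\<^sub>F x in nhds (c p). x = (c \<circ> inv_into U c) x"
    using chart_near[OF U] by eventually_elim simp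
  have "((\<lambda>x. x) has_derivative (\<lambda>x. x)) (at (c p))" by (rule has_derivative_ident)
  then have "((c \<circ> inv_into U c) has_derivative (\<lambda>x. x)) (at (c p))"
    by (rule has_derivative_transform_eventually)
      (use ev eventually_nhds_x_imp_x[OF ev] eventually_nhds_conv_at in auto)
  from dfun_eqI[OF assms this] show ?thesis by simp
qed

text \<open>The derivative of the transition back to the chart fixed at \<open>p\<close> is a left
  inverse, and an injective linear map of the model space into itself is bijective.\<close>

lemma bij_dfun_chart:
  assumes "(V, d) \<in> M" "p \<in> V"
  shows "bij (dfun M p d)"
proof -
  obtain U c where U: "chart_at M p = (U, c)" "(U, c) \<in> M" "p \<in> U" using chart_atE[OF p] by blast
  have "v = frechet_derivative (c \<circ> inv_into V d) (at (d p)) (dfun M p d v)" for v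
    using dfun_chart[OF assms smooth_chart[OF U(2,3)]] dfun_chart_self[OF U(1)] by metis
  then have "inj (dfun M p d)"
    by (metis injI)
  moreover have "linear (dfun M p d)"
    by (rule linear_dfun[OF smooth_chart[OF assms]])
  ultimately show ?thesis
    using linear_injective_imp_surjective by (auto simp: bij_def)
qed

end

text \<open>In one fixed chart X f is the sum of the components of X times the partial derivatives
  of f, all of them smooth. Only components in that one chart are assumed, so the lemma is available
  before the notion of smooth field is known to be independent of the chart.\<close>

lemma smooth_fun_near_dfun_component:
  assumes "(V, d) \<in> M" "p \<in> V" "smooth_fun_near M p f"
    and "smooth_fun_near M p (\<lambda>q. dfun M q d (X q))"
  shows "smooth_fun_near M p (\<lambda>q. dfun M q f (X q))"
proof -
  let ?F = "\<lambda>b q. frechet_derivative (f \<circ> inv_into V d) (at (d q)) b"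
  have p: "p \<in> points M" using assms(1,2) chart_facts(4) by blast
  have "smooth_at (f \<circ> inv_into V d) (d p)"
    using assms(3) smooth_fun_near_iff[OF assms(1,2)] by blast
  then have F: "smooth_fun_near M p (?F b)" for b
    by (intro smooth_fun_near_compose[OF p smooth_chart[OF assms(1,2)],
          where h = "\<lambda>x. frechet_derivative (f \<circ> inv_into V d) (at x) b"] smooth_at_frechet_derivative)
  have "\<forall>\<^sub>F q in nearby M p. q \<in> V"
    using open_in_nearby chart_facts(1) assms by blast
  moreover have "\<forall>\<^sub>F q in nearby M p. smooth_fun_near M q f"
    using smooth_fun_near_eventually p assms(3) by blast
  moreover note nearby_points[OF p]
  ultimately have ev: "\<forall>\<^sub>F q in nearby M p.
      (\<Sum>b\<in>Basis. (dfun M q d (X q) \<bullet> b) *\<^sub>R ?F b q) = dfun M q f (X q)"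
  proof eventually_elim
    case (elim q)
    have "linear (frechet_derivative (f \<circ> inv_into V d) (at (d q)))"
      using elim smooth_fun_near_iff[OF assms(1)] smooth_at_differentiable linear_frechet_derivative by blast
    then show ?case
      using dfun_chart[OF elim(3) assms(1) elim(1,2)] linear_expand by metis
  qed
  show ?thesis
    by (rule smooth_fun_near_cong[OF p _ ev])
      (intro smooth_fun_near_sum[OF p] smooth_fun_near_scaleR[OF p] F
        smooth_fun_near_linear[OF p bounded_linear_inner_left] assms(4))
qed

text \<open>The components of a field in another chart \<open>d\<close> are the derivatives of the
  function \<open>d\<close> along the field, so smooth components in one chart give smooth
  components in all.\<close>

lemma smooth_vf_near_iff:
  assumes "(U, c) \<in> M" "p \<in> U"
  shows "smooth_vf_near M p X \<longleftrightarrow> smooth_fun_near M p (\<lambda>q. dfun M q c (X q))"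
proof
  assume "smooth_vf_near M p X"
  then obtain W where "open_in M W" "p \<in> W" "smooth_vf M W X"
    unfolding smooth_vf_near_def by blast
  then have "smooth_fun M (U \<inter> W) (\<lambda>q. dfun M q c (X q))" "open_in M (U \<inter> W)" "p \<in> U \<inter> W"
    using assms open_in_Int chart_facts(1) unfolding smooth_vf_def by blast+
  then show "smooth_fun_near M p (\<lambda>q. dfun M q c (X q))"
    unfolding smooth_fun_near_def by blast
next
  assume "smooth_fun_near M p (\<lambda>q. dfun M q c (X q))"
  then obtain W where W: "open_in M W" "p \<in> W" "smooth_fun M W (\<lambda>q. dfun M q c (X q))"
    unfolding smooth_fun_near_def by blast
  have *: "\<forall>q\<in>U \<inter> W. smooth_fun_near M q (\<lambda>q. dfun M q c (X q))"
    using W smooth_fun_iff by blast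
  have UW: "open_in M (U \<inter> W)" using W(1) chart_facts(1)[OF assms(1)] open_in_Int by blast
  have "smooth_vf M (U \<inter> W) X"
    unfolding smooth_vf_def
  proof clarify
    fix V d assume V: "(V, d) \<in> M"
    have "open_in M (V \<inter> (U \<inter> W))" using UW V chart_facts(1) open_in_Int by blast
    then show "smooth_fun M (V \<inter> (U \<inter> W)) (\<lambda>q. dfun M q d (X q))"
      using smooth_fun_iff smooth_fun_near_dfun_component[OF assms(1) _ smooth_chart[OF V]] * by blast
  qed
  then show "smooth_vf_near M p X"
    unfolding smooth_vf_near_def using UW W assms by blast
qed

lemma smooth_vf_iff:
  assumes "open_in M W"
  shows "smooth_vf M W X \<longleftrightarrow> (\<forall>q\<in>W. smooth_vf_near M q X)"
proof
  show "smooth_vf M W X \<Longrightarrow> \<forall>q\<in>W. smooth_vf_near M q X"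
    using assms unfolding smooth_vf_near_def by blast
  assume *: "\<forall>q\<in>W. smooth_vf_near M q X"
  show "smooth_vf M W X"
    unfolding smooth_vf_def
  proof clarify
    fix U c assume U: "(U, c) \<in> M"
    then have "open_in M (U \<inter> W)" using assms chart_facts(1) open_in_Int by blast
    then show "smooth_fun M (U \<inter> W) (\<lambda>q. dfun M q c (X q))"
      using smooth_fun_iff smooth_vf_near_iff[OF U] * by blast
  qed
qed

lemma smooth_vf_near_eventually:
  "p \<in> points M \<Longrightarrow> smooth_vf_near M p X \<Longrightarrow> \<forall>\<^sub>F q in nearby M p. smooth_vf_near M q X"
  unfolding smooth_vf_near_def by (auto simp: eventually_nearby)

section \<open>Local vector fields and their extensions\<close>

context
  fixes p :: 'm
  assumes p: "p \<in> points M"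
begin

lemma smooth_fun_near_dfun:
  assumes "smooth_fun_near M p f" "smooth_vf_near M p X"
  shows "smooth_fun_near M p (\<lambda>q. dfun M q f (X q))"
  by (rule chart_atE[OF p]) (use assms smooth_fun_near_dfun_component smooth_vf_near_iff in blast)

lemma smooth_vf_near_cong:
  assumes "smooth_vf_near M p X" "\<forall>\<^sub>F q in nearby M p. X q = Y q"
  shows "smooth_vf_near M p Y"
proof -
  obtain U c where U: "(U, c) \<in> M" "p \<in> U" using chart_atE[OF p] by blast
  show ?thesis
    unfolding smooth_vf_near_iff[OF U]
    by (rule smooth_fun_near_cong[OF p assms(1)[unfolded smooth_vf_near_iff[OF U]]])
      (use assms(2) in eventually_elim, simp)
qed

lemma linear_component_near:
  assumes "(U, c) \<in> M" "p \<in> U"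
  shows "\<forall>\<^sub>F q in nearby M p. linear (dfun M q c) \<and> bij (dfun M q c)"
proof -
  have "\<forall>\<^sub>F q in nearby M p. q \<in> U"
    using open_in_nearby chart_facts(1) assms by blast
  with nearby_points[OF p] show ?thesis
    by eventually_elim (use assms linear_dfun smooth_chart bij_dfun_chart in blast)
qed

lemma smooth_vf_near_add:
  assumes "smooth_vf_near M p X" "smooth_vf_near M p Y"
  shows "smooth_vf_near M p (\<lambda>q. X q + Y q)"
proof -
  obtain U c where U: "(U, c) \<in> M" "p \<in> U" using chart_atE[OF p] by blast
  have ev: "\<forall>\<^sub>F q in nearby M p. dfun M q c (X q) + dfun M q c (Y q) = dfun M q c (X q + Y q)"
    using linear_component_near[OF U] by eventually_elim (simp add: linear_add)
  show ?thesis
    using smooth_fun_near_cong[OF p smooth_fun_near_add[OF p] ev] assms by (simp add: smooth_vf_near_iff[OF U])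
qed

lemma smooth_vf_near_scaleR:
  assumes "smooth_fun_near M p f" "smooth_vf_near M p X"
  shows "smooth_vf_near M p (\<lambda>q. f q *\<^sub>R X q)"
proof -
  obtain U c where U: "(U, c) \<in> M" "p \<in> U" using chart_atE[OF p] by blast
  have ev: "\<forall>\<^sub>F q in nearby M p. f q *\<^sub>R dfun M q c (X q) = dfun M q c (f q *\<^sub>R X q)"
    using linear_component_near[OF U] by eventually_elim (simp add: linear_scale)
  show ?thesis
    using smooth_fun_near_cong[OF p smooth_fun_near_scaleR[OF p] ev] assms by (simp add: smooth_vf_near_iff[OF U])
qed

lemma smooth_vf_near_zero: "smooth_vf_near M p (\<lambda>q. 0)"
proof -
  obtain U c where U: "(U, c) \<in> M" "p \<in> U" using chart_atE[OF p] by blast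
  have ev: "\<forall>\<^sub>F q in nearby M p. 0 = dfun M q c 0"
    using linear_component_near[OF U] by eventually_elim (simp add: linear_0)
  show ?thesis
    using smooth_fun_near_cong[OF p smooth_fun_near_const[OF p] ev] by (simp add: smooth_vf_near_iff[OF U])
qed

lemma smooth_vf_near_sum:
  assumes "\<And>i. i \<in> I \<Longrightarrow> smooth_vf_near M p (X i)"
  shows "smooth_vf_near M p (\<lambda>q. \<Sum>i\<in>I. X i q)"
  using assms
  by (induction I rule: infinite_finite_induct) (auto simp: smooth_vf_near_zero intro!: smooth_vf_near_add)

text \<open>These are the coordinate vector fields of the chart. Their components are constant in
  this chart, hence they are smooth, although as functions into the model space they need not even
  be continuous.\<close>

lemma coordinate_fields:
  assumes "(U, c) \<in> M" "p \<in> U"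
  obtains P where "\<And>b q. q \<in> U \<Longrightarrow> smooth_vf_near M q (P b)"
    "\<And>b q. q \<in> U \<Longrightarrow> dfun M q c (P b q) = b"
    "\<And>q v. q \<in> U \<Longrightarrow> v = (\<Sum>b\<in>Basis. (dfun M q c v \<bullet> b) *\<^sub>R P b q)"
proof
  let ?P = "\<lambda>b q. inv (dfun M q c) b"
  have U: "q \<in> points M" if "q \<in> U" for q
    using that assms chart_facts(4) by blast
  have bij: "bij (dfun M q c)" and lin: "linear (dfun M q c)" if "q \<in> U" for q
    using that U assms linear_dfun smooth_chart bij_dfun_chart by blast+
  show 1: "dfun M q c (?P b q) = b" if "q \<in> U" for b q
    using bij[OF that] by (simp add: bij_is_surj surj_f_inv_f)
  show "smooth_vf_near M q (?P b)" if "q \<in> U" for b q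
  proof -
    have "\<forall>\<^sub>F q in nearby M q. q \<in> U"
      using open_in_nearby chart_facts(1) assms that by blast
    then have ev: "\<forall>\<^sub>F q in nearby M q. b = dfun M q c (?P b q)"
      by eventually_elim (simp add: 1)
    show ?thesis
      using smooth_fun_near_cong[OF U[OF that] smooth_fun_near_const[OF U[OF that]] ev]
      by (simp add: smooth_vf_near_iff[OF assms(1) that])
  qed
  show "v = (\<Sum>b\<in>Basis. (dfun M q c v \<bullet> b) *\<^sub>R ?P b q)" if "q \<in> U" for q v
  proof (rule injD[OF bij_is_inj[OF bij[OF that]]])
    show "dfun M q c v = dfun M q c (\<Sum>b\<in>Basis. (dfun M q c v \<bullet> b) *\<^sub>R ?P b q)"
      by (simp add: linear_sum[OF lin[OF that]] linear_scale[OF lin[OF that]] 1[OF that]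
          euclidean_representation)
  qed
qed

text \<open>A combination of coordinate fields with constant coefficients. It justifies the choice
  made in \<open>extension\<close>.\<close>

lemma smooth_vf_near_ex: "\<exists>X. smooth_vf_near M p X \<and> X p = v"
proof -
  obtain U c where U: "(U, c) \<in> M" "p \<in> U" using chart_atE[OF p] by blast
  obtain P where P: "\<And>b q. q \<in> U \<Longrightarrow> smooth_vf_near M q (P b)"
    "\<And>q v. q \<in> U \<Longrightarrow> v = (\<Sum>b\<in>Basis. (dfun M q c v \<bullet> b) *\<^sub>R P b q)"
    using coordinate_fields[OF U] by metis
  let ?X = "\<lambda>q. \<Sum>b\<in>Basis. (dfun M p c v \<bullet> b) *\<^sub>R P b q"
  have "smooth_vf_near M p ?X"
    by (intro smooth_vf_near_sum smooth_vf_near_scaleR smooth_fun_near_const p P U)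
  moreover have "?X p = v" using P(2)[OF U(2), of v] by simp
  ultimately show ?thesis by (intro exI[of _ ?X]) simp
qed

lemma extension_spec:
  "smooth_vf_near M p (extension M p v)" "extension M p v p = v"
  using someI_ex[OF smooth_vf_near_ex[of v]] by (simp_all add: extension_def)

end

end

section \<open>Positive definite symmetric bilinear forms\<close>

text \<open>The metric at a point is unrelated to the inner product of the model space, so
  orthogonality is developed for an arbitrary positive definite form.\<close>

definition inner_form :: "('a::euclidean_space \<Rightarrow> 'a \<Rightarrow> real) \<Rightarrow> bool" where
  "inner_form g \<longleftrightarrow> bilinear g \<and> (\<forall>u v. g u v = g v u) \<and> (\<forall>v. v \<noteq> 0 \<longrightarrow> 0 < g v v)"

text \<open>The index set is of arbitrary type, so that frames of two complementary spaces can later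
  be joined along a sum of index sets.\<close>

definition orthonormal_family :: "('a \<Rightarrow> 'a \<Rightarrow> real) \<Rightarrow> 'i set \<Rightarrow> ('i \<Rightarrow> 'a) \<Rightarrow> bool" where
  "orthonormal_family g I e \<longleftrightarrow> finite I \<and> (\<forall>i\<in>I. \<forall>j\<in>I. g (e i) (e j) = (if i = j then 1 else 0))"

lemma bilinear_sum_left:
  assumes "bilinear h"
  shows "h (\<Sum>i\<in>I. x i) y = (\<Sum>i\<in>I. h (x i) y)"
  using linear_sum[of "\<lambda>x. h x y" x I] assms by (simp add: bilinear_def)

lemma bilinear_sum_right:
  assumes "bilinear h"
  shows "h y (\<Sum>i\<in>I. x i) = (\<Sum>i\<in>I. h y (x i))"
  using linear_sum[of "h y" x I] assms by (simp add: bilinear_def)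

lemmas bilinear_expand = bilinear_ladd bilinear_radd bilinear_lsub bilinear_rsub
  bilinear_lmul bilinear_rmul bilinear_lneg bilinear_rneg bilinear_lzero bilinear_rzero
  bilinear_sum_left bilinear_sum_right

context
  fixes g :: "'a::euclidean_space \<Rightarrow> 'a \<Rightarrow> real"
  assumes g: "inner_form g"
begin

lemma inner_form_bilinear: "bilinear g" and inner_form_commute: "g u v = g v u"
  and inner_form_pos: "v \<noteq> 0 \<Longrightarrow> 0 < g v v"
  using g by (auto simp: inner_form_def)

lemma inner_form_eq_0: "g v v = 0 \<longleftrightarrow> v = 0"
  using inner_form_pos[of v] bilinear_lzero[OF inner_form_bilinear] by fastforce

lemma orthogonal_span:
  assumes "\<And>x. x \<in> S \<Longrightarrow> g w x = 0" "x \<in> span S"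
  shows "g w x = 0"
  using assms(2)
  by (induction rule: span_induct_alt) (simp_all add: assms(1) bilinear_expand[OF inner_form_bilinear])

text \<open>Induction over a finite spanning set: the new vector b is first made orthogonal to the
  old span, by subtracting its own projection c, and then the projection of u is corrected along b -
  c.\<close>

lemma orthogonal_decomposition:
  assumes "subspace V"
  shows "\<exists>w\<in>V. \<forall>v\<in>V. g (u - w) v = 0"
proof -
  have "\<exists>w\<in>span B. \<forall>v\<in>span B. g (u - w) v = 0" if "finite B" for B :: "'a set" and u
    using that
  proof (induction B arbitrary: u)
    case empty
    then show ?case by (simp add: bilinear_rzero[OF inner_form_bilinear])
  next
    case (insert b B)
    obtain c where c: "c \<in> span B" "\<And>v. v \<in> span B \<Longrightarrow> g (b - c) v = 0" using insert.IH[of b] by blast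
    obtain w where w: "w \<in> span B" "\<And>v. v \<in> span B \<Longrightarrow> g (u - w) v = 0" using insert.IH[of u] by blast
    \<comment> \<open>When b already lies in the old span, b - c vanishes and division by zero makes
      \<open>k\<close> equal to 0, which is the right coefficient.\<close>
    define k where "k = g u (b - c) / g (b - c) (b - c)"
    let ?w = "w + k *\<^sub>R (b - c)"
    have "g w (b - c) = 0" using c(2)[OF w(1)] inner_form_commute by metis
    moreover have "k * g (b - c) (b - c) = g u (b - c)"
      using inner_form_eq_0[of "b - c"]
      by (cases "b - c = 0") (simp_all add: k_def bilinear_rzero[OF inner_form_bilinear])
    ultimately have bc: "g (u - ?w) (b - c) = 0"
      by (simp only: bilinear_lsub[OF inner_form_bilinear] bilinear_ladd[OF inner_form_bilinear]
          bilinear_lmul[OF inner_form_bilinear]) simp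
    have B: "g (u - ?w) v = 0" if "v \<in> span B" for v
    proof -
      have "g (u - ?w) v = g (u - w) v - k * g (b - c) v"
        by (simp only: diff_diff_eq[symmetric] bilinear_lsub[OF inner_form_bilinear]
            bilinear_lmul[OF inner_form_bilinear, of k])
           (simp add: bilinear_expand[OF inner_form_bilinear])
      then show ?thesis using c(2) w(2) that by simp
    qed
    have "g (u - ?w) b = g (u - ?w) (b - c) + g (u - ?w) c"
      by (simp only: bilinear_radd[OF inner_form_bilinear, symmetric]) simp
    then have "g (u - ?w) b = 0" using bc B[OF c(1)] by simp
    then have "\<forall>v\<in>span (insert b B). g (u - ?w) v = 0"
      using B span_base orthogonal_span[of "insert b B" "u - ?w"] by blast
    moreover have "?w \<in> span (insert b B)"
      using c(1) w(1) span_mono[of B "insert b B"]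
      by (intro span_add span_scale span_diff) (auto intro: span_base)
    ultimately show ?case by blast
  qed
  moreover obtain B where "finite B" "span B = V"
    using assms finiteI_independent basis_exists span_eq_iff
    by (metis independent_imp_finite span_subspace)
  ultimately show ?thesis by metis
qed

lemma orthonormal_residual:
  assumes "orthonormal_family g I e" "j \<in> I"
  shows "g (u - (\<Sum>i\<in>I. g u (e i) *\<^sub>R e i)) (e j) = 0"
proof -
  let ?s = "\<Sum>i\<in>I. g u (e i) *\<^sub>R e i"
  have "g ?s (e j) = (\<Sum>i\<in>I. g u (e i) * g (e i) (e j))"
    by (simp add: bilinear_sum_left[OF inner_form_bilinear] bilinear_lmul[OF inner_form_bilinear])
  also have "\<dots> = (\<Sum>i\<in>I. g u (e i) * (if i = j then 1 else 0))"
    by (rule sum.cong[OF refl]) (use assms in \<open>auto simp: orthonormal_family_def\<close>)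
  also have "\<dots> = g u (e j)"
    using assms by (simp add: orthonormal_family_def if_distrib cong: if_cong)
  finally show ?thesis by (simp add: bilinear_lsub[OF inner_form_bilinear])
qed

lemma orthonormal_expand:
  assumes "orthonormal_family g I e" "u \<in> span (e ` I)"
  shows "u = (\<Sum>i\<in>I. g u (e i) *\<^sub>R e i)"
proof -
  let ?s = "\<Sum>i\<in>I. g u (e i) *\<^sub>R e i"
  have "u - ?s \<in> span (e ` I)"
    using assms(2) by (intro span_diff span_sum span_scale) (auto intro: span_base)
  then have "g (u - ?s) (u - ?s) = 0"
    using orthogonal_span[of "e ` I"] orthonormal_residual[OF assms(1)] by blast
  then show ?thesis using inner_form_eq_0 by simp
qed

lemma gram_schmidt_step:
  assumes e: "orthonormal_family g {..<r} e"
    and y: "y = z - (\<Sum>i<r. g z (e i) *\<^sub>R e i)" "y \<noteq> 0" and e': "e' = inverse (sqrt (g y y)) *\<^sub>R y"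
  shows "orthonormal_family g {..<Suc r} (e(r := e'))"
    and "span ((e(r := e')) ` {..<Suc r}) = span (insert z (e ` {..<r}))"
proof -
  have pos: "0 < g y y" by (rule inner_form_pos[OF y(2)])
  have "g e' e' = 1"
    using pos by (simp add: e' bilinear_lmul[OF inner_form_bilinear] bilinear_rmul[OF inner_form_bilinear]
        field_simps)
  moreover have "g e' (e j) = 0" "g (e j) e' = 0" if "j < r" for j
  proof -
    have "g y (e j) = 0" using orthonormal_residual[OF e, of j z] that y(1) by simp
    then show "g e' (e j) = 0" by (simp add: e' bilinear_lmul[OF inner_form_bilinear])
    then show "g (e j) e' = 0" using inner_form_commute by metis
  qed
  ultimately show "orthonormal_family g {..<Suc r} (e(r := e'))"
    using e by (auto simp: orthonormal_family_def less_Suc_eq)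
  let ?s = "\<Sum>i<r. g z (e i) *\<^sub>R e i"
  have s: "?s \<in> span (insert x (e ` {..<r}))" for x
    by (intro span_sum span_scale) (auto intro: span_base)
  have im: "(e(r := e')) ` {..<Suc r} = insert e' (e ` {..<r})"
    by (auto simp: less_Suc_eq)
  show "span ((e(r := e')) ` {..<Suc r}) = span (insert z (e ` {..<r}))"
    unfolding im
    span_eq
  proof
    have "e' \<in> span (insert z (e ` {..<r}))"
      unfolding e' y(1) by (intro span_scale span_diff s) (auto intro: span_base)
    then show "insert e' (e ` {..<r}) \<subseteq> span (insert z (e ` {..<r}))"
      by (auto intro: span_base)
    have "z = sqrt (g y y) *\<^sub>R e' + ?s"
      using pos y(1) by (simp add: e')
    also have "\<dots> \<in> span (insert e' (e ` {..<r}))"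
      by (intro span_add span_scale s) (auto intro: span_base)
    finally show "insert z (e ` {..<r}) \<subseteq> span (insert e' (e ` {..<r}))"
      by (auto intro: span_base)
  qed
qed

text \<open>Pairing a linear relation with a member of the family extracts its coefficient, so the
  family is independent; the rest is a dimension count.\<close>

lemma orthonormal_span_eq:
  assumes "orthonormal_family g I e" "subspace S" "\<And>i. i \<in> I \<Longrightarrow> e i \<in> S" "dim S \<le> card I"
  shows "span (e ` I) = S"
proof -
  have fin: "finite I" using assms(1) by (simp add: orthonormal_family_def)
  have inj: "inj_on e I"
  proof (rule inj_onI)
    fix i j assume ij: "i \<in> I" "j \<in> I" and eq: "e i = e j"
    have "g (e i) (e j) = (if i = j then 1 else 0)" "g (e i) (e i) = 1"
      using assms(1) ij unfolding orthonormal_family_def by simp_all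
    then show "i = j" using eq by (metis zero_neq_one)
  qed
  have "independent (e ` I)"
  proof (rule independent_if_scalars_zero)
    fix k x assume 0: "(\<Sum>x\<in>e ` I. k x *\<^sub>R x) = 0" and "x \<in> e ` I"
    then obtain j where j: "j \<in> I" "x = e j" by blast
    have "0 = g (\<Sum>i\<in>I. k (e i) *\<^sub>R e i) (e j)"
      using 0 by (simp add: sum.reindex[OF inj] bilinear_lzero[OF inner_form_bilinear])
    also have "\<dots> = (\<Sum>i\<in>I. k (e i) * g (e i) (e j))"
      using j by (simp add: bilinear_sum_left[OF inner_form_bilinear] bilinear_lmul[OF inner_form_bilinear])
    also have "\<dots> = (\<Sum>i\<in>I. k (e i) * (if i = j then 1 else 0))"
      by (rule sum.cong[OF refl]) (use assms(1) j in \<open>auto simp: orthonormal_family_def\<close>)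
    also have "\<dots> = k x" using fin j by (simp add: if_distrib cong: if_cong)
    finally show "k x = 0" by simp
  qed (use fin in simp)
  then have "dim (span (e ` I)) = card I"
    by (simp add: dim_eq_card_independent card_image[OF inj])
  then show ?thesis
    using assms(2-4) by (intro subspace_dim_equal subspace_span span_minimal) auto
qed

text \<open>The coefficient matrix a(i,j) = g(e i, f j) satisfies that the sum over i of a(i,j)
  a(i,k) is g(f j, f k), by expanding f j in the family e. This makes traces independent of the
  frames picked by \<open>local_frame\<close>.\<close>

lemma orthonormal_trace_eq:
  assumes "orthonormal_family g I e" "orthonormal_family g J f" "span (e ` I) = span (f ` J)"
    and "bilinear (b :: 'a \<Rightarrow> 'a \<Rightarrow> real)"
  shows "(\<Sum>i\<in>I. b (e i) (e i)) = (\<Sum>j\<in>J. b (f j) (f j))"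
proof -
  have e: "e i = (\<Sum>j\<in>J. g (e i) (f j) *\<^sub>R f j)" if "i \<in> I" for i
    by (rule orthonormal_expand[OF assms(2)]) (use that assms(3) span_base[of "e i" "e ` I"] in simp)
  have f: "f j = (\<Sum>i\<in>I. g (f j) (e i) *\<^sub>R e i)" if "j \<in> J" for j
    by (rule orthonormal_expand[OF assms(1)]) (use that assms(3) span_base[of "f j" "f ` J"] in simp)
  have "(\<Sum>i\<in>I. b (e i) (e i))
      = (\<Sum>i\<in>I. \<Sum>j\<in>J. \<Sum>k\<in>J. g (e i) (f j) * (g (e i) (f k) * b (f j) (f k)))"
  proof (rule sum.cong[OF refl])
    fix i assume i: "i \<in> I"
    have "b (e i) (e i) = b (\<Sum>j\<in>J. g (e i) (f j) *\<^sub>R f j) (\<Sum>k\<in>J. g (e i) (f k) *\<^sub>R f k)"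
      using e[OF i] by simp
    also have "\<dots> = (\<Sum>j\<in>J. \<Sum>k\<in>J. g (e i) (f j) * (g (e i) (f k) * b (f j) (f k)))"
      by (simp add: bilinear_expand[OF assms(4)] sum_distrib_left)
        (subst sum.swap, simp add: mult.left_commute)
    finally show "b (e i) (e i) = \<dots>" .
  qed
  also have "\<dots> = (\<Sum>j\<in>J. \<Sum>k\<in>J. \<Sum>i\<in>I. g (e i) (f j) * (g (e i) (f k) * b (f j) (f k)))"
    by (subst sum.swap, rule sum.cong[OF refl], rule sum.swap)
  also have "\<dots> = (\<Sum>j\<in>J. \<Sum>k\<in>J. (if j = k then 1 else 0) * b (f j) (f k))"
  proof (intro sum.cong refl)
    fix j k assume jk: "j \<in> J" "k \<in> J"
    have "(if j = k then 1 else 0) = g (f j) (f k)"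
      using assms(2) jk by (simp add: orthonormal_family_def)
    also have "\<dots> = g (\<Sum>i\<in>I. g (f j) (e i) *\<^sub>R e i) (f k)" using f[OF jk(1)] by simp
    also have "\<dots> = (\<Sum>i\<in>I. g (e i) (f j) * g (e i) (f k))"
      by (simp add: bilinear_expand[OF inner_form_bilinear] inner_form_commute[of "f j"])
    finally show "(\<Sum>i\<in>I. g (e i) (f j) * (g (e i) (f k) * b (f j) (f k)))
        = (if j = k then 1 else 0) * b (f j) (f k)"
      by (simp add: sum_distrib_right mult.assoc)
  qed
  also have "\<dots> = (\<Sum>j\<in>J. b (f j) (f j))"
    using assms(2) by (simp add: orthonormal_family_def if_distrib if_distribR cong: if_cong)
  finally show ?thesis .
qed

end

text \<open>The sum is the contraction of the skew matrix g(\<phi> e i, e j) with the symmetric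
  matrix b(e i, e j); exchanging the summation indices shows that it is its own negative. Symmetry
  is asked on the family only, because a second fundamental form is symmetric just on tangent
  vectors of the fibre.\<close>

lemma trace_symmetric_skew:
  assumes "inner_form g" "orthonormal_family g I e"
    and "bilinear (b :: 'a::euclidean_space \<Rightarrow> 'a \<Rightarrow> real)"
    and sym: "\<And>i j. i \<in> I \<Longrightarrow> j \<in> I \<Longrightarrow> b (e i) (e j) = b (e j) (e i)"
    and skew: "\<And>u v. g u (\<phi> v) = - g (\<phi> u) v" and inv: "\<And>i. i \<in> I \<Longrightarrow> \<phi> (e i) \<in> span (e ` I)"
  shows "(\<Sum>i\<in>I. b (e i) (\<phi> (e i))) = 0"
proof -
  let ?s = "\<Sum>i\<in>I. \<Sum>j\<in>I. g (\<phi> (e i)) (e j) * b (e i) (e j)"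
  have "(\<Sum>i\<in>I. b (e i) (\<phi> (e i))) = ?s"
  proof (rule sum.cong[OF refl])
    fix i assume i: "i \<in> I"
    have "b (e i) (\<phi> (e i)) = b (e i) (\<Sum>j\<in>I. g (\<phi> (e i)) (e j) *\<^sub>R e j)"
      using orthonormal_expand[OF assms(1,2) inv[OF i]] by simp
    then show "b (e i) (\<phi> (e i)) = (\<Sum>j\<in>I. g (\<phi> (e i)) (e j) * b (e i) (e j))"
      by (simp add: bilinear_expand[OF assms(3)])
  qed
  moreover have "?s = (\<Sum>j\<in>I. \<Sum>i\<in>I. g (\<phi> (e i)) (e j) * b (e i) (e j))"
    by (rule sum.swap)
  moreover have "\<dots> = - ?s"
    unfolding sum_negf[symmetric]
  proof (intro sum.cong refl)
    fix i j assume ij: "i \<in> I" "j \<in> I"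
    have "g (\<phi> (e j)) (e i) = - g (\<phi> (e i)) (e j)"
      using skew[of "e i" "e j"] inner_form_commute[OF assms(1), of "\<phi> (e j)" "e i"] by (rule trans[rotated])
    then show "g (\<phi> (e j)) (e i) * b (e j) (e i) = - (g (\<phi> (e i)) (e j) * b (e i) (e j))"
      by (simp only: sym[OF ij] mult_minus_left)
  qed
  ultimately show ?thesis by linarith
qed


section \<open>Smooth maps and metrics\<close>

context
  fixes A :: "('m::{second_countable_topology, t2_space}, 'a::euclidean_space) atlas"
    and B :: "('n::{second_countable_topology, t2_space}, 'b::euclidean_space) atlas"
    and f :: "'m \<Rightarrow> 'n" and p :: 'm
  assumes A: "smooth_manifold A" and B: "smooth_manifold B" and f: "smooth_map A B f"
    and p: "p \<in> points A"
begin

lemma smooth_map_point: "f p \<in> points B"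
  using f p by (auto simp: smooth_map_def)

lemma smooth_map_nearby:
  assumes "eventually P (nearby B (f p))"
  shows "\<forall>\<^sub>F q in nearby A p. P (f q)"
proof -
  obtain W where W: "open_in B W" "f p \<in> W" "\<forall>y\<in>W. P y"
    using assms unfolding eventually_nearby[OF smooth_map_point] by blast
  have "continuous_on (points A) f" "f ` points A \<subseteq> points B"
    using f by (auto simp: smooth_map_def)
  then have "open_in A (points A \<inter> f -` W)"
    using W(1) unfolding open_in_def by (intro continuous_openin_preimage) auto
  then show ?thesis
    unfolding eventually_nearby[OF p] using W p by blast
qed

lemma smooth_map_pullback:
  assumes "smooth_fun_near B (f p) h"
  shows "smooth_fun_near A p (\<lambda>q. h (f q))"
proof -
  obtain U c where U: "(U, c) \<in> A" "p \<in> U" using chart_atE[OF A p] by blast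
  obtain V d where V: "(V, d) \<in> B" "f p \<in> V" using chart_atE[OF B smooth_map_point] by blast
  have V_near: "\<forall>\<^sub>F q in nearby A p. f q \<in> V"
    using smooth_map_nearby[of "\<lambda>y. y \<in> V"] open_in_nearby[of B V "f p"] chart_facts(1)[OF B] V by blast
  have "smooth_on (c ` (U \<inter> f -` V)) (d \<circ> f \<circ> inv_into U c)"
    using f U V unfolding smooth_map_def by blast
  moreover have "open (c ` (U \<inter> f -` V))"
  proof -
    have "open_in A (points A \<inter> f -` V)"
      using f chart_facts(1)[OF B V(1)] unfolding open_in_def smooth_map_def
      by (intro continuous_openin_preimage) auto
    moreover have "U \<inter> (points A \<inter> f -` V) = U \<inter> f -` V"
      using chart_facts(4)[OF A U(1)] by blast
    ultimately show ?thesis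
      using chart_image_open[OF A U(1)] by metis
  qed
  ultimately have "smooth_at (d \<circ> f \<circ> inv_into U c) (c p)"
    using U(2) V(2) unfolding smooth_at_def
    by (intro exI[of _ "c ` (U \<inter> f -` V)"] conjI imageI) auto
  moreover have "smooth_at (h \<circ> inv_into V d) (d (f p))"
    using assms smooth_fun_near_iff[OF B V] by blast
  ultimately have sm: "smooth_at (\<lambda>x. (h \<circ> inv_into V d) ((d \<circ> f \<circ> inv_into U c) x)) (c p)"
    by (intro smooth_at_compose[where f = "d \<circ> f \<circ> inv_into U c" and g = "h \<circ> inv_into V d"])
      (auto simp: chart_inv[OF A U])
  have "\<forall>\<^sub>F x in nhds (c p). (h \<circ> inv_into V d) ((d \<circ> f \<circ> inv_into U c) x) = ((\<lambda>q. h (f q)) \<circ> inv_into U c) x"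
    using V_near unfolding nearby_chart_iff[OF A U]
    by eventually_elim (simp add: chart_inv[OF B V(1)])
  from smooth_at_cong[OF sm this] show ?thesis
    using smooth_fun_near_iff[OF A U] by blast
qed

text \<open>The chain rule, in the form (df v) h = v (h o f). Torsion is defined by the action on
  functions, so naturality of brackets will be derived from this formula.\<close>

lemma dfun_smooth_map:
  assumes "smooth_fun_near B (f p) h"
  shows "dfun A p (\<lambda>q. h (f q)) v = dfun B (f p) h (mdiff A B f p v)"
proof -
  obtain U c where U: "chart_at A p = (U, c)" "(U, c) \<in> A" "p \<in> U" using chart_atE[OF A p] by blast
  obtain V d where V: "chart_at B (f p) = (V, d)" "(V, d) \<in> B" "f p \<in> V"
    using chart_atE[OF B smooth_map_point] by blast
  have "smooth_fun_near A p (d \<circ> f)"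
    using smooth_map_pullback[OF smooth_chart[OF B V(2,3)]] by (simp add: o_def)
  then have df: "((d \<circ> f \<circ> inv_into U c) has_derivative dfun A p (d \<circ> f)) (at (c p))"
    by (rule has_derivative_dfun[OF A p U(1)])
  have dh: "((h \<circ> inv_into V d) has_derivative dfun B (f p) h) (at (d (f p)))"
    by (rule has_derivative_dfun[OF B smooth_map_point V(1) assms])
  have "\<forall>\<^sub>F q in nearby A p. f q \<in> V"
    using smooth_map_nearby[of "\<lambda>y. y \<in> V"] open_in_nearby[of B V "f p"] chart_facts(1)[OF B] V by blast
  then have ev: "\<forall>\<^sub>F x in nhds (c p).
      ((h \<circ> inv_into V d) \<circ> (d \<circ> f \<circ> inv_into U c)) x = ((\<lambda>q. h (f q)) \<circ> inv_into U c) x"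
    unfolding nearby_chart_iff[OF A U(2,3)]
    by eventually_elim (simp add: chart_inv[OF B V(2)])
  have "(((h \<circ> inv_into V d) \<circ> (d \<circ> f \<circ> inv_into U c)) has_derivative
      dfun B (f p) h \<circ> dfun A p (d \<circ> f)) (at (c p))"
    by (rule diff_chain_at[OF df]) (use dh chart_inv[OF A U(2,3)] in simp)
  then have "(((\<lambda>q. h (f q)) \<circ> inv_into U c) has_derivative dfun B (f p) h \<circ> dfun A p (d \<circ> f)) (at (c p))"
    by (rule has_derivative_transform_eventually)
      (use ev eventually_nhds_x_imp_x[OF ev] eventually_nhds_conv_at in auto)
  from dfun_eqI[OF A p U(1) this] show ?thesis
    by (simp add: mdiff_def V(1))
qed

lemma linear_mdiff: "linear (mdiff A B f p)"
proof -
  obtain V d where V: "chart_at B (f p) = (V, d)" "(V, d) \<in> B" "f p \<in> V"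
    using chart_atE[OF B smooth_map_point] by blast
  have "smooth_fun_near A p (d \<circ> f)"
    using smooth_map_pullback[OF smooth_chart[OF B V(2,3)]] by (simp add: o_def)
  from linear_dfun[OF A p this] show ?thesis
    unfolding mdiff_def V(1) by simp
qed

end

lemma riemannian_metric_inner_form:
  "riemannian_metric M g \<Longrightarrow> p \<in> points M \<Longrightarrow> inner_form (g p)"
  by (auto simp: riemannian_metric_def inner_form_def)

text \<open>Smoothness of a metric is postulated for fields on a common open set, whereas germs come
  with separate neighbourhoods.\<close>

lemma smooth_vf_near_common:
  fixes M :: "('m::{second_countable_topology, t2_space}, 'a::euclidean_space) atlas"
  assumes "smooth_manifold M" "p \<in> points M" "finite I" "\<And>i. i \<in> I \<Longrightarrow> smooth_vf_near M p (X i)"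
  shows "\<exists>W. open_in M W \<and> p \<in> W \<and> (\<forall>i\<in>I. smooth_vf M W (X i))"
proof -
  have "\<forall>\<^sub>F q in nearby M p. \<forall>i\<in>I. smooth_vf_near M q (X i)"
    using smooth_vf_near_eventually[OF assms(1,2,4)] by (simp add: eventually_ball_finite_distrib[OF assms(3)])
  then obtain W where "open_in M W" "p \<in> W" "\<forall>q\<in>W. \<forall>i\<in>I. smooth_vf_near M q (X i)"
    unfolding eventually_nearby[OF assms(2)] by blast
  then show ?thesis
    using smooth_vf_iff[OF assms(1)] by blast
qed

lemma smooth_vf_near_metric:
  fixes M :: "('m::{second_countable_topology, t2_space}, 'a::euclidean_space) atlas"
  assumes M: "smooth_manifold M" and g: "riemannian_metric M g" and p: "p \<in> points M"
    and X: "smooth_vf_near M p X" and Y: "smooth_vf_near M p Y"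
  shows "smooth_fun_near M p (\<lambda>q. g q (X q) (Y q))"
proof -
  have "\<exists>W. open_in M W \<and> p \<in> W \<and> (\<forall>Z\<in>{X, Y}. smooth_vf M W Z)"
    by (rule smooth_vf_near_common[OF M p]) (use X Y in auto)
  then obtain W where "open_in M W" "p \<in> W" "smooth_vf M W X" "smooth_vf M W Y"
    by auto
  then have "open_in M W" "p \<in> W" "smooth_fun M W (\<lambda>q. g q (X q) (Y q))"
    using g unfolding riemannian_metric_def by blast+
  then show ?thesis unfolding smooth_fun_near_def by blast
qed

lemma smooth_vf_near_endomorphism:
  assumes "smooth_endomorphism M \<phi>" "smooth_vf_near M p X"
  shows "smooth_vf_near M p (\<lambda>q. \<phi> q (X q))"
  using assms unfolding smooth_endomorphism_def smooth_vf_near_def by blast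

context
  fixes A :: "('m::{second_countable_topology, t2_space}, 'a::euclidean_space) atlas"
    and B :: "('n::{second_countable_topology, t2_space}, 'b::euclidean_space) atlas"
    and f :: "'m \<Rightarrow> 'n" and p :: 'm
  assumes A: "smooth_manifold A" and B: "smooth_manifold B" and f: "smooth_map A B f"
    and p: "p \<in> points A"
begin

text \<open>The image of a field under the differential is only a field along \<open>f\<close> and
  in general not a field on \<open>B\<close>. It is therefore written in coordinate fields of
  \<open>B\<close> with coefficient functions living on \<open>A\<close>.\<close>

lemma smooth_along_expand:
  assumes "smooth_vf_near A p X"
  obtains P x where "\<And>b. smooth_vf_near B (f p) (P b)" "\<And>b. smooth_fun_near A p (x b)"
    and "\<forall>\<^sub>F q in nearby A p. mdiff A B f q (X q) = (\<Sum>b\<in>(Basis :: 'b set). (x b q :: real) *\<^sub>R P b (f q))"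
proof -
  note fp = smooth_map_point[OF A B f p]
  obtain V d where V: "(V, d) \<in> B" "f p \<in> V" using chart_atE[OF B fp] by blast
  obtain P where P: "\<And>b q. q \<in> V \<Longrightarrow> smooth_vf_near B q (P b)"
    "\<And>q v. q \<in> V \<Longrightarrow> v = (\<Sum>b\<in>Basis. (dfun B q d v \<bullet> b) *\<^sub>R P b q)"
    using coordinate_fields[OF B fp V] by metis
  have "\<forall>\<^sub>F q in nearby A p. f q \<in> V"
    using smooth_map_nearby[OF A B f p, of "\<lambda>y. y \<in> V"] open_in_nearby[of B V "f p"] chart_facts(1)[OF B] V
    by blast
  with nearby_points[OF p] have "\<forall>\<^sub>F q in nearby A p. mdiff A B f q (X q)
      = (\<Sum>b\<in>Basis. (dfun A q (\<lambda>q. d (f q)) (X q) \<bullet> b) *\<^sub>R P b (f q))"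
  proof eventually_elim
    case (elim q)
    show ?case
      using P(2)[OF elim(2), of "mdiff A B f q (X q)"]
        dfun_smooth_map[OF A B f elim(1) smooth_chart[OF B V(1) elim(2)]] by simp
  qed
  moreover have "smooth_fun_near A p (\<lambda>q. dfun A q (\<lambda>q. d (f q)) (X q) \<bullet> b)" for b
    by (intro smooth_fun_near_linear[OF A p bounded_linear_inner_left] smooth_fun_near_dfun[OF A p]
        smooth_map_pullback[OF A B f p] smooth_chart[OF B V] assms)
  ultimately show ?thesis
    using that[of P "\<lambda>b q. dfun A q (\<lambda>q. d (f q)) (X q) \<bullet> b"] P(1)[OF V(2)] by blast
qed

lemma smooth_metric_along:
  assumes g: "riemannian_metric B g" and X: "smooth_vf_near A p X" and Y: "smooth_vf_near B (f p) Y"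
  shows "smooth_fun_near A p (\<lambda>q. g (f q) (mdiff A B f q (X q)) (Y (f q)))"
proof -
  obtain P x where P: "\<And>b. smooth_vf_near B (f p) (P b)" "\<And>b. smooth_fun_near A p (x b)"
    and ev: "\<forall>\<^sub>F q in nearby A p. mdiff A B f q (X q) = (\<Sum>b\<in>(Basis :: 'b set). x b q *\<^sub>R P b (f q))"
    by (rule smooth_along_expand[OF X]) blast
  have "\<forall>\<^sub>F q in nearby A p. (\<Sum>b\<in>(Basis :: 'b set). x b q * g (f q) (P b (f q)) (Y (f q)))
      = g (f q) (mdiff A B f q (X q)) (Y (f q))"
    using ev nearby_points[OF p]
  proof eventually_elim
    case (elim q)
    then have bl: "bilinear (g (f q))"
      using g smooth_map_point[OF A B f] by (auto simp: riemannian_metric_def)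
    then show ?case using elim(1) by (simp add: bilinear_expand[OF bl])
  qed
  moreover have "smooth_fun_near A p (\<lambda>q. \<Sum>b\<in>(Basis :: 'b set). x b q * g (f q) (P b (f q)) (Y (f q)))"
  proof (rule smooth_fun_near_sum[OF A p])
    fix b :: 'b
    have "smooth_fun_near A p (\<lambda>q. g (f q) (P b (f q)) (Y (f q)))"
      using smooth_map_pullback[OF A B f p smooth_vf_near_metric[OF B g smooth_map_point[OF A B f p] P(1) Y]] .
    then show "smooth_fun_near A p (\<lambda>q. x b q * g (f q) (P b (f q)) (Y (f q)))"
      by (rule smooth_fun_near_mult[OF A p P(2)])
  qed
  ultimately show ?thesis by (rule smooth_fun_near_cong[OF A p, rotated])
qed

text \<open>For the inclusion of a fibre this yields the smoothness of the induced endomorphism and,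
  with the identity in the role of \<phi>, that of the induced metric.\<close>

lemma smooth_endomorphism_along:
  assumes g: "riemannian_metric B g" and \<phi>: "smooth_endomorphism B \<phi>"
    and X: "smooth_vf_near A p X" and Y: "smooth_vf_near A p Y"
  shows "smooth_fun_near A p (\<lambda>q. g (f q) (mdiff A B f q (X q)) (\<phi> (f q) (mdiff A B f q (Y q))))"
proof -
  obtain P y where P: "\<And>b. smooth_vf_near B (f p) (P b)" "\<And>b. smooth_fun_near A p (y b)"
    and ev: "\<forall>\<^sub>F q in nearby A p. mdiff A B f q (Y q) = (\<Sum>b\<in>(Basis :: 'b set). y b q *\<^sub>R P b (f q))"
    by (rule smooth_along_expand[OF Y]) blast
  have "\<forall>\<^sub>F q in nearby A p.
      (\<Sum>b\<in>(Basis :: 'b set). y b q * g (f q) (mdiff A B f q (X q)) (\<phi> (f q) (P b (f q))))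
      = g (f q) (mdiff A B f q (X q)) (\<phi> (f q) (mdiff A B f q (Y q)))"
    using ev nearby_points[OF p]
  proof eventually_elim
    case (elim q)
    then have bl: "bilinear (g (f q))" and lin: "linear (\<phi> (f q))"
      using g \<phi> smooth_map_point[OF A B f] by (auto simp: riemannian_metric_def smooth_endomorphism_def)
    then show ?case using elim(1) 
      by (simp add: bilinear_expand[OF bl] linear_sum[OF lin] linear_scale[OF lin])
  qed
  moreover have "smooth_fun_near A p (\<lambda>q. \<Sum>b\<in>(Basis :: 'b set).
      y b q * g (f q) (mdiff A B f q (X q)) (\<phi> (f q) (P b (f q))))"
  proof (rule smooth_fun_near_sum[OF A p])
    fix b :: 'b
    have "smooth_fun_near A p (\<lambda>q. g (f q) (mdiff A B f q (X q)) (\<phi> (f q) (P b (f q))))"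
      using smooth_metric_along[OF g X smooth_vf_near_endomorphism[OF \<phi> P(1)]] .
    then show "smooth_fun_near A p (\<lambda>q. y b q * g (f q) (mdiff A B f q (X q)) (\<phi> (f q) (P b (f q))))"
      by (rule smooth_fun_near_mult[OF A p P(2)])
  qed
  ultimately show ?thesis by (rule smooth_fun_near_cong[OF A p, rotated])
qed

end

section \<open>Smooth orthonormal frames\<close>

text \<open>Smoothness of a distribution in terms of sections: locally constant rank, and every
  vector at \<open>p\<close> extends to a local section. These are the ingredients of
  Gram-Schmidt.\<close>

definition smooth_distribution ::
    "('m::topological_space, 'a::euclidean_space) atlas \<Rightarrow> ('m \<Rightarrow> 'a set) \<Rightarrow> 'm \<Rightarrow> bool" where
  "smooth_distribution M S p \<longleftrightarrow>
     (\<forall>\<^sub>F q in nearby M p. subspace (S q) \<and> dim (S q) = dim (S p)) \<and>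
     (\<forall>v\<in>S p. \<exists>X. smooth_vf_near M p X \<and> X p = v \<and> (\<forall>\<^sub>F q in nearby M p. X q \<in> S q))"

definition smooth_frame ::
    "('m::topological_space, 'a::euclidean_space) atlas \<Rightarrow> ('m \<Rightarrow> 'a \<Rightarrow> 'a \<Rightarrow> real) \<Rightarrow> ('m \<Rightarrow> 'a set)
      \<Rightarrow> 'm \<Rightarrow> (nat \<Rightarrow> 'm \<Rightarrow> 'a) \<Rightarrow> bool" where
  "smooth_frame M g S p E \<longleftrightarrow> (\<forall>i<dim (S p). smooth_vf_near M p (E i)) \<and>
     (\<forall>\<^sub>F q in nearby M p. orthonormal_family (g q) {..<dim (S p)} (\<lambda>i. E i q) \<and>
        span ((\<lambda>i. E i q) ` {..<dim (S p)}) = S q)"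

context
  fixes M :: "('m::{second_countable_topology, t2_space}, 'a::euclidean_space) atlas"
    and g :: "'m \<Rightarrow> 'a \<Rightarrow> 'a \<Rightarrow> real" and p :: 'm
  assumes M: "smooth_manifold M" and g: "riemannian_metric M g" and p: "p \<in> points M"
begin

lemma smooth_vf_near_diff:
  assumes "smooth_vf_near M p X" "smooth_vf_near M p Y"
  shows "smooth_vf_near M p (\<lambda>q. X q - Y q)"
proof -
  have "smooth_vf_near M p (\<lambda>q. X q + (-1) *\<^sub>R Y q)"
    using assms by (rule smooth_vf_near_add[OF M p _ smooth_vf_near_scaleR[OF M p smooth_fun_near_const[OF M p]]])
  then show ?thesis by simp
qed

lemma smooth_vf_near_residual:
  fixes E :: "nat \<Rightarrow> 'm \<Rightarrow> 'a"
  assumes "smooth_vf_near M p Z" "\<And>i. i < r \<Longrightarrow> smooth_vf_near M p (E i)"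
  shows "smooth_vf_near M p (\<lambda>q. Z q - (\<Sum>i<r. g q (Z q) (E i q) *\<^sub>R E i q))"
  by (intro smooth_vf_near_diff smooth_vf_near_sum[OF M p] smooth_vf_near_scaleR[OF M p]
      smooth_vf_near_metric[OF M g p] assms) auto

text \<open>Independence is assumed at \<open>p\<close> only. There the residual \<open>Y\<close> is
  nonzero, so g(Y, Y) is positive near \<open>p\<close> by continuity, and the normalising factor is
  smooth.\<close>

lemma gram_schmidt:
  fixes Z :: "nat \<Rightarrow> 'm \<Rightarrow> 'a"
  assumes "\<And>i. i < r \<Longrightarrow> smooth_vf_near M p (Z i)"
    and "\<And>i. i < r \<Longrightarrow> Z i p \<notin> span ((\<lambda>j. Z j p) ` {..<i})"
  shows "\<exists>E. (\<forall>i<r. smooth_vf_near M p (E i)) \<and>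
    (\<forall>\<^sub>F q in nearby M p. orthonormal_family (g q) {..<r} (\<lambda>i. E i q) \<and>
      span ((\<lambda>i. E i q) ` {..<r}) = span ((\<lambda>i. Z i q) ` {..<r}))"
  using assms
proof (induction r)
  case 0
  then show ?case by (simp add: orthonormal_family_def)
next
  case (Suc r)
  have "\<exists>E. (\<forall>i<r. smooth_vf_near M p (E i)) \<and>
    (\<forall>\<^sub>F q in nearby M p. orthonormal_family (g q) {..<r} (\<lambda>i. E i q) \<and>
      span ((\<lambda>i. E i q) ` {..<r}) = span ((\<lambda>i. Z i q) ` {..<r}))"
    by (rule Suc.IH) (use Suc.prems in simp_all)
  then obtain E where E: "\<And>i. i < r \<Longrightarrow> smooth_vf_near M p (E i)"
    and ev: "\<forall>\<^sub>F q in nearby M p. orthonormal_family (g q) {..<r} (\<lambda>i. E i q) \<and>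
      span ((\<lambda>i. E i q) ` {..<r}) = span ((\<lambda>i. Z i q) ` {..<r})"
    by blast
  define Y where "Y q = Z r q - (\<Sum>i<r. g q (Z r q) (E i q) *\<^sub>R E i q)" for q
  define n where "n q = inverse (sqrt (g q (Y q) (Y q)))" for q
  have Y: "smooth_vf_near M p Y"
    unfolding Y_def using Suc.prems(1) E by (intro smooth_vf_near_residual) auto
  have "Y p \<noteq> 0"
  proof
    assume "Y p = 0"
    then have "Z r p = (\<Sum>i<r. g p (Z r p) (E i p) *\<^sub>R E i p)" by (simp add: Y_def)
    also have "\<dots> \<in> span ((\<lambda>i. E i p) ` {..<r})"
      by (intro span_sum span_scale) (auto intro: span_base)
    finally show False using nearby_self[OF p ev] Suc.prems(2)[of r] by simp
  qed
  then have pos: "0 < g p (Y p) (Y p)"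
    by (rule inner_form_pos[OF riemannian_metric_inner_form[OF g p]])
  have gYY: "smooth_fun_near M p (\<lambda>q. g q (Y q) (Y q))"
    by (rule smooth_vf_near_metric[OF M g p Y Y])
  have "smooth_fun_near M p n"
    unfolding n_def
    by (rule smooth_fun_near_compose[OF M p gYY, where h = "\<lambda>t. inverse (sqrt t)"])
      (rule smooth_at_inverse_sqrt[OF pos])
  then have nY: "smooth_vf_near M p (\<lambda>q. n q *\<^sub>R Y q)"
    by (rule smooth_vf_near_scaleR[OF M p _ Y])
  define E' where "E' = E(r := (\<lambda>q. n q *\<^sub>R Y q))"
  have "smooth_vf_near M p (E' i)" if "i < Suc r" for i
    using that nY E by (auto simp: E'_def less_Suc_eq)
  moreover have "\<forall>\<^sub>F q in nearby M p. g q (Y q) (Y q) \<in> {0<..}"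
    by (rule smooth_fun_near_continuous[OF M p gYY]) (use pos in auto)
  with ev nearby_points[OF p] have "\<forall>\<^sub>F q in nearby M p. orthonormal_family (g q) {..<Suc r} (\<lambda>i. E' i q) \<and>
      span ((\<lambda>i. E' i q) ` {..<Suc r}) = span ((\<lambda>i. Z i q) ` {..<Suc r})"
  proof eventually_elim
    case (elim q)
    let ?e = "\<lambda>i. E i q"
    have gq: "inner_form (g q)" by (rule riemannian_metric_inner_form[OF g elim(2)])
    have "Y q \<noteq> 0"
      using elim(3) inner_form_eq_0[OF gq, of "Y q"] by auto
    note step = gram_schmidt_step[OF gq conjunct1[OF elim(1)] Y_def this refl]
    have E'q: "(\<lambda>i. E' i q) = ?e(r := inverse (sqrt (g q (Y q) (Y q))) *\<^sub>R Y q)"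
      by (auto simp: E'_def n_def)
    have "span (insert (Z r q) (?e ` {..<r})) = span (insert (Z r q) ((\<lambda>i. Z i q) ` {..<r}))"
      using elim(1) by (simp add: span_insert)
    then show ?case
      using step unfolding E'q by (simp add: lessThan_Suc)
  qed
  ultimately show ?case by (intro exI[of _ E']) simp
qed

text \<open>A basis of \<open>S p\<close> is extended to local sections and orthonormalised. Near
  \<open>p\<close> the resulting family lies in \<open>S q\<close> and has as many members as the
  locally constant dimension, hence spans \<open>S q\<close>.\<close>

lemma smooth_frame_ex:
  assumes "smooth_distribution M S p"
  shows "\<exists>E. smooth_frame M g S p E"
proof -
  let ?r = "dim (S p)"
  have dist: "\<forall>\<^sub>F q in nearby M p. subspace (S q) \<and> dim (S q) = ?r"
    and ext: "\<And>v. v \<in> S p \<Longrightarrow> \<exists>X. smooth_vf_near M p X \<and> X p = v \<and> (\<forall>\<^sub>F q in nearby M p. X q \<in> S q)"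
    using assms by (auto simp: smooth_distribution_def)
  obtain B where B: "B \<subseteq> S p" "independent B" "card B = ?r"
    using basis_exists by metis
  then obtain v where v: "bij_betw v {..<?r} B"
    using ex_bij_betw_nat_finite[OF independent_imp_finite[OF B(2)]] by (metis atLeast0LessThan)
  have "\<forall>i. \<exists>X. i < ?r \<longrightarrow> smooth_vf_near M p X \<and> X p = v i \<and> (\<forall>\<^sub>F q in nearby M p. X q \<in> S q)"
  proof
    fix i
    show "\<exists>X. i < ?r \<longrightarrow> smooth_vf_near M p X \<and> X p = v i \<and> (\<forall>\<^sub>F q in nearby M p. X q \<in> S q)"
      using ext[of "v i"] v B(1) by (cases "i < ?r") (auto simp: bij_betw_def)
  qed
  from choice[OF this] obtain Z where
    "\<forall>i<?r. smooth_vf_near M p (Z i) \<and> Z i p = v i \<and> (\<forall>\<^sub>F q in nearby M p. Z i q \<in> S q)"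
    by blast
  then have Z: "\<And>i. i < ?r \<Longrightarrow> smooth_vf_near M p (Z i)" "\<And>i. i < ?r \<Longrightarrow> Z i p = v i"
    "\<And>i. i < ?r \<Longrightarrow> \<forall>\<^sub>F q in nearby M p. Z i q \<in> S q"
    by blast+
  have "Z i p \<notin> span ((\<lambda>j. Z j p) ` {..<i})" if i: "i < ?r" for i
  proof
    assume *: "Z i p \<in> span ((\<lambda>j. Z j p) ` {..<i})"
    have "(\<lambda>j. Z j p) ` {..<i} \<subseteq> B - {v i}"
    proof
      fix x assume "x \<in> (\<lambda>j. Z j p) ` {..<i}"
      then obtain j where "j < i" "x = v j" using Z(2) i by auto
      then show "x \<in> B - {v i}"
        using v i by (auto simp: bij_betw_def inj_on_def)
    qed
    from subsetD[OF span_mono[OF this] *] have "v i \<in> span (B - {v i})" using Z(2)[OF i] by simp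
    moreover have "v i \<in> B" using v i by (auto simp: bij_betw_def)
    ultimately show False using B(2) dependent_def by blast
  qed
  then obtain E where E: "\<And>i. i < ?r \<Longrightarrow> smooth_vf_near M p (E i)"
    and ev: "\<forall>\<^sub>F q in nearby M p. orthonormal_family (g q) {..<?r} (\<lambda>i. E i q) \<and>
      span ((\<lambda>i. E i q) ` {..<?r}) = span ((\<lambda>i. Z i q) ` {..<?r})"
    using gram_schmidt[of ?r Z] Z(1) by blast
  have "\<forall>\<^sub>F q in nearby M p. \<forall>i\<in>{..<?r}. Z i q \<in> S q"
    using Z(3) by (intro eventually_ball_finite) auto
  with ev dist nearby_points[OF p] have "\<forall>\<^sub>F q in nearby M p.
      orthonormal_family (g q) {..<?r} (\<lambda>i. E i q) \<and> span ((\<lambda>i. E i q) ` {..<?r}) = S q"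
  proof eventually_elim
    case (elim q)
    have "span ((\<lambda>i. Z i q) ` {..<?r}) \<subseteq> S q"
      using elim by (intro span_minimal) auto
    moreover have "E i q \<in> span ((\<lambda>i. E i q) ` {..<?r})" if "i < ?r" for i
      using that by (intro span_base) simp
    ultimately have "span ((\<lambda>i. E i q) ` {..<?r}) = S q"
      using elim
      by (intro orthonormal_span_eq[OF riemannian_metric_inner_form[OF g elim(3)]]) auto
    then show ?case using elim by simp
  qed
  then show ?thesis using E by (auto simp: smooth_frame_def)
qed

text \<open>Makes the choice in \<open>local_frame\<close> usable. Finitely many germs hold on one
  common neighbourhood, which is what \<open>orthonormal_frame\<close> asks for.\<close>

lemma smooth_frame_local_frame:
  assumes "smooth_distribution M S p"
  shows "smooth_frame M g S p (local_frame M g S p)"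
proof -
  let ?r = "dim (S p)"
  obtain E where E: "smooth_frame M g S p E" using smooth_frame_ex[OF assms] by blast
  then have ev: "\<forall>\<^sub>F q in nearby M p. orthonormal_family (g q) {..<?r} (\<lambda>i. E i q) \<and>
      span ((\<lambda>i. E i q) ` {..<?r}) = S q" and "\<And>i. i < ?r \<Longrightarrow> smooth_vf_near M p (E i)"
    by (auto simp: smooth_frame_def)
  then have "\<forall>\<^sub>F q in nearby M p. \<forall>i\<in>{..<?r}. smooth_vf_near M q (E i)"
    using smooth_vf_near_eventually[OF M p] by (intro eventually_ball_finite) auto
  with ev have "\<forall>\<^sub>F q in nearby M p. (\<forall>i<?r. smooth_vf_near M q (E i)) \<and>
      orthonormal_family (g q) {..<?r} (\<lambda>i. E i q) \<and> span ((\<lambda>i. E i q) ` {..<?r}) = S q"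
    by eventually_elim auto
  then obtain W where W: "open_in M W" "p \<in> W" "\<forall>q\<in>W. (\<forall>i<?r. smooth_vf_near M q (E i)) \<and>
      orthonormal_family (g q) {..<?r} (\<lambda>i. E i q) \<and> span ((\<lambda>i. E i q) ` {..<?r}) = S q"
    unfolding eventually_nearby[OF p] by blast
  then have "orthonormal_frame M g S ?r W E"
    unfolding orthonormal_frame_def orthonormal_family_def using smooth_vf_iff[OF M W(1)] by simp
  then have "\<exists>E W. open_in M W \<and> p \<in> W \<and> orthonormal_frame M g S ?r W E" using W by blast
  then have "\<exists>W. open_in M W \<and> p \<in> W \<and> orthonormal_frame M g S ?r W (local_frame M g S p)"
    unfolding local_frame_def by (rule someI_ex)
  then obtain W where W: "open_in M W" "p \<in> W" "orthonormal_frame M g S ?r W (local_frame M g S p)"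
    by blast
  then show ?thesis
    unfolding smooth_frame_def eventually_nearby[OF p] orthonormal_frame_def orthonormal_family_def
    using smooth_vf_iff[OF M W(1)] by (intro conjI exI[of _ W]) auto
qed

lemma smooth_distribution_UNIV: "smooth_distribution M (\<lambda>_. UNIV) p"
  using smooth_vf_near_ex[OF M p] by (simp add: smooth_distribution_def)

end


section \<open>The Levi-Civita connection\<close>

context
  fixes M :: "('m::{second_countable_topology, t2_space}, 'a::euclidean_space) atlas"
    and g :: "'m \<Rightarrow> 'a \<Rightarrow> 'a \<Rightarrow> real" and D :: "'m \<Rightarrow> 'a \<Rightarrow> ('m \<Rightarrow> 'a) \<Rightarrow> 'a" and p :: 'm
  assumes M: "smooth_manifold M" and g: "riemannian_metric M g" and D: "levi_civita M g D"
    and p: "p \<in> points M"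
begin

lemma connection_linear: "smooth_vf_near M p Y \<Longrightarrow> linear (\<lambda>v. D p v Y)"
  using D p by (simp add: levi_civita_def affine_connection_def)

lemma connection_cong:
  assumes "smooth_vf_near M p Y" "\<forall>\<^sub>F q in nearby M p. Y q = Z q"
  shows "D p v Y = D p v Z"
proof -
  obtain W where "open_in M W" "p \<in> W" "\<forall>q\<in>W. Y q = Z q"
    using assms(2) unfolding eventually_nearby[OF p] by blast
  moreover have "smooth_vf_near M p Z" by (rule smooth_vf_near_cong[OF M p assms])
  ultimately show ?thesis
    using D p assms(1) unfolding levi_civita_def affine_connection_def by blast
qed

lemma connection_zero: "D p v (\<lambda>q. 0) = 0"
proof -
  have "D p v (\<lambda>q. 0 + 0) = D p v (\<lambda>q. 0) + D p v (\<lambda>q. 0)"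
    using D p smooth_vf_near_zero[OF M p] unfolding levi_civita_def affine_connection_def by blast
  then show ?thesis by simp
qed

lemma connection_metric:
  "smooth_vf_near M p Y \<Longrightarrow> smooth_vf_near M p Z \<Longrightarrow>
    dfun M p (\<lambda>q. g q (Y q) (Z q)) v = g p (D p v Y) (Z p) + g p (Y p) (D p v Z)"
  using D p by (simp add: levi_civita_def metric_connection_def)

lemma connection_torsion:
  fixes f :: "'m \<Rightarrow> real"
  assumes "smooth_vf_near M p X" "smooth_vf_near M p Y" "smooth_fun_near M p f"
  shows "dfun M p f (D p (X p) Y - D p (Y p) X) =
    dfun M p (\<lambda>q. dfun M q f (Y q)) (X p) - dfun M p (\<lambda>q. dfun M q f (X q)) (Y p)"
  using D p assms by (simp add: levi_civita_def torsion_free_def)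

text \<open>The Lie brackets of the usual formula are written as differences of covariant
  derivatives, so that \<open>bracket_related\<close> can rewrite them. Expanding the three
  derivatives by metric compatibility makes the remaining terms cancel.\<close>

lemma koszul:
  assumes "smooth_vf_near M p X" "smooth_vf_near M p Y" "smooth_vf_near M p Z"
  shows "2 * g p (D p (X p) Y) (Z p) =
      dfun M p (\<lambda>q. g q (Y q) (Z q)) (X p) + dfun M p (\<lambda>q. g q (X q) (Z q)) (Y p)
      - dfun M p (\<lambda>q. g q (X q) (Y q)) (Z p)
      + g p (D p (X p) Y - D p (Y p) X) (Z p) - g p (D p (X p) Z - D p (Z p) X) (Y p)
      - g p (D p (Y p) Z - D p (Z p) Y) (X p)"
proof -
  have gp: "inner_form (g p)" by (rule riemannian_metric_inner_form[OF g p])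
  have comm: "g p (V p) (D p v W) = g p (D p v W) (V p)" for v V W
    by (rule inner_form_commute[OF gp])
  show ?thesis
    by (simp add: connection_metric assms bilinear_lsub[OF inner_form_bilinear[OF gp]] comm)
qed

text \<open>Real functions separate tangent vectors, since the coordinates of a chart already do.
  Vanishing torsion is a statement about such functions, and this turns it back into one about
  vectors.\<close>

lemma tangent_vector_eqI:
  assumes "\<And>h :: 'm \<Rightarrow> real. smooth_fun_near M p h \<Longrightarrow> dfun M p h u = dfun M p h v"
  shows "u = v"
proof -
  obtain U c where U: "(U, c) \<in> M" "p \<in> U" using chart_atE[OF M p] by blast
  have "dfun M p c u \<bullet> b = dfun M p c v \<bullet> b" for b
    using assms[OF smooth_fun_near_linear[OF M p bounded_linear_inner_left smooth_chart[OF M U]]]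
    by (simp add: dfun_bounded_linear[OF M p bounded_linear_inner_left smooth_chart[OF M U]])
  then have "dfun M p c u = dfun M p c v" by (metis vector_eq_rdot)
  then show ?thesis
    using bij_dfun_chart[OF M p U] by (meson bij_is_inj injD)
qed

end


section \<open>Covariant derivatives of fundamental forms\<close>

text \<open>The common ground of the almost contact structure, the almost Hermitian structure and
  the structure induced on a fibre: skewness says that the fundamental form is alternating.\<close>

definition skew_endomorphism ::
    "('m::topological_space, 'a::euclidean_space) atlas \<Rightarrow> ('m \<Rightarrow> 'a \<Rightarrow> 'a \<Rightarrow> real)
      \<Rightarrow> ('m \<Rightarrow> 'a \<Rightarrow> 'a) \<Rightarrow> bool" where
  "skew_endomorphism M g \<phi> \<longleftrightarrow> smooth_endomorphism M \<phi> \<and>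
     (\<forall>p\<in>points M. \<forall>u v. g p u (\<phi> p v) = - g p (\<phi> p u) v)"

context
  fixes M :: "('m::{second_countable_topology, t2_space}, 'a::euclidean_space) atlas"
    and g :: "'m \<Rightarrow> 'a \<Rightarrow> 'a \<Rightarrow> real" and D :: "'m \<Rightarrow> 'a \<Rightarrow> ('m \<Rightarrow> 'a) \<Rightarrow> 'a" and p :: 'm
    and \<phi> :: "'m \<Rightarrow> 'a \<Rightarrow> 'a"
  assumes M: "smooth_manifold M" and g: "riemannian_metric M g" and D: "levi_civita M g D"
    and \<phi>: "skew_endomorphism M g \<phi>" and p: "p \<in> points M"
begin

lemma smooth_vf_near_skew: "smooth_vf_near M p X \<Longrightarrow> smooth_vf_near M p (\<lambda>q. \<phi> q (X q))"
  using \<phi> smooth_vf_near_endomorphism by (auto simp: skew_endomorphism_def)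

lemma cov_deriv_fields:
  fixes u :: 'a
  assumes "smooth_vf_near M p Y" "smooth_vf_near M p Z"
  defines "c \<equiv> dfun M p (\<lambda>q. g q (Y q) (\<phi> q (Z q))) u - g p (D p u Y) (\<phi> p (Z p)) - g p (Y p) (\<phi> p (D p u Z))"
  shows "c = g p (D p u (\<lambda>q. \<phi> q (Z q))) (Y p) + g p (D p u Z) (\<phi> p (Y p))"
    and "c = - g p (D p u (\<lambda>q. \<phi> q (Y q))) (Z p) - g p (D p u Y) (\<phi> p (Z p))"
proof -
  have gp: "inner_form (g p)" by (rule riemannian_metric_inner_form[OF g p])
  have skew: "g q u (\<phi> q v) = - g q (\<phi> q u) v" if "q \<in> points M" for q u v
    using \<phi> that by (simp add: skew_endomorphism_def)
  note metric = connection_metric[OF M g D p]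
  have "dfun M p (\<lambda>q. g q (Y q) (\<phi> q (Z q))) u
      = g p (D p u Y) (\<phi> p (Z p)) + g p (Y p) (D p u (\<lambda>q. \<phi> q (Z q)))"
    by (rule metric[OF assms(1) smooth_vf_near_skew[OF assms(2)]])
  moreover have "g p (Y p) (D p u (\<lambda>q. \<phi> q (Z q))) = g p (D p u (\<lambda>q. \<phi> q (Z q))) (Y p)"
    "g p (Y p) (\<phi> p (D p u Z)) = - g p (D p u Z) (\<phi> p (Y p))"
    using skew[OF p, of "Y p"] by (simp_all add: inner_form_commute[OF gp])
  ultimately show "c = g p (D p u (\<lambda>q. \<phi> q (Z q))) (Y p) + g p (D p u Z) (\<phi> p (Y p))"
    by (simp add: c_def)
  \<comment> \<open>By skewness the same function is also - g(\<phi> Y, Z); differentiating it in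
    this shape moves \<phi> onto the first field.\<close>
  have "\<forall>\<^sub>F q in nearby M p. (-1) * g q (\<phi> q (Y q)) (Z q) = g q (Y q) (\<phi> q (Z q))"
    using nearby_points[OF p] by eventually_elim (simp add: skew)
  moreover have "smooth_fun_near M p (\<lambda>q. (-1) * g q (\<phi> q (Y q)) (Z q))"
    using smooth_fun_near_mult[OF M p smooth_fun_near_const[OF M p]
        smooth_vf_near_metric[OF M g p smooth_vf_near_skew[OF assms(1)] assms(2)]] .
  ultimately have "dfun M p (\<lambda>q. g q (Y q) (\<phi> q (Z q))) u = dfun M p (\<lambda>q. (-1) * g q (\<phi> q (Y q)) (Z q)) u"
    using dfun_cong[OF M p] by metis
  also have "\<dots> = (-1) * dfun M p (\<lambda>q. g q (\<phi> q (Y q)) (Z q)) u"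
    using assms(1,2)
    by (intro dfun_bounded_linear[OF M p bounded_linear_mult_right] smooth_vf_near_metric[OF M g p]
        smooth_vf_near_skew)
  also have "dfun M p (\<lambda>q. g q (\<phi> q (Y q)) (Z q)) u
      = g p (D p u (\<lambda>q. \<phi> q (Y q))) (Z p) + g p (\<phi> p (Y p)) (D p u Z)"
    by (rule metric[OF smooth_vf_near_skew[OF assms(1)] assms(2)])
  finally show "c = - g p (D p u (\<lambda>q. \<phi> q (Y q))) (Z p) - g p (D p u Y) (\<phi> p (Z p))"
    using skew[OF p, of "Y p" "D p u Z"] by (simp add: c_def)
qed

text \<open>
  The first expression only involves the value of the first field, the second one only the value
  of the second; hence the choice of the extensions is irrelevant.
\<close>

lemma cov_deriv_fundamental_form:
  assumes Z: "smooth_vf_near M p Z"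
  shows "cov_deriv_form M D (fundamental_form g \<phi>) p u v (Z p)
    = g p (D p u (\<lambda>q. \<phi> q (Z q))) v + g p (D p u Z) (\<phi> p v)"
proof -
  let ?Y = "extension M p v" and ?Z = "extension M p (Z p)"
  have Y': "smooth_vf_near M p ?Y" "?Y p = v" and Z': "smooth_vf_near M p ?Z" "?Z p = Z p"
    by (rule extension_spec[OF M p])+
  have "cov_deriv_form M D (fundamental_form g \<phi>) p u v (Z p) =
      dfun M p (\<lambda>q. g q (?Y q) (\<phi> q (?Z q))) u - g p (D p u ?Y) (\<phi> p (Z p)) - g p v (\<phi> p (D p u ?Z))"
    by (simp add: cov_deriv_form_def fundamental_form_def Let_def)
  also have "\<dots> = - g p (D p u (\<lambda>q. \<phi> q (?Y q))) (Z p) - g p (D p u ?Y) (\<phi> p (Z p))"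
    using cov_deriv_fields(2)[OF Y'(1) Z'(1), of u] unfolding Y'(2) Z'(2) .
  also have "\<dots> = g p (D p u (\<lambda>q. \<phi> q (Z q))) v + g p (D p u Z) (\<phi> p v)"
    using cov_deriv_fields[OF Y'(1) Z, of u] unfolding Y'(2) by linarith
  finally show ?thesis .
qed

text \<open>The version for traces: the frame field itself may serve as extension, and the last slot
  w appears undifferentiated.\<close>

lemma cov_deriv_fundamental_form':
  assumes Y: "smooth_vf_near M p Y"
  shows "cov_deriv_form M D (fundamental_form g \<phi>) p u (Y p) w
    = - g p (D p u (\<lambda>q. \<phi> q (Y q))) w - g p (D p u Y) (\<phi> p w)"
proof -
  have Z: "smooth_vf_near M p (extension M p w)" "extension M p w p = w"
    by (rule extension_spec[OF M p])+
  show ?thesis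
    using cov_deriv_fundamental_form[OF Z(1), of u "Y p"] cov_deriv_fields[OF Y Z(1), of u]
    unfolding Z(2) by linarith
qed

lemma bilinear_cov_deriv:
  "bilinear (\<lambda>u v. cov_deriv_form M D (fundamental_form g \<phi>) p u v w)"
proof -
  let ?Z = "extension M p w"
  have Z: "smooth_vf_near M p ?Z" "?Z p = w" by (rule extension_spec[OF M p])+
  have bl: "bilinear (g p)" using inner_form_bilinear[OF riemannian_metric_inner_form[OF g p]] .
  have lin: "linear (\<lambda>v. D p v ?Z)" "linear (\<lambda>v. D p v (\<lambda>q. \<phi> q (?Z q)))" "linear (\<phi> p)"
    using connection_linear[OF M g D p] Z(1) smooth_vf_near_skew \<phi> p
    by (auto simp: skew_endomorphism_def smooth_endomorphism_def)
  have eq: "(\<lambda>u v. cov_deriv_form M D (fundamental_form g \<phi>) p u v w)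
      = (\<lambda>u v. g p (D p u (\<lambda>q. \<phi> q (?Z q))) v + g p (D p u ?Z) (\<phi> p v))"
    using cov_deriv_fundamental_form[OF Z(1)] unfolding Z(2) by blast
  show ?thesis
    unfolding eq bilinear_def
    by (auto intro!: linearI simp: bilinear_ladd[OF bl] bilinear_radd[OF bl] bilinear_lmul[OF bl]
        bilinear_rmul[OF bl] linear_add[OF lin(1)] linear_add[OF lin(2)] linear_add[OF lin(3)]
        linear_scale[OF lin(1)] linear_scale[OF lin(2)] linear_scale[OF lin(3)] algebra_simps)
qed

end

section \<open>Related vector fields\<close>

text \<open>
  Horizontal lifts under a Riemannian submersion and restrictions of tangent fields to a submanifold
  are both instances of this relation, so that base and fibres are treated alike.
\<close>

definition iso_related ::
    "('m::topological_space, 'a::euclidean_space) atlas \<Rightarrow> ('m \<Rightarrow> 'a \<Rightarrow> 'a \<Rightarrow> real)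
      \<Rightarrow> ('n::topological_space, 'b::euclidean_space) atlas \<Rightarrow> ('n \<Rightarrow> 'b \<Rightarrow> 'b \<Rightarrow> real)
      \<Rightarrow> ('m \<Rightarrow> 'n) \<Rightarrow> 'm \<Rightarrow> ('m \<Rightarrow> 'a) \<Rightarrow> ('n \<Rightarrow> 'b) \<Rightarrow> bool" where
  "iso_related A gA B gB f p X X' \<longleftrightarrow> smooth_vf_near A p X \<and> smooth_vf_near B (f p) X' \<and>
     (\<forall>\<^sub>F q in nearby A p. mdiff A B f q (X q) = X' (f q) \<and>
        (\<forall>u. gA q u (X q) = gB (f q) (mdiff A B f q u) (X' (f q))))"

context
  fixes A :: "('m::{second_countable_topology, t2_space}, 'a::euclidean_space) atlas"
    and B :: "('n::{second_countable_topology, t2_space}, 'b::euclidean_space) atlas"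
    and f :: "'m \<Rightarrow> 'n" and p :: 'm
    and gA :: "'m \<Rightarrow> 'a \<Rightarrow> 'a \<Rightarrow> real" and DA :: "'m \<Rightarrow> 'a \<Rightarrow> ('m \<Rightarrow> 'a) \<Rightarrow> 'a"
    and gB :: "'n \<Rightarrow> 'b \<Rightarrow> 'b \<Rightarrow> real" and DB :: "'n \<Rightarrow> 'b \<Rightarrow> ('n \<Rightarrow> 'b) \<Rightarrow> 'b"
  assumes A: "smooth_manifold A" and gA: "riemannian_metric A gA" and DA: "levi_civita A gA DA"
    and B: "smooth_manifold B" and gB: "riemannian_metric B gB" and DB: "levi_civita B gB DB"
    and f: "smooth_map A B f" and p: "p \<in> points A"
begin

text \<open>Related fields have related brackets: applied to h o f, the bracket of X and Y gives the
  bracket of X' and Y' applied to h. Vanishing torsion on both sides lets the differences of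
  covariant derivatives stand for the brackets.\<close>

lemma bracket_related:
  assumes "smooth_vf_near A p X" "smooth_vf_near B (f p) X'" "\<forall>\<^sub>F q in nearby A p. mdiff A B f q (X q) = X' (f q)"
    and "smooth_vf_near A p Y" "smooth_vf_near B (f p) Y'" "\<forall>\<^sub>F q in nearby A p. mdiff A B f q (Y q) = Y' (f q)"
  shows "mdiff A B f p (DA p (X p) Y - DA p (Y p) X) = DB (f p) (X' (f p)) Y' - DB (f p) (Y' (f p)) X'"
proof (rule tangent_vector_eqI[OF B gB DB smooth_map_point[OF A B f p]])
  note fp = smooth_map_point[OF A B f p]
  fix h :: "'n \<Rightarrow> real" assume h: "smooth_fun_near B (f p) h"
  have hf: "smooth_fun_near A p (\<lambda>q. h (f q))" by (rule smooth_map_pullback[OF A B f p h])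
  have deriv: "dfun A p (\<lambda>q. dfun A q (\<lambda>q. h (f q)) (Y q)) (X p)
      = dfun B (f p) (\<lambda>y. dfun B y h (Y' y)) (X' (f p))"
    if X: "\<forall>\<^sub>F q in nearby A p. mdiff A B f q (X q) = X' (f q)"
      and Y: "smooth_vf_near B (f p) Y'" "\<forall>\<^sub>F q in nearby A p. mdiff A B f q (Y q) = Y' (f q)"
    for X X' Y Y'
  proof -
    have "\<forall>\<^sub>F y in nearby B (f p). smooth_fun_near B y h"
      by (rule smooth_fun_near_eventually[OF B fp h])
    from smooth_map_nearby[OF A B f p this] nearby_points[OF p] Y(2)
    have ev: "\<forall>\<^sub>F q in nearby A p. dfun B (f q) h (Y' (f q)) = dfun A q (\<lambda>q. h (f q)) (Y q)"
    proof eventually_elim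
      case (elim q)
      then show ?case using dfun_smooth_map[OF A B f elim(2,1)] by simp
    qed
    have sm: "smooth_fun_near B (f p) (\<lambda>y. dfun B y h (Y' y))"
      by (rule smooth_fun_near_dfun[OF B fp h Y(1)])
    have "dfun A p (\<lambda>q. dfun A q (\<lambda>q. h (f q)) (Y q)) (X p) = dfun A p (\<lambda>q. dfun B (f q) h (Y' (f q))) (X p)"
      using dfun_cong[OF A p smooth_map_pullback[OF A B f p sm] ev] by simp
    also have "\<dots> = dfun B (f p) (\<lambda>y. dfun B y h (Y' y)) (mdiff A B f p (X p))"
      by (rule dfun_smooth_map[OF A B f p sm])
    finally show ?thesis using nearby_self[OF p X] by simp
  qed
  have "dfun B (f p) h (mdiff A B f p (DA p (X p) Y - DA p (Y p) X))
      = dfun A p (\<lambda>q. h (f q)) (DA p (X p) Y - DA p (Y p) X)"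
    using dfun_smooth_map[OF A B f p h] by simp
  also have "\<dots> = dfun A p (\<lambda>q. dfun A q (\<lambda>q. h (f q)) (Y q)) (X p)
      - dfun A p (\<lambda>q. dfun A q (\<lambda>q. h (f q)) (X q)) (Y p)"
    by (rule connection_torsion[OF A gA DA p assms(1,4) hf])
  also have "\<dots> = dfun B (f p) (\<lambda>y. dfun B y h (Y' y)) (X' (f p))
      - dfun B (f p) (\<lambda>y. dfun B y h (X' y)) (Y' (f p))"
    using deriv[OF assms(3,5,6)] deriv[OF assms(6,2,3)] by simp
  also have "\<dots> = dfun B (f p) h (DB (f p) (X' (f p)) Y' - DB (f p) (Y' (f p)) X')"
    using connection_torsion[OF B gB DB fp assms(2,5) h] by simp
  finally show "dfun B (f p) h (mdiff A B f p (DA p (X p) Y - DA p (Y p) X))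
      = dfun B (f p) h (DB (f p) (X' (f p)) Y' - DB (f p) (Y' (f p)) X')" .
qed

lemma metric_related:
  assumes "iso_related A gA B gB f p Y Y'" "iso_related A gA B gB f p Z Z'"
  shows "dfun A p (\<lambda>q. gA q (Y q) (Z q)) v = dfun B (f p) (\<lambda>y. gB y (Y' y) (Z' y)) (mdiff A B f p v)"
proof -
  have ev: "\<forall>\<^sub>F q in nearby A p. gB (f q) (Y' (f q)) (Z' (f q)) = gA q (Y q) (Z q)"
    using assms[unfolded iso_related_def, THEN conjunct2, THEN conjunct2]
    by eventually_elim simp
  have sm: "smooth_fun_near B (f p) (\<lambda>y. gB y (Y' y) (Z' y))"
    using assms by (intro smooth_vf_near_metric[OF B gB smooth_map_point[OF A B f p]]) (auto simp: iso_related_def)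
  show ?thesis
    using dfun_cong[OF A p smooth_map_pullback[OF A B f p sm] ev] dfun_smooth_map[OF A B f p sm] by simp
qed

lemma iso_related_point:
  assumes "iso_related A gA B gB f p X X'"
  shows "mdiff A B f p (X p) = X' (f p)" "gA p u (X p) = gB (f p) (mdiff A B f p u) (X' (f p))"
  using nearby_self[OF p assms[unfolded iso_related_def, THEN conjunct2, THEN conjunct2]] by auto

lemma iso_relatedD:
  assumes "iso_related A gA B gB f p X X'"
  shows "smooth_vf_near A p X" "smooth_vf_near B (f p) X'"
    "\<forall>\<^sub>F q in nearby A p. mdiff A B f q (X q) = X' (f q)"
  using assms by (auto simp: iso_related_def elim: eventually_mono)

text \<open>The terms of the two Koszul formulas agree one by one. The brackets are paired with
  related fields but may leave the distribution themselves, hence the quantifier over all u in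
  \<open>iso_related\<close>.\<close>

lemma connection_related:
  assumes "iso_related A gA B gB f p X X'" "iso_related A gA B gB f p Y Y'" "iso_related A gA B gB f p Z Z'"
  shows "gA p (DA p (X p) Y) (Z p) = gB (f p) (DB (f p) (X' (f p)) Y') (Z' (f p))"
proof -
  note x = iso_relatedD[OF assms(1)] iso_related_point[OF assms(1)]
    and y = iso_relatedD[OF assms(2)] iso_related_point[OF assms(2)]
    and z = iso_relatedD[OF assms(3)] iso_related_point[OF assms(3)]
  have "2 * gA p (DA p (X p) Y) (Z p) = 2 * gB (f p) (DB (f p) (X' (f p)) Y') (Z' (f p))"
    unfolding koszul[OF A gA DA p x(1) y(1) z(1)]
    unfolding koszul[OF B gB DB smooth_map_point[OF A B f p] x(2) y(2) z(2)]
      metric_related[OF assms(1,2)] metric_related[OF assms(1,3)] metric_related[OF assms(2,3)]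
      x(5) y(5) z(5) x(4) y(4) z(4)
      bracket_related[OF x(1-3) y(1-3)] bracket_related[OF x(1-3) z(1-3)] bracket_related[OF y(1-3) z(1-3)]
    by (rule refl)
  then show ?thesis by simp
qed

text \<open>A lift z of Z' in \<open>S q\<close> has the coefficients g(z, E i) = g'(df (E i), Z')
  with respect to an orthonormal frame of S. The right-hand side does not mention z and is smooth,
  so it is used to define the lift.\<close>

lemma related_lift:
  assumes S: "smooth_distribution A S p" and Z': "smooth_vf_near B (f p) Z'"
    and iso: "\<forall>\<^sub>F q in nearby A p. \<forall>w\<in>S q. \<forall>u. gA q u w = gB (f q) (mdiff A B f q u) (mdiff A B f q w)"
    and im: "\<forall>\<^sub>F q in nearby A p. Z' (f q) \<in> mdiff A B f q ` S q"
  shows "\<exists>Z. iso_related A gA B gB f p Z Z' \<and> (\<forall>\<^sub>F q in nearby A p. Z q \<in> S q)"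
proof -
  let ?r = "dim (S p)"
  obtain E where "smooth_frame A gA S p E" using smooth_frame_ex[OF A gA p S] by blast
  then have E: "\<And>i. i < ?r \<Longrightarrow> smooth_vf_near A p (E i)"
    and ev: "\<forall>\<^sub>F q in nearby A p. orthonormal_family (gA q) {..<?r} (\<lambda>i. E i q) \<and>
      span ((\<lambda>i. E i q) ` {..<?r}) = S q"
    by (auto simp: smooth_frame_def)
  define Z where "Z q = (\<Sum>i<?r. gB (f q) (mdiff A B f q (E i q)) (Z' (f q)) *\<^sub>R E i q)" for q
  have "smooth_vf_near A p Z"
    unfolding Z_def
    by (intro smooth_vf_near_sum[OF A p] smooth_vf_near_scaleR[OF A p]
        smooth_metric_along[OF A B f p gB _ Z'] E) auto
  moreover have Z: "\<forall>\<^sub>F q in nearby A p. Z q \<in> S q \<and> mdiff A B f q (Z q) = Z' (f q) \<and>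
      (\<forall>u. gA q u (Z q) = gB (f q) (mdiff A B f q u) (Z' (f q)))"
    using iso im ev nearby_points[OF p]
  proof eventually_elim
    case (elim q)
    have gq: "inner_form (gA q)" by (rule riemannian_metric_inner_form[OF gA elim(4)])
    obtain z where z: "z \<in> S q" "Z' (f q) = mdiff A B f q z" using elim(2) by blast
    have "gB (f q) (mdiff A B f q (E i q)) (Z' (f q)) = gA q z (E i q)" for i
      using elim(1) z inner_form_commute[OF gq] by metis
    then have "Z q = (\<Sum>i<?r. gA q z (E i q) *\<^sub>R E i q)" by (simp add: Z_def)
    also have "\<dots> = z"
      by (rule orthonormal_expand[OF gq, symmetric]) (use elim(3) z(1) in auto)
    finally show ?case using z elim(1) by simp
  qed
  ultimately show ?thesis
    using Z' by (intro exI[of _ Z]) (auto simp: iso_related_def elim: eventually_mono)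
qed

section \<open>Fundamental forms under a map that is isometric on a distribution\<close>

context
  fixes \<phi>A :: "'m \<Rightarrow> 'a \<Rightarrow> 'a" and \<phi>B :: "'n \<Rightarrow> 'b \<Rightarrow> 'b" and S :: "'m \<Rightarrow> 'a set" and R :: "'n \<Rightarrow> 'b set"
  assumes \<phi>A: "skew_endomorphism A gA \<phi>A" and \<phi>B: "skew_endomorphism B gB \<phi>B"
    and S: "smooth_distribution A S p" and R: "smooth_distribution B R (f p)"
    and iso: "\<And>q u w. q \<in> points A \<Longrightarrow> w \<in> S q \<Longrightarrow> gA q u w = gB (f q) (mdiff A B f q u) (mdiff A B f q w)"
    and inv: "\<And>q w. q \<in> points A \<Longrightarrow> w \<in> S q \<Longrightarrow> \<phi>A q w \<in> S q"
    and intertwine: "\<And>q v. q \<in> points A \<Longrightarrow> mdiff A B f q (\<phi>A q v) = \<phi>B (f q) (mdiff A B f q v)"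
    and im: "\<And>q. q \<in> points A \<Longrightarrow> mdiff A B f q ` S q = R (f q)"
begin

text \<open>The assumptions fit the submersion with \<open>S\<close> horizontal and \<open>R\<close>
  everything, and the inclusion of a fibre with \<open>S\<close> everything and \<open>R\<close>
  vertical. Invariance of \<open>S\<close> under \<open>\<phi>A\<close> makes the relation pass to
  the images under \<open>\<phi>A\<close> and \<open>\<phi>B\<close>.\<close>

lemma related_extension:
  assumes "w \<in> S p"
  obtains Z Z' where "Z p = w" "iso_related A gA B gB f p Z Z'"
    "iso_related A gA B gB f p (\<lambda>q. \<phi>A q (Z q)) (\<lambda>y. \<phi>B y (Z' y))"
proof -
  have "mdiff A B f p w \<in> R (f p)" using im[OF p] assms by blast
  then obtain Z' where Z': "smooth_vf_near B (f p) Z'" "Z' (f p) = mdiff A B f p w"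
    and ev: "\<forall>\<^sub>F y in nearby B (f p). Z' y \<in> R y"
    using R unfolding smooth_distribution_def by blast
  have iso_ev: "\<forall>\<^sub>F q in nearby A p. \<forall>w\<in>S q. \<forall>u. gA q u w = gB (f q) (mdiff A B f q u) (mdiff A B f q w)"
    using nearby_points[OF p] by eventually_elim (simp add: iso)
  have "\<forall>\<^sub>F q in nearby A p. Z' (f q) \<in> mdiff A B f q ` S q"
    using smooth_map_nearby[OF A B f p ev] nearby_points[OF p] by eventually_elim (simp add: im)
  then obtain Z where Z: "iso_related A gA B gB f p Z Z'" and ZS: "\<forall>\<^sub>F q in nearby A p. Z q \<in> S q"
    using related_lift[OF S Z'(1) iso_ev] by blast
  have "iso_related A gA B gB f p (\<lambda>q. \<phi>A q (Z q)) (\<lambda>y. \<phi>B y (Z' y))"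
    unfolding iso_related_def
  proof (intro conjI)
    show "smooth_vf_near A p (\<lambda>q. \<phi>A q (Z q))"
      by (rule smooth_vf_near_skew[OF A gA DA \<phi>A p iso_relatedD(1)[OF Z]])
    show "smooth_vf_near B (f p) (\<lambda>y. \<phi>B y (Z' y))"
      by (rule smooth_vf_near_skew[OF B gB DB \<phi>B smooth_map_point[OF A B f p] Z'(1)])
    show "\<forall>\<^sub>F q in nearby A p. mdiff A B f q (\<phi>A q (Z q)) = \<phi>B (f q) (Z' (f q)) \<and>
        (\<forall>u. gA q u (\<phi>A q (Z q)) = gB (f q) (mdiff A B f q u) (\<phi>B (f q) (Z' (f q))))"
      using iso_relatedD(3)[OF Z] ZS nearby_points[OF p]
      by eventually_elim (simp add: iso inv intertwine)
  qed
  \<comment> \<open>Both vectors lie in \<open>S p\<close> and have the same image; the differential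
    is isometric on \<open>S p\<close>, so their difference has length 0.\<close>
  moreover have "Z p = w"
  proof -
    have gp: "inner_form (gA p)" by (rule riemannian_metric_inner_form[OF gA p])
    have "Z p \<in> S p" "subspace (S p)"
      using nearby_self[OF p ZS] S nearby_self[OF p] by (auto simp: smooth_distribution_def)
    then have "gA p (Z p - w) (Z p - w) = gB (f p) (mdiff A B f p (Z p - w)) (mdiff A B f p (Z p - w))"
      using assms by (intro iso[OF p]) (simp add: subspace_diff)
    moreover have "mdiff A B f p (Z p - w) = 0"
      using iso_related_point(1)[OF Z] Z'(2) by (simp add: linear_diff[OF linear_mdiff[OF A B f p]])
    ultimately have "gA p (Z p - w) (Z p - w) = 0"
      using riemannian_metric_inner_form[OF gB smooth_map_point[OF A B f p]]
        inner_form_eq_0 by fastforce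
    then show ?thesis using inner_form_eq_0[OF gp] by simp
  qed
  ultimately show ?thesis using that Z by blast
qed

text \<open>By skewness the covariant derivative of the form consists of g(D_X \<phi>Z, Y) and g(D_X
  Z, \<phi>Y), and \<open>connection_related\<close> applies to each of the two.\<close>

lemma cov_deriv_related:
  assumes "u \<in> S p" "v \<in> S p" "w \<in> S p"
  shows "cov_deriv_form A DA (fundamental_form gA \<phi>A) p u v w
    = cov_deriv_form B DB (fundamental_form gB \<phi>B) (f p) (mdiff A B f p u) (mdiff A B f p v) (mdiff A B f p w)"
proof -
  obtain X X' where X: "X p = u" "iso_related A gA B gB f p X X'"
    by (rule related_extension[OF assms(1)])
  obtain Y Y' where Y: "Y p = v" "iso_related A gA B gB f p Y Y'"
    "iso_related A gA B gB f p (\<lambda>q. \<phi>A q (Y q)) (\<lambda>y. \<phi>B y (Y' y))"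
    by (rule related_extension[OF assms(2)])
  obtain Z Z' where Z: "Z p = w" "iso_related A gA B gB f p Z Z'"
    "iso_related A gA B gB f p (\<lambda>q. \<phi>A q (Z q)) (\<lambda>y. \<phi>B y (Z' y))"
    by (rule related_extension[OF assms(3)])
  show ?thesis
    using cov_deriv_fundamental_form[OF A gA DA \<phi>A p iso_relatedD(1)[OF Z(2)], of u v]
      cov_deriv_fundamental_form[OF B gB DB \<phi>B smooth_map_point[OF A B f p] iso_relatedD(2)[OF Z(2)],
        of "X' (f p)" "Y' (f p)"]
      connection_related[OF X(2) Z(3) Y(2)] connection_related[OF X(2) Z(2) Y(3)]
      iso_related_point(1)[OF X(2)] iso_related_point(1)[OF Y(2)] iso_related_point(1)[OF Z(2)]
    unfolding X(1) Y(1) Z(1) by simp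
qed

text \<open>The differential carries an orthonormal basis of \<open>S p\<close> to one of
  \<open>R (f p)\<close>; invariance of the trace then allows an arbitrary orthonormal basis
  there.\<close>

lemma trace_cov_deriv_related:
  assumes e: "orthonormal_family (gA p) I e" "span (e ` I) = S p"
    and e': "orthonormal_family (gB (f p)) J e'" "span (e' ` J) = R (f p)" and w: "w \<in> S p"
  shows "(\<Sum>i\<in>I. cov_deriv_form A DA (fundamental_form gA \<phi>A) p (e i) (e i) w)
    = (\<Sum>j\<in>J. cov_deriv_form B DB (fundamental_form gB \<phi>B) (f p) (e' j) (e' j) (mdiff A B f p w))"
proof -
  let ?T = "\<lambda>u v. cov_deriv_form B DB (fundamental_form gB \<phi>B) (f p) u v (mdiff A B f p w)"
  let ?df = "mdiff A B f p"
  have eS: "e i \<in> S p" if "i \<in> I" for i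
    using e(2) that by (metis image_eqI span_base)
  have "(\<Sum>i\<in>I. cov_deriv_form A DA (fundamental_form gA \<phi>A) p (e i) (e i) w)
      = (\<Sum>i\<in>I. ?T (?df (e i)) (?df (e i)))"
    using cov_deriv_related eS w by (intro sum.cong) auto
  also have "\<dots> = (\<Sum>j\<in>J. ?T (e' j) (e' j))"
  proof (rule orthonormal_trace_eq[OF riemannian_metric_inner_form[OF gB smooth_map_point[OF A B f p]] _ e'(1),
        where b = ?T and e = "\<lambda>i. ?df (e i)"])
    show "orthonormal_family (gB (f p)) I (\<lambda>i. ?df (e i))"
      using e(1) eS iso[OF p] by (simp add: orthonormal_family_def)
    have "span ((\<lambda>i. ?df (e i)) ` I) = ?df ` span (e ` I)"
      using linear_span_image[OF linear_mdiff[OF A B f p], of "e ` I"] by (simp add: image_image)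
    then show "span ((\<lambda>i. ?df (e i)) ` I) = span (e' ` J)"
      using e(2) e'(2) im[OF p] by simp
    show "bilinear ?T"
      by (rule bilinear_cov_deriv[OF B gB DB \<phi>B smooth_map_point[OF A B f p]])
  qed
  finally show ?thesis .
qed

end

end

section \<open>Contact-complex Riemannian submersions\<close>

text \<open>From the axioms follow \<phi> \<xi> = 0, \<eta> o \<phi> = 0 and \<eta> = g(\<xi>, -).
  Then g(\<phi> \<phi> u, \<phi> v) can be evaluated both by compatibility with the metric and by
  the formula for the square of \<phi>.\<close>

lemma almost_contact_skew_endomorphism:
  assumes "almost_contact_metric M \<phi> \<xi> \<eta> g"
  shows "skew_endomorphism M g \<phi>"
  unfolding skew_endomorphism_def
proof (intro conjI ballI allI)
  show "smooth_endomorphism M \<phi>" using assms by (simp add: almost_contact_metric_def)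
  fix p u v assume p: "p \<in> points M"
  have gp: "inner_form (g p)"
    using assms p riemannian_metric_inner_form by (auto simp: almost_contact_metric_def)
  note bl = inner_form_bilinear[OF gp]
  have sq: "\<phi> p (\<phi> p v) = - v + \<eta> p v *\<^sub>R \<xi> p" and one: "\<eta> p (\<xi> p) = 1"
    and comp: "g p (\<phi> p u) (\<phi> p v) = g p u v - \<eta> p u * \<eta> p v" for u v
    using assms p by (auto simp: almost_contact_metric_def)
  have lin: "linear (\<phi> p)"
    using assms p by (auto simp: almost_contact_metric_def smooth_endomorphism_def)
  have \<xi>0: "\<xi> p \<noteq> 0"
    using comp[of "\<xi> p" "\<xi> p"] one
    by (auto simp: linear_0[OF lin] bilinear_lzero[OF bl])
  \<comment> \<open>The formula for the square, applied to \<phi> \<xi>, makes \<phi> \<xi> a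
    multiple of \<xi>; one more application of \<phi> shows that this multiple is zero.\<close>
  have "\<phi> p (\<phi> p (\<xi> p)) = 0" using sq[of "\<xi> p"] one by simp
  then have \<phi>\<xi>: "\<phi> p (\<xi> p) = \<eta> p (\<phi> p (\<xi> p)) *\<^sub>R \<xi> p"
    using sq[of "\<phi> p (\<xi> p)"] by (simp add: linear_0[OF lin])
  then have "0 = \<eta> p (\<phi> p (\<xi> p)) *\<^sub>R \<phi> p (\<xi> p)"
    using \<open>\<phi> p (\<phi> p (\<xi> p)) = 0\<close> linear_scale[OF lin] by metis
  then have \<phi>\<xi>0: "\<phi> p (\<xi> p) = 0" using \<phi>\<xi> by fastforce
  \<comment> \<open>The third power of \<phi> is computed in two ways; the results differ by
    \<eta>(\<phi> w) \<xi>, and \<xi> is nonzero.\<close>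
  have \<eta>\<phi>: "\<eta> p (\<phi> p w) = 0" for w
  proof -
    have "\<phi> p (\<phi> p (\<phi> p w)) = - \<phi> p w"
      using arg_cong[OF sq[of w], of "\<phi> p"]
      by (simp only: linear_add[OF lin] linear_neg[OF lin] linear_scale[OF lin] \<phi>\<xi>0) simp
    then show ?thesis using sq[of "\<phi> p w"] \<xi>0 by simp
  qed
  have \<eta>: "\<eta> p w = g p (\<xi> p) w" for w
    using comp[of "\<xi> p" w] one by (simp add: \<phi>\<xi>0 bilinear_lzero[OF bl])
  have "g p (\<phi> p (\<phi> p u)) (\<phi> p v) = g p (\<phi> p u) v"
    using comp[of "\<phi> p u" v] \<eta>\<phi> by simp
  moreover have "g p (\<phi> p (\<phi> p u)) (\<phi> p v) = - g p u (\<phi> p v) + \<eta> p u * \<eta> p (\<phi> p v)"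
    by (simp only: sq bilinear_ladd[OF bl] bilinear_lneg[OF bl] bilinear_lmul[OF bl] \<eta> real_scaleR_def)
  ultimately show "g p u (\<phi> p v) = - g p (\<phi> p u) v" using \<eta>\<phi> by simp
qed

lemma almost_hermitian_skew_endomorphism:
  assumes "almost_hermitian N J g"
  shows "skew_endomorphism N g J"
  unfolding skew_endomorphism_def
proof (intro conjI ballI allI)
  show "smooth_endomorphism N J" using assms by (simp add: almost_hermitian_def)
  fix p u v assume p: "p \<in> points N"
  have bl: "bilinear (g p)"
    using assms p by (simp add: almost_hermitian_def riemannian_metric_def)
  have "g p (J p (J p u)) (J p v) = g p (J p u) v" "J p (J p u) = - u"
    using assms p unfolding almost_hermitian_def by blast+
  then show "g p u (J p v) = - g p (J p u) v"
    by (simp add: bilinear_lneg[OF bl])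
qed

context
  fixes M :: "('m::{second_countable_topology, t2_space}, 'a::euclidean_space) atlas"
    and N :: "('n::{second_countable_topology, t2_space}, 'b::euclidean_space) atlas"
    and g :: "'m \<Rightarrow> 'a \<Rightarrow> 'a \<Rightarrow> real" and g' :: "'n \<Rightarrow> 'b \<Rightarrow> 'b \<Rightarrow> real" and \<pi> :: "'m \<Rightarrow> 'n"
  assumes M: "smooth_manifold M" and g: "riemannian_metric M g"
    and N: "smooth_manifold N" and g': "riemannian_metric N g'"
    and sub: "riemannian_submersion M g N g' \<pi>"
begin

lemma submersion_smooth: "smooth_map M N \<pi>"
  using sub by (simp add: riemannian_submersion_def)

section \<open>Orthogonal splitting of a tangent space into vertical and horizontal vectors\<close>

context
  fixes p :: 'm
  assumes p: "p \<in> points M"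
begin

lemma submersion_linear: "linear (mdiff M N \<pi> p)"
  by (rule linear_mdiff[OF M N submersion_smooth p])

lemma subspace_vertical: "subspace (vertical M N \<pi> p)"
  unfolding vertical_def using linear_subspace_kernel[OF submersion_linear] .

lemma point_inner_form: "inner_form (g p)"
  by (rule riemannian_metric_inner_form[OF g p])

lemma subspace_horizontal: "subspace (horizontal M g N \<pi> p)"
  unfolding horizontal_def subspace_def
  by (simp add: bilinear_expand[OF inner_form_bilinear[OF point_inner_form]])

lemma vertical_horizontal_orthogonal:
  assumes "v \<in> vertical M N \<pi> p" "h \<in> horizontal M g N \<pi> p"
  shows "g p h v = 0" "g p v h = 0"
  using assms inner_form_commute[OF point_inner_form, of v h] by (auto simp: horizontal_def)

lemma vertical_horizontal_disjoint:
  "v \<in> vertical M N \<pi> p \<Longrightarrow> v \<in> horizontal M g N \<pi> p \<Longrightarrow> v = 0"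
  using vertical_horizontal_orthogonal inner_form_eq_0[OF point_inner_form] by blast

lemma vproj_eqI:
  assumes "w \<in> vertical M N \<pi> p" "u - w \<in> horizontal M g N \<pi> p"
  shows "vproj M g N \<pi> p u = w"
  unfolding vproj_def
proof (rule the_equality)
  fix x assume x: "x \<in> vertical M N \<pi> p \<and> u - x \<in> horizontal M g N \<pi> p"
  then have "(u - x) - (u - w) \<in> horizontal M g N \<pi> p"
    using assms subspace_diff[OF subspace_horizontal] by blast
  moreover have "w - x \<in> vertical M N \<pi> p"
    using assms x subspace_diff[OF subspace_vertical] by blast
  ultimately show "x = w" using vertical_horizontal_disjoint[of "w - x"] by simp
qed (use assms in simp)

lemma hproj_eqI:
  assumes "w \<in> horizontal M g N \<pi> p" "u - w \<in> vertical M N \<pi> p"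
  shows "hproj M g N \<pi> p u = w"
  unfolding hproj_def
proof (rule the_equality)
  fix x assume x: "x \<in> horizontal M g N \<pi> p \<and> u - x \<in> vertical M N \<pi> p"
  then have "(u - x) - (u - w) \<in> vertical M N \<pi> p"
    using assms subspace_diff[OF subspace_vertical] by blast
  moreover have "w - x \<in> horizontal M g N \<pi> p"
    using assms x subspace_diff[OF subspace_horizontal] by blast
  ultimately show "x = w" using vertical_horizontal_disjoint[of "w - x"] by simp
qed (use assms in simp)

lemma vertical_decomposition:
  "\<exists>w\<in>vertical M N \<pi> p. u - w \<in> horizontal M g N \<pi> p"
  using orthogonal_decomposition[OF point_inner_form subspace_vertical, of u]
  by (auto simp: horizontal_def)

lemma vproj_vertical: "vproj M g N \<pi> p u \<in> vertical M N \<pi> p"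
  and hproj_horizontal: "hproj M g N \<pi> p u \<in> horizontal M g N \<pi> p"
  and hproj_vproj: "hproj M g N \<pi> p u + vproj M g N \<pi> p u = u"
proof -
  obtain w where w: "w \<in> vertical M N \<pi> p" "u - w \<in> horizontal M g N \<pi> p"
    using vertical_decomposition by blast
  then have "vproj M g N \<pi> p u = w" "hproj M g N \<pi> p u = u - w"
    by (auto intro: vproj_eqI hproj_eqI)
  then show "vproj M g N \<pi> p u \<in> vertical M N \<pi> p" "hproj M g N \<pi> p u \<in> horizontal M g N \<pi> p"
    "hproj M g N \<pi> p u + vproj M g N \<pi> p u = u"
    using w by auto
qed

lemma proj_of_horizontal:
  assumes "u \<in> horizontal M g N \<pi> p"
  shows "hproj M g N \<pi> p u = u" "vproj M g N \<pi> p u = 0"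
  using assms subspace_0[OF subspace_vertical] by (auto intro: vproj_eqI hproj_eqI)

lemma metric_vproj:
  assumes "v \<in> vertical M N \<pi> p"
  shows "g p (vproj M g N \<pi> p u) v = g p u v" "g p (hproj M g N \<pi> p u) v = 0"
proof -
  show 0: "g p (hproj M g N \<pi> p u) v = 0"
    by (rule vertical_horizontal_orthogonal(1)[OF assms hproj_horizontal])
  have "g p u v = g p (hproj M g N \<pi> p u + vproj M g N \<pi> p u) v" by (simp add: hproj_vproj)
  then show "g p (vproj M g N \<pi> p u) v = g p u v"
    using 0 by (simp add: bilinear_ladd[OF inner_form_bilinear[OF point_inner_form]])
qed

lemma metric_hproj:
  assumes "h \<in> horizontal M g N \<pi> p"
  shows "g p (hproj M g N \<pi> p u) h = g p u h"
proof -
  have "g p u h = g p (hproj M g N \<pi> p u + vproj M g N \<pi> p u) h" by (simp add: hproj_vproj)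
  then show ?thesis
    using vertical_horizontal_orthogonal(2)[OF vproj_vertical assms]
    by (simp add: bilinear_ladd[OF inner_form_bilinear[OF point_inner_form]])
qed

lemma vertical_if_orthogonal:
  assumes "\<And>h. h \<in> horizontal M g N \<pi> p \<Longrightarrow> g p v h = 0"
  shows "v \<in> vertical M N \<pi> p"
proof -
  have "g p (hproj M g N \<pi> p v) (hproj M g N \<pi> p v) = 0"
    using metric_hproj[OF hproj_horizontal] assms[OF hproj_horizontal] by simp
  then have "hproj M g N \<pi> p v = 0" using inner_form_eq_0[OF point_inner_form] by simp
  then show ?thesis using vproj_vertical[of v] hproj_vproj[of v] by simp
qed

lemma mdiff_hproj: "mdiff M N \<pi> p (hproj M g N \<pi> p u) = mdiff M N \<pi> p u"
proof -
  have "mdiff M N \<pi> p u = mdiff M N \<pi> p (hproj M g N \<pi> p u + vproj M g N \<pi> p u)"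
    by (simp add: hproj_vproj)
  then show ?thesis
    using vproj_vertical by (simp add: linear_add[OF submersion_linear] vertical_def)
qed

lemma mdiff_horizontal_image: "mdiff M N \<pi> p ` horizontal M g N \<pi> p = UNIV"
proof -
  have "surj (mdiff M N \<pi> p)" using sub p by (simp add: riemannian_submersion_def)
  then have "\<exists>u. y = mdiff M N \<pi> p (hproj M g N \<pi> p u)" for y
    using mdiff_hproj surjD by metis
  then show ?thesis using hproj_horizontal by blast
qed

text \<open>The isometry condition concerns pairs of horizontal vectors, but the vertical part of u
  is killed by the differential and is orthogonal to w. This is the one-sided form required by
  \<open>iso_related\<close>.\<close>

lemma metric_horizontal:
  assumes "w \<in> horizontal M g N \<pi> p"
  shows "g p u w = g' (\<pi> p) (mdiff M N \<pi> p u) (mdiff M N \<pi> p w)"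
proof -
  have "g' (\<pi> p) (mdiff M N \<pi> p (hproj M g N \<pi> p u)) (mdiff M N \<pi> p w) = g p (hproj M g N \<pi> p u) w"
    using sub p assms hproj_horizontal unfolding riemannian_submersion_def by blast
  then show ?thesis by (simp add: mdiff_hproj metric_hproj[OF assms])
qed

lemma dim_horizontal: "dim (horizontal M g N \<pi> p) = DIM('b)"
proof -
  have "inj_on (mdiff M N \<pi> p) (horizontal M g N \<pi> p)"
    by (subst linear_inj_on_iff_eq_0[OF submersion_linear subspace_horizontal])
      (auto simp: vertical_def intro: vertical_horizontal_disjoint)
  then have "dim (mdiff M N \<pi> p ` horizontal M g N \<pi> p) = dim (horizontal M g N \<pi> p)"
    by (intro dim_image_eq[OF submersion_linear])
      (simp only: span_eq_iff[of "horizontal M g N \<pi> p", THEN iffD2, OF subspace_horizontal])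
  then show ?thesis by (simp add: mdiff_horizontal_image)
qed

lemma dim_vertical: "dim (vertical M N \<pi> p) + DIM('b) = DIM('a)"
proof -
  have "{x + y |x y. x \<in> vertical M N \<pi> p \<and> y \<in> horizontal M g N \<pi> p} = UNIV"
  proof (intro set_eqI iffI UNIV_I)
    fix u :: 'a
    have "u = vproj M g N \<pi> p u + hproj M g N \<pi> p u" using hproj_vproj[of u] by (simp only: add.commute)
    then show "u \<in> {x + y |x y. x \<in> vertical M N \<pi> p \<and> y \<in> horizontal M g N \<pi> p}"
      using hproj_horizontal vproj_vertical by blast
  qed
  moreover have "vertical M N \<pi> p \<inter> horizontal M g N \<pi> p = {0}"
    using vertical_horizontal_disjoint subspace_0[OF subspace_vertical] subspace_0[OF subspace_horizontal]
    by blast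
  ultimately show ?thesis
    using dim_sums_Int[OF subspace_vertical subspace_horizontal] by (simp add: dim_horizontal)
qed

end

text \<open>Local horizontal fields arise as gradients of the coordinate functions of
  \<open>N\<close> pulled back to \<open>M\<close>: a gradient is horizontal because these functions
  have zero derivative along vertical vectors.\<close>

lemma smooth_distribution_horizontal:
  assumes p: "p \<in> points M"
  shows "smooth_distribution M (horizontal M g N \<pi>) p"
  unfolding smooth_distribution_def
proof (intro conjI ballI)
  show "\<forall>\<^sub>F q in nearby M p. subspace (horizontal M g N \<pi> q) \<and>
      dim (horizontal M g N \<pi> q) = dim (horizontal M g N \<pi> p)"
    using nearby_points[OF p] by eventually_elim (simp add: subspace_horizontal dim_horizontal p)
next
  fix v assume v: "v \<in> horizontal M g N \<pi> p"
  note \<pi>p = smooth_map_point[OF M N submersion_smooth p]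
  obtain V d where V: "(V, d) \<in> N" "\<pi> p \<in> V" using chart_atE[OF N \<pi>p] by blast
  let ?n = "dim (UNIV :: 'a set)"
  obtain e where "smooth_frame M g (\<lambda>_. UNIV) p e"
    using smooth_frame_ex[OF M g p smooth_distribution_UNIV[OF M g p]] by blast
  then have e: "\<And>i. i < ?n \<Longrightarrow> smooth_vf_near M p (e i)"
    and ev: "\<forall>\<^sub>F q in nearby M p. orthonormal_family (g q) {..<?n} (\<lambda>i. e i q) \<and>
      span ((\<lambda>i. e i q) ` {..<?n}) = UNIV"
    by (auto simp: smooth_frame_def)
  \<comment> \<open>\<open>G b\<close> is the gradient of the b-component of d o \<pi>; the
    orthonormal frame of the whole tangent space makes its smoothness visible.\<close>
  define G where "G b q = (\<Sum>k<?n. (dfun M q (\<lambda>q. d (\<pi> q)) (e k q) \<bullet> b) *\<^sub>R e k q)" for b q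
  have G_smooth: "smooth_vf_near M p (G b)" for b
    unfolding G_def
    by (intro smooth_vf_near_sum[OF M p] smooth_vf_near_scaleR[OF M p] e
        smooth_fun_near_linear[OF M p bounded_linear_inner_left] smooth_fun_near_dfun[OF M p]
        smooth_map_pullback[OF M N submersion_smooth p] smooth_chart[OF N V]) auto
  have "\<forall>\<^sub>F q in nearby M p. \<pi> q \<in> V"
    using smooth_map_nearby[OF M N submersion_smooth p, of "\<lambda>y. y \<in> V"]
      open_in_nearby[of N V "\<pi> p"] chart_facts(1)[OF N] V by blast
  with ev nearby_points[OF p] have G: "\<forall>\<^sub>F q in nearby M p.
      \<forall>b x. g q (G b q) x = dfun N (\<pi> q) d (mdiff M N \<pi> q x) \<bullet> b"
  proof eventually_elim
    case (elim q)
    have gq: "inner_form (g q)" by (rule point_inner_form[OF elim(2)])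
    have sm: "smooth_fun_near N (\<pi> q) d" by (rule smooth_chart[OF N V(1) elim(3)])
    have dd: "dfun M q (\<lambda>q. d (\<pi> q)) x = dfun N (\<pi> q) d (mdiff M N \<pi> q x)" for x
      by (rule dfun_smooth_map[OF M N submersion_smooth elim(2) sm])
    have lin: "linear (dfun M q (\<lambda>q. d (\<pi> q)))"
      by (rule linear_dfun[OF M elim(2) smooth_map_pullback[OF M N submersion_smooth elim(2) sm]])
    have "g q (G b q) x = dfun M q (\<lambda>q. d (\<pi> q)) x \<bullet> b" for b x
    proof -
      have "x = (\<Sum>k<?n. g q x (e k q) *\<^sub>R e k q)"
        by (rule orthonormal_expand[OF gq]) (use elim(1) in auto)
      from arg_cong[OF this, of "dfun M q (\<lambda>q. d (\<pi> q))"]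
      have "dfun M q (\<lambda>q. d (\<pi> q)) x = (\<Sum>k<?n. g q x (e k q) *\<^sub>R dfun M q (\<lambda>q. d (\<pi> q)) (e k q))"
        by (simp only: linear_sum[OF lin] linear_scale[OF lin])
      then show ?thesis
        by (simp add: G_def bilinear_sum_left[OF inner_form_bilinear[OF gq]]
            bilinear_lmul[OF inner_form_bilinear[OF gq]] inner_sum_left inner_form_commute[OF gq, of x]
            mult.commute)
    qed
    then show ?case using dd by simp
  qed
  have lin_d: "linear (dfun N y d)" if "y \<in> V" for y
    using that V(1) chart_facts(4)[OF N V(1)] by (intro linear_dfun[OF N] smooth_chart[OF N]) auto
  have "\<forall>\<^sub>F q in nearby M p. G b q \<in> horizontal M g N \<pi> q" for b
    using G \<open>\<forall>\<^sub>F q in nearby M p. \<pi> q \<in> V\<close>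
    by eventually_elim (simp add: horizontal_def vertical_def linear_0[OF lin_d])
  note G_hor = this
  \<comment> \<open>Surjectivity of the differential makes b \<mapsto> G b p injective, so by
    dimension the gradients at \<open>p\<close> fill the horizontal space.\<close>
  have "v \<in> range (\<lambda>b. G b p)"
  proof -
    note Gp = nearby_self[OF p G, rule_format]
    have lin: "linear (\<lambda>b. G b p)"
      by (rule linearI) (simp_all add: G_def inner_add_right scaleR_add_left sum.distrib scaleR_sum_right)
    have "inj (\<lambda>b. G b p)"
      unfolding linear_injective_0[OF lin]
    proof (intro allI impI)
      fix b assume "G b p = 0"
      then have "dfun N (\<pi> p) d (mdiff M N \<pi> p x) \<bullet> b = 0" for x
        using Gp[of b x] by (simp add: bilinear_lzero[OF inner_form_bilinear[OF point_inner_form[OF p]]])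
      moreover have "surj (dfun N (\<pi> p) d)" using bij_dfun_chart[OF N \<pi>p V] by (simp add: bij_is_surj)
      moreover have "surj (mdiff M N \<pi> p)" using sub p by (simp add: riemannian_submersion_def)
      ultimately have "b \<bullet> b = 0" by (metis surjD)
      then show "b = 0" by simp
    qed
    then have "dim (range (\<lambda>b. G b p)) = DIM('b)"
      using dim_image_eq[OF lin, of UNIV] by simp
    moreover have "range (\<lambda>b. G b p) \<subseteq> horizontal M g N \<pi> p"
      using nearby_self[OF p G_hor] by blast
    ultimately have "range (\<lambda>b. G b p) = horizontal M g N \<pi> p"
      using linear_subspace_image[OF lin subspace_UNIV]
      by (intro subspace_dim_equal) (simp_all add: subspace_horizontal[OF p] dim_horizontal[OF p])
    then show ?thesis using v by simp
  qed
  then obtain b where "G b p = v" by blast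
  then show "\<exists>X. smooth_vf_near M p X \<and> X p = v \<and> (\<forall>\<^sub>F q in nearby M p. X q \<in> horizontal M g N \<pi> q)"
    using G_smooth G_hor by blast
qed

text \<open>Any local extension of a vertical vector becomes vertical after subtracting its
  horizontal part, which is smooth when written in a horizontal frame and vanishes at
  \<open>p\<close>.\<close>

lemma smooth_distribution_vertical:
  assumes p: "p \<in> points M"
  shows "smooth_distribution M (vertical M N \<pi>) p"
  unfolding smooth_distribution_def
proof (intro conjI ballI)
  show "\<forall>\<^sub>F q in nearby M p. subspace (vertical M N \<pi> q) \<and>
      dim (vertical M N \<pi> q) = dim (vertical M N \<pi> p)"
    using nearby_points[OF p]
    by eventually_elim (use subspace_vertical dim_vertical p in \<open>metis add_right_cancel\<close>)
next
  fix v assume v: "v \<in> vertical M N \<pi> p"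
  let ?r = "dim (horizontal M g N \<pi> p)"
  obtain e where "smooth_frame M g (horizontal M g N \<pi>) p e"
    using smooth_frame_ex[OF M g p smooth_distribution_horizontal[OF p]] by blast
  then have e: "\<And>i. i < ?r \<Longrightarrow> smooth_vf_near M p (e i)"
    and ev: "\<forall>\<^sub>F q in nearby M p. orthonormal_family (g q) {..<?r} (\<lambda>i. e i q) \<and>
      span ((\<lambda>i. e i q) ` {..<?r}) = horizontal M g N \<pi> q"
    by (auto simp: smooth_frame_def)
  obtain X where X: "smooth_vf_near M p X" "X p = v" using smooth_vf_near_ex[OF M p] by blast
  define Y where "Y q = X q - (\<Sum>i<?r. g q (X q) (e i q) *\<^sub>R e i q)" for q
  have "smooth_vf_near M p Y"
    unfolding Y_def by (rule smooth_vf_near_residual[OF M g p X(1) e])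
  moreover have "e i p \<in> horizontal M g N \<pi> p" if "i < ?r" for i
    using nearby_self[OF p ev] that by (metis image_eqI lessThan_iff span_base)
  then have "Y p = v"
    using vertical_horizontal_orthogonal(2)[OF p v] by (simp add: Y_def X(2))
  moreover have "\<forall>\<^sub>F q in nearby M p. Y q \<in> vertical M N \<pi> q"
    using ev nearby_points[OF p]
  proof eventually_elim
    case (elim q)
    note gq = point_inner_form[OF elim(2)]
    have "g q (Y q) (e i q) = 0" if "i < ?r" for i
      using orthonormal_residual[OF gq conjunct1[OF elim(1)]] that by (simp add: Y_def)
    then have "g q (Y q) h = 0" if "h \<in> horizontal M g N \<pi> q" for h
      using orthogonal_span[OF gq, of "(\<lambda>i. e i q) ` {..<?r}" "Y q" h] elim(1) that by auto
    then show ?case by (rule vertical_if_orthogonal[OF elim(2)])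
  qed
  ultimately show "\<exists>X. smooth_vf_near M p X \<and> X p = v \<and> (\<forall>\<^sub>F q in nearby M p. X q \<in> vertical M N \<pi> q)"
    by blast
qed

end

section \<open>Traces of the covariant derivative of the fundamental form\<close>

lemma orthogonal_fields:
  fixes M :: "('m::{second_countable_topology, t2_space}, 'a::euclidean_space) atlas"
  assumes M: "smooth_manifold M" and g: "riemannian_metric M g" and D: "levi_civita M g D"
    and p: "p \<in> points M" and Y: "smooth_vf_near M p Y" and Z: "smooth_vf_near M p Z"
    and orth: "\<forall>\<^sub>F q in nearby M p. g q (Y q) (Z q) = 0"
  shows "g p (D p u Y) (Z p) = - g p (Y p) (D p u Z)"
proof -
  have "\<forall>\<^sub>F q in nearby M p. 0 = g q (Y q) (Z q)" using orth by eventually_elim simp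
  then have "dfun M p (\<lambda>q. g q (Y q) (Z q)) u = 0"
    using dfun_cong[OF M p smooth_fun_near_const[OF M p]] dfun_const[OF M p] by metis
  then show ?thesis using connection_metric[OF M g D p Y Z] by simp
qed

context
  fixes M :: "('m::{second_countable_topology, t2_space}, 'a::euclidean_space) atlas"
    and N :: "('n::{second_countable_topology, t2_space}, 'b::euclidean_space) atlas"
    and g :: "'m \<Rightarrow> 'a \<Rightarrow> 'a \<Rightarrow> real" and g' :: "'n \<Rightarrow> 'b \<Rightarrow> 'b \<Rightarrow> real" and \<pi> :: "'m \<Rightarrow> 'n"
    and D :: "'m \<Rightarrow> 'a \<Rightarrow> ('m \<Rightarrow> 'a) \<Rightarrow> 'a" and D' :: "'n \<Rightarrow> 'b \<Rightarrow> ('n \<Rightarrow> 'b) \<Rightarrow> 'b"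
    and \<phi> :: "'m \<Rightarrow> 'a \<Rightarrow> 'a" and J :: "'n \<Rightarrow> 'b \<Rightarrow> 'b" and p :: 'm
  assumes M: "smooth_manifold M" and g: "riemannian_metric M g" and D: "levi_civita M g D"
    and N: "smooth_manifold N" and g': "riemannian_metric N g'" and D': "levi_civita N g' D'"
    and sub: "riemannian_submersion M g N g' \<pi>"
    and \<phi>: "skew_endomorphism M g \<phi>" and J: "skew_endomorphism N g' J"
    and intertwine: "\<And>q v. q \<in> points M \<Longrightarrow> mdiff M N \<pi> q (\<phi> q v) = J (\<pi> q) (mdiff M N \<pi> q v)"
    and p: "p \<in> points M"
begin

private abbreviation (input) "H \<equiv> horizontal M g N \<pi>"
private abbreviation (input) "V \<equiv> vertical M N \<pi>"

lemma phi_skew: "q \<in> points M \<Longrightarrow> g q u (\<phi> q v) = - g q (\<phi> q u) v"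
  using \<phi> by (simp add: skew_endomorphism_def)

lemma linear_phi: "q \<in> points M \<Longrightarrow> linear (\<phi> q)"
  using \<phi> by (simp add: skew_endomorphism_def smooth_endomorphism_def)

lemma phi_vertical: "q \<in> points M \<Longrightarrow> v \<in> V q \<Longrightarrow> \<phi> q v \<in> V q"
  using J smooth_map_point[OF M N submersion_smooth[OF M g N g' sub]] linear_0
  by (fastforce simp: vertical_def intertwine skew_endomorphism_def smooth_endomorphism_def)

lemma phi_horizontal: "q \<in> points M \<Longrightarrow> h \<in> H q \<Longrightarrow> \<phi> q h \<in> H q"
  using phi_vertical phi_skew by (fastforce simp: horizontal_def)

private lemmas submersion_at = M g N g' sub p
private lemmas bilinear_at = inner_form_bilinear[OF point_inner_form[OF M g N g' sub p]]

text \<open>A vertical field is related to the zero field, so its bracket with a projectable field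
  is related to a bracket with zero. It serves for X basic as well as for X vertical, where X' is
  zero.\<close>

lemma mdiff_bracket_vertical:
  assumes "smooth_vf_near M p X" "smooth_vf_near N (\<pi> p) X'" "\<forall>\<^sub>F q in nearby M p. mdiff M N \<pi> q (X q) = X' (\<pi> q)"
    and "smooth_vf_near M p Y" "\<forall>\<^sub>F q in nearby M p. Y q \<in> V q"
  shows "D p (X p) Y - D p (Y p) X \<in> V p"
proof -
  note \<pi> = submersion_smooth[OF M g N g' sub]
  note \<pi>p = smooth_map_point[OF M N \<pi> p]
  have "\<forall>\<^sub>F q in nearby M p. mdiff M N \<pi> q (Y q) = (\<lambda>y. 0) (\<pi> q)"
    using assms(5) by eventually_elim (simp add: vertical_def)
  then have "mdiff M N \<pi> p (D p (X p) Y - D p (Y p) X) = D' (\<pi> p) (X' (\<pi> p)) (\<lambda>y. 0) - D' (\<pi> p) 0 X'"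
    using bracket_related[OF M g D N g' D' \<pi> p assms(1-4) smooth_vf_near_zero[OF N \<pi>p]] by simp
  also have "\<dots> = 0"
    using connection_zero[OF N g' D' \<pi>p] linear_0[OF connection_linear[OF N g' D' \<pi>p assms(2)]] by simp
  finally show ?thesis by (simp add: vertical_def)
qed

text \<open>
  O'Neill's tensor \<open>A\<close> is alternating: on a basic field \<open>E\<close> the function \<open>g(E, E)\<close> is constant
  along the fibres and \<open>[E, Y]\<close> is vertical for vertical \<open>Y\<close>.
\<close>

lemma connection_vertical_field_alternating:
  assumes u: "u \<in> H p" and Y: "smooth_vf_near M p Y" "\<forall>\<^sub>F q in nearby M p. Y q \<in> V q"
  shows "g p u (D p u Y) = 0"
proof -
  note \<pi> = submersion_smooth[OF M g N g' sub]
  have im: "mdiff M N \<pi> q ` H q = UNIV" if "q \<in> points M" for q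
    by (rule mdiff_horizontal_image[OF M g N g' sub that])
  obtain E E' where E: "E p = u" "iso_related M g N g' \<pi> p E E'"
  proof (rule related_extension[OF M g D N g' D' \<pi> p \<phi> J smooth_distribution_horizontal[OF M g N g' sub p]
        smooth_distribution_UNIV[OF N g' smooth_map_point[OF M N \<pi> p]] _ phi_horizontal intertwine im u])
    show "g q u w = g' (\<pi> q) (mdiff M N \<pi> q u) (mdiff M N \<pi> q w)" if "q \<in> points M" "w \<in> H q" for q u w
      by (rule metric_horizontal[OF M g N g' sub that])
  qed
  note E_smooth = iso_relatedD[OF M g D N g' D' \<pi> p E(2)]
  have Yp: "Y p \<in> V p" by (rule nearby_self[OF p Y(2)])
  have "dfun M p (\<lambda>q. g q (E q) (E q)) (Y p) = 0"
    unfolding metric_related[OF M g D N g' D' \<pi> p E(2) E(2)]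
    using Yp linear_0[OF linear_dfun[OF N smooth_map_point[OF M N \<pi> p]
        smooth_vf_near_metric[OF N g' smooth_map_point[OF M N \<pi> p] E_smooth(2,2)]]]
    by (simp add: vertical_def)
  then have "g p u (D p (Y p) E) = 0"
    using connection_metric[OF M g D p E_smooth(1,1), of "Y p"] E(1)
      inner_form_commute[OF point_inner_form[OF submersion_at], of "D p (Y p) E" u] by simp
  moreover have "D p u Y - D p (Y p) E \<in> V p"
    using mdiff_bracket_vertical[OF E_smooth Y] E(1) by simp
  then have "g p u (D p u Y - D p (Y p) E) = 0"
    using vertical_horizontal_orthogonal(1)[OF submersion_at _ u] by blast
  ultimately show ?thesis by (simp add: bilinear_rsub[OF bilinear_at])
qed

text \<open>Polarisation of the preceding lemma.\<close>

lemma connection_vertical_field_skew: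
  assumes "u \<in> H p" "w \<in> H p" and Y: "smooth_vf_near M p Y" "\<forall>\<^sub>F q in nearby M p. Y q \<in> V q"
  shows "g p u (D p w Y) = - g p w (D p u Y)"
proof -
  have lin: "linear (\<lambda>v. D p v Y)" by (rule connection_linear[OF M g D p Y(1)])
  have "u + w \<in> H p" by (rule subspace_add[OF subspace_horizontal[OF submersion_at] assms(1,2)])
  then have "g p (u + w) (D p (u + w) Y) = 0" "g p u (D p u Y) = 0" "g p w (D p w Y) = 0"
    using connection_vertical_field_alternating Y assms(1,2) by blast+
  then show ?thesis
    by (simp add: linear_add[OF lin] bilinear_ladd[OF bilinear_at] bilinear_radd[OF bilinear_at])
qed

text \<open>Both traces run over the same chosen frame, so the identity is proved term by term.
  Paired with v, B(E, E) becomes g(D_E \<phi>E, v) - g(D_{\<phi>E} E, v), and alternation makes both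
  contributions equal; hence the factor 1/2.\<close>

lemma trace_horizontal:
  assumes v: "v \<in> V p"
  shows "(\<Sum>i<dim (H p). cov_deriv_form M D (fundamental_form g \<phi>) p
      (local_frame M g H p i p) (local_frame M g H p i p) v) = - (1/2) * g p (trace_Bh M \<phi> g D N \<pi> p) v"
proof -
  let ?E = "local_frame M g H p" and ?r = "dim (H p)"
  have "smooth_frame M g H p ?E"
    by (rule smooth_frame_local_frame[OF M g p smooth_distribution_horizontal[OF submersion_at]])
  then have E: "\<And>i. i < ?r \<Longrightarrow> smooth_vf_near M p (?E i)"
    and ev: "\<forall>\<^sub>F q in nearby M p. span ((\<lambda>i. ?E i q) ` {..<?r}) = H q"
    by (auto simp: smooth_frame_def elim: eventually_mono)
  have EH: "\<forall>\<^sub>F q in nearby M p. ?E i q \<in> H q" if "i < ?r" for i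
    using ev by eventually_elim (use that in \<open>metis image_eqI lessThan_iff span_base\<close>)
  obtain Y where Y: "smooth_vf_near M p Y" "Y p = \<phi> p v" "\<forall>\<^sub>F q in nearby M p. Y q \<in> V q"
    using smooth_distribution_vertical[OF submersion_at] phi_vertical[OF p v]
    unfolding smooth_distribution_def by blast
  obtain Z where Z: "smooth_vf_near M p Z" "Z p = v" "\<forall>\<^sub>F q in nearby M p. Z q \<in> V q"
    using smooth_distribution_vertical[OF submersion_at] v
    unfolding smooth_distribution_def by blast
  \<comment> \<open>Derivatives of horizontal fields are thrown onto vertical extensions of v and of
    \<phi> v, for which the alternation is available.\<close>
  have conn: "g p (D p u X) (W p) = - g p (X p) (D p u W)"
    if "smooth_vf_near M p X" "\<forall>\<^sub>F q in nearby M p. X q \<in> H q"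
      "smooth_vf_near M p W" "\<forall>\<^sub>F q in nearby M p. W q \<in> V q" for u X W
  proof (rule orthogonal_fields[OF M g D p that(1,3)])
    show "\<forall>\<^sub>F q in nearby M p. g q (X q) (W q) = 0"
      using that(2,4) nearby_points[OF p]
      by eventually_elim (simp add: vertical_horizontal_orthogonal[OF M g N g' sub])
  qed
  have "cov_deriv_form M D (fundamental_form g \<phi>) p (?E i p) (?E i p) v
      = - (1/2) * g p (tensor_B M \<phi> g D N \<pi> (?E i) (?E i) p) v" if i: "i < ?r" for i
  proof -
    let ?e = "?E i p" and ?\<phi>E = "\<lambda>q. \<phi> q (?E i q)"
    have e: "?e \<in> H p" by (rule nearby_self[OF p EH[OF i]])
    have \<phi>E: "smooth_vf_near M p ?\<phi>E"
      by (rule smooth_vf_near_skew[OF M g D \<phi> p E[OF i]])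
    have \<phi>EH: "\<forall>\<^sub>F q in nearby M p. ?\<phi>E q \<in> H q"
      using EH[OF i] nearby_points[OF p] by eventually_elim (simp add: phi_horizontal)
    \<comment> \<open>Here \<phi> v is again vertical and both horizontal slots hold the same
      vector, so alternation removes the second term of the covariant derivative.\<close>
    have "g p (D p ?e (?E i)) (\<phi> p v) = 0"
      using conn[OF E[OF i] EH[OF i] Y(1,3)] Y(2) connection_vertical_field_alternating[OF e Y(1,3)] by simp
    then have cov: "cov_deriv_form M D (fundamental_form g \<phi>) p ?e ?e v = - g p (D p ?e ?\<phi>E) v"
      using cov_deriv_fundamental_form'[OF M g D \<phi> p E[OF i]] by simp
    have "g p (D p (\<phi> p ?e) (?E i)) v = - g p ?e (D p (\<phi> p ?e) Z)"
      using conn[OF E[OF i] EH[OF i] Z(1,3)] Z(2) by simp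
    also have "\<dots> = g p (\<phi> p ?e) (D p ?e Z)"
      using connection_vertical_field_skew[OF e phi_horizontal[OF p e] Z(1,3)] by simp
    also have "\<dots> = - g p (D p ?e ?\<phi>E) v"
      using conn[OF \<phi>E \<phi>EH Z(1,3)] Z(2) by simp
    finally have alt: "g p (D p (\<phi> p ?e) (?E i)) v = - g p (D p ?e ?\<phi>E) v" .
    have proj: "\<forall>\<^sub>F q in nearby M p. hproj M g N \<pi> q (?E i q) = ?E i q \<and> vproj M g N \<pi> q (?E i q) = 0"
      using EH[OF i] nearby_points[OF p]
      by eventually_elim (simp add: proj_of_horizontal[OF M g N g' sub])
    \<comment> \<open>The frame fields are horizontal near \<open>p\<close> and not just at
      \<open>p\<close>; locality of the connection therefore removes the projections, and the two
      summands of B containing v E vanish.\<close>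
    have "D p u (\<lambda>q. \<phi> q (hproj M g N \<pi> q (?E i q))) = D p u ?\<phi>E"
      "D p u (\<lambda>q. hproj M g N \<pi> q (?E i q)) = D p u (?E i)"
      "D p u (\<lambda>q. \<phi> q (vproj M g N \<pi> q (?E i q))) = D p u (\<lambda>q. 0)"
      "D p u (\<lambda>q. vproj M g N \<pi> q (?E i q)) = D p u (\<lambda>q. 0)" for u
      by (rule connection_cong[OF M g D p, symmetric],
          (rule \<phi>E E[OF i] smooth_vf_near_zero[OF M p]),
          use proj nearby_points[OF p] in eventually_elim, simp add: linear_0[OF linear_phi])+
    then have "tensor_B M \<phi> g D N \<pi> (?E i) (?E i) p
        = vproj M g N \<pi> p (D p ?e ?\<phi>E) - vproj M g N \<pi> p (D p (\<phi> p ?e) (?E i))"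
      using nearby_self[OF p proj] by (simp add: tensor_B_def Let_def connection_zero[OF M g D p])
    then have "g p (tensor_B M \<phi> g D N \<pi> (?E i) (?E i) p) v
        = g p (D p ?e ?\<phi>E) v - g p (D p (\<phi> p ?e) (?E i)) v"
      using metric_vproj(1)[OF submersion_at v] by (simp add: bilinear_lsub[OF bilinear_at])
    then show ?thesis using cov alt by simp
  qed
  then have "(\<Sum>i<?r. cov_deriv_form M D (fundamental_form g \<phi>) p (?E i p) (?E i p) v)
      = (\<Sum>i<?r. - (1/2) * g p (tensor_B M \<phi> g D N \<pi> (?E i) (?E i) p) v)"
    by (intro sum.cong) auto
  also have "\<dots> = - (1/2) * g p (trace_Bh M \<phi> g D N \<pi> p) v"
    unfolding trace_Bh_def frame_sum_def bilinear_sum_left[OF bilinear_at] sum_distrib_left ..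
  finally show ?thesis .
qed

text \<open>Each term is - g(D_W \<phi>W, x) - g(D_W W, \<phi>x). The first part sums to zero, and
  the second is the mean curvature because \<phi>x is horizontal.\<close>

lemma trace_vertical:
  assumes x: "x \<in> H p"
  shows "(\<Sum>i<dim (V p). cov_deriv_form M D (fundamental_form g \<phi>) p
      (local_frame M g V p i p) (local_frame M g V p i p) x) = - g p (mean_curvature M g D N \<pi> p) (\<phi> p x)"
proof -
  let ?W = "local_frame M g V p" and ?r = "dim (V p)"
  have "smooth_frame M g V p ?W"
    by (rule smooth_frame_local_frame[OF M g p smooth_distribution_vertical[OF submersion_at]])
  then have W: "\<And>i. i < ?r \<Longrightarrow> smooth_vf_near M p (?W i)"
    and ev: "\<forall>\<^sub>F q in nearby M p. orthonormal_family (g q) {..<?r} (\<lambda>i. ?W i q) \<and>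
      span ((\<lambda>i. ?W i q) ` {..<?r}) = V q"
    by (auto simp: smooth_frame_def)
  have WV: "\<forall>\<^sub>F q in nearby M p. ?W i q \<in> V q" if "i < ?r" for i
    using ev by eventually_elim (use that in \<open>metis image_eqI lessThan_iff span_base\<close>)
  obtain X where X: "smooth_vf_near M p X" "X p = x" "\<forall>\<^sub>F q in nearby M p. X q \<in> H q"
    using smooth_distribution_horizontal[OF submersion_at] x
    unfolding smooth_distribution_def by blast
  have conn: "g p (D p u Y) x = - g p (Y p) (D p u X)"
    if "smooth_vf_near M p Y" "\<forall>\<^sub>F q in nearby M p. Y q \<in> V q" for u Y
  proof -
    have "\<forall>\<^sub>F q in nearby M p. g q (Y q) (X q) = 0"
      using that(2) X(3) nearby_points[OF p]
      by eventually_elim (simp add: vertical_horizontal_orthogonal[OF M g N g' sub])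
    from orthogonal_fields[OF M g D p that(1) X(1) this] X(2) show ?thesis by simp
  qed
  \<comment> \<open>Up to sign this is the second fundamental form of the fibre paired with x.
    Extending x to a horizontal X makes it bilinear on all tangent vectors without differentiating
    the frame.\<close>
  let ?b = "\<lambda>u v. g p v (D p u X)"
  have lin: "linear (\<lambda>u. D p u X)" by (rule connection_linear[OF M g D p X(1)])
  have "(\<Sum>i<?r. ?b (?W i p) (\<phi> p (?W i p))) = 0"
  proof (rule trace_symmetric_skew[OF point_inner_form[OF submersion_at],
        where b = ?b and e = "\<lambda>i. ?W i p" and \<phi> = "\<phi> p"])
    show "orthonormal_family (g p) {..<?r} (\<lambda>i. ?W i p)" using nearby_self[OF p ev] by simp
    show "bilinear ?b"
      unfolding bilinear_def
      by (auto intro!: linearI simp: bilinear_expand[OF bilinear_at] linear_add[OF lin] linear_scale[OF lin])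
    \<comment> \<open>Symmetry of the second fundamental form: the bracket of two vertical fields is
      vertical, hence orthogonal to x.\<close>
    show "?b (?W i p) (?W j p) = ?b (?W j p) (?W i p)" if "i \<in> {..<?r}" "j \<in> {..<?r}" for i j
    proof -
      have zero: "\<forall>\<^sub>F q in nearby M p. mdiff M N \<pi> q (?W i q) = (\<lambda>y. 0) (\<pi> q)"
        using WV[of i] that by (auto simp: vertical_def elim: eventually_mono)
      have "D p (?W i p) (?W j) - D p (?W j p) (?W i) \<in> V p"
        using that WV smooth_vf_near_zero[OF N smooth_map_point[OF M N submersion_smooth[OF M g N g' sub] p]]
        by (intro mdiff_bracket_vertical[OF W _ zero W]) auto
      then have "g p (D p (?W i p) (?W j)) x = g p (D p (?W j p) (?W i)) x"
        using vertical_horizontal_orthogonal(2)[OF submersion_at _ x]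
        by (fastforce simp: bilinear_lsub[OF bilinear_at])
      then show ?thesis using conn W WV that by simp
    qed
    show "g p u (\<phi> p v) = - g p (\<phi> p u) v" for u v by (rule phi_skew[OF p])
    show "\<phi> p (?W i p) \<in> span ((\<lambda>i. ?W i p) ` {..<?r})" if "i \<in> {..<?r}" for i
      using nearby_self[OF p ev] phi_vertical[OF p nearby_self[OF p WV[of i]]] that by simp
  qed
  then have sum0: "(\<Sum>i<?r. g p (D p (?W i p) (\<lambda>q. \<phi> q (?W i q))) x) = 0"
  proof -
    have "g p (D p (?W i p) (\<lambda>q. \<phi> q (?W i q))) x = - ?b (?W i p) (\<phi> p (?W i p))" if i: "i < ?r" for i
    proof (rule conn[OF smooth_vf_near_skew[OF M g D \<phi> p W[OF i]]])
      show "\<forall>\<^sub>F q in nearby M p. \<phi> q (?W i q) \<in> V q"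
        using WV[OF i] nearby_points[OF p] by eventually_elim (simp add: phi_vertical)
    qed
    then show ?thesis
      using \<open>(\<Sum>i<?r. ?b (?W i p) (\<phi> p (?W i p))) = 0\<close> by (simp add: sum_negf)
  qed
  have "(\<Sum>i<?r. cov_deriv_form M D (fundamental_form g \<phi>) p (?W i p) (?W i p) x)
      = (\<Sum>i<?r. - g p (D p (?W i p) (\<lambda>q. \<phi> q (?W i q))) x - g p (D p (?W i p) (?W i)) (\<phi> p x))"
    by (intro sum.cong refl cov_deriv_fundamental_form'[OF M g D \<phi> p W]) simp
  also have "\<dots> = - (\<Sum>i<?r. g p (D p (?W i p) (?W i)) (\<phi> p x))"
    using sum0 by (simp add: sum_subtractf sum_negf)
  also have "\<dots> = - g p (mean_curvature M g D N \<pi> p) (\<phi> p x)"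
    unfolding mean_curvature_def frame_sum_def bilinear_sum_left[OF bilinear_at]
    by (simp add: metric_hproj[OF submersion_at phi_horizontal[OF p x]])
  finally show ?thesis .
qed

text \<open>The three frames are chosen independently of one another. Joined along the sum of the
  index sets, the horizontal and the vertical one form an orthonormal basis, and the trace does not
  depend on the basis.\<close>

lemma trace_split:
  assumes b: "bilinear b"
  shows "(\<Sum>i<dim (UNIV :: 'a set). b (local_frame M g (\<lambda>_. UNIV) p i p) (local_frame M g (\<lambda>_. UNIV) p i p))
    = (\<Sum>i<dim (H p). b (local_frame M g H p i p) (local_frame M g H p i p))
    + (\<Sum>i<dim (V p). b (local_frame M g V p i p) (local_frame M g V p i p) :: real)"
proof -
  let ?E = "\<lambda>i. local_frame M g H p i p" and ?W = "\<lambda>i. local_frame M g V p i p"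
    and ?U = "\<lambda>i. local_frame M g (\<lambda>_. UNIV) p i p"
  have fr: "orthonormal_family (g p) {..<dim (S p)} (\<lambda>i. local_frame M g S p i p)"
    "span ((\<lambda>i. local_frame M g S p i p) ` {..<dim (S p)}) = S p" if "smooth_distribution M S p" for S
    using smooth_frame_local_frame[OF M g p that] nearby_self[OF p] by (auto simp: smooth_frame_def)
  note E = fr[OF smooth_distribution_horizontal[OF submersion_at]]
    and W = fr[OF smooth_distribution_vertical[OF submersion_at]]
    and U = fr[OF smooth_distribution_UNIV[OF M g p]]
  let ?I = "{..<dim (H p)} <+> {..<dim (V p)}" and ?e = "case_sum ?E ?W"
  have EH: "?E i \<in> H p" if "i < dim (H p)" for i
    using E(2) that by (metis (no_types, lifting) image_eqI lessThan_iff span_base)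
  have WV: "?W i \<in> V p" if "i < dim (V p)" for i
    using W(2) that by (metis (no_types, lifting) image_eqI lessThan_iff span_base)
  have "orthonormal_family (g p) ?I ?e"
    unfolding orthonormal_family_def
  proof (intro conjI ballI)
    have "g p (?E i) (?E j) = (if i = j then 1 else 0)" if "i < dim (H p)" "j < dim (H p)" for i j
      using E(1) that by (simp add: orthonormal_family_def)
    moreover have "g p (?W i) (?W j) = (if i = j then 1 else 0)" if "i < dim (V p)" "j < dim (V p)" for i j
      using W(1) that by (simp add: orthonormal_family_def)
    ultimately show "g p (?e k) (?e l) = (if k = l then 1 else 0)" if "k \<in> ?I" "l \<in> ?I" for k l
      using that vertical_horizontal_orthogonal[OF submersion_at WV EH] by (cases k; cases l) auto
  qed simp
  moreover have "span (?e ` ?I) = UNIV"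
  proof (intro set_eqI iffI UNIV_I)
    fix u
    have sub: "?E ` {..<dim (H p)} \<subseteq> ?e ` ?I" "?W ` {..<dim (V p)} \<subseteq> ?e ` ?I"
      by (force simp: image_iff)+
    have "hproj M g N \<pi> p u \<in> span (?e ` ?I)" "vproj M g N \<pi> p u \<in> span (?e ` ?I)"
      using hproj_horizontal[OF submersion_at, of u] vproj_vertical[OF submersion_at, of u]
        span_mono[OF sub(1)] span_mono[OF sub(2)] E(2) W(2) by auto
    then show "u \<in> span (?e ` ?I)"
      using hproj_vproj[OF submersion_at, of u] span_add by metis
  qed
  ultimately have "(\<Sum>i<dim (UNIV :: 'a set). b (?U i) (?U i)) = (\<Sum>k\<in>?I. b (?e k) (?e k))"
    using orthonormal_trace_eq[OF point_inner_form[OF submersion_at] U(1) _ _ b, of ?I ?e] U(2) by simp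
  then show ?thesis by (simp add: sum.Plus)
qed

text \<open>The comparison of traces for the submersion itself, with the horizontal distribution
  upstairs matched to the whole tangent space of the base.\<close>

lemma codifferential_base:
  assumes x: "x \<in> H p"
  shows "codifferential N g' D' (fundamental_form g' J) (\<pi> p) (mdiff M N \<pi> p x)
    = - (\<Sum>i<dim (H p). cov_deriv_form M D (fundamental_form g \<phi>) p
      (local_frame M g H p i p) (local_frame M g H p i p) x)"
proof -
  note \<pi> = submersion_smooth[OF M g N g' sub]
  note \<pi>p = smooth_map_point[OF M N \<pi> p]
  have E: "orthonormal_family (g p) {..<dim (H p)} (\<lambda>i. local_frame M g H p i p)"
    "span ((\<lambda>i. local_frame M g H p i p) ` {..<dim (H p)}) = H p"
    using smooth_frame_local_frame[OF M g p smooth_distribution_horizontal[OF submersion_at]] nearby_self[OF p]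
    by (auto simp: smooth_frame_def)
  have E': "orthonormal_family (g' (\<pi> p)) {..<dim (UNIV :: 'b set)} (\<lambda>i. local_frame N g' (\<lambda>_. UNIV) (\<pi> p) i (\<pi> p))"
    "span ((\<lambda>i. local_frame N g' (\<lambda>_. UNIV) (\<pi> p) i (\<pi> p)) ` {..<dim (UNIV :: 'b set)}) = UNIV"
    using smooth_frame_local_frame[OF N g' \<pi>p smooth_distribution_UNIV[OF N g' \<pi>p]] nearby_self[OF \<pi>p]
    by (auto simp: smooth_frame_def)
  have im: "mdiff M N \<pi> q ` H q = UNIV" if "q \<in> points M" for q
    by (rule mdiff_horizontal_image[OF M g N g' sub that])
  have iso: "g q u w = g' (\<pi> q) (mdiff M N \<pi> q u) (mdiff M N \<pi> q w)" if "q \<in> points M" "w \<in> H q" for q u w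
    by (rule metric_horizontal[OF M g N g' sub that])
  show ?thesis
    unfolding codifferential_def frame_sum_def
    by (rule arg_cong[where f = uminus, OF trace_cov_deriv_related[symmetric, OF M g D N g' D' \<pi> p \<phi> J
        smooth_distribution_horizontal[OF submersion_at] smooth_distribution_UNIV[OF N g' \<pi>p]
        iso phi_horizontal intertwine im E E' x]])
qed

end


section \<open>The fibres\<close>

context
  fixes M :: "('m::{second_countable_topology, t2_space}, 'a::euclidean_space) atlas"
    and N :: "('n::{second_countable_topology, t2_space}, 'b::euclidean_space) atlas"
    and F :: "('m, 'f::euclidean_space) atlas"
    and g :: "'m \<Rightarrow> 'a \<Rightarrow> 'a \<Rightarrow> real" and g' :: "'n \<Rightarrow> 'b \<Rightarrow> 'b \<Rightarrow> real" and \<pi> :: "'m \<Rightarrow> 'n"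
    and \<phi> :: "'m \<Rightarrow> 'a \<Rightarrow> 'a" and y :: 'n
  assumes M: "smooth_manifold M" and g: "riemannian_metric M g"
    and N: "smooth_manifold N" and g': "riemannian_metric N g'"
    and sub: "riemannian_submersion M g N g' \<pi>"
    and F: "embedded_submanifold F M" and fibre: "points F = {q \<in> points M. \<pi> q = y}"
    and dim: "DIM('f) + DIM('b) = DIM('a)"
    and \<phi>: "skew_endomorphism M g \<phi>"
    and \<phi>_vertical: "\<And>q v. q \<in> points M \<Longrightarrow> v \<in> vertical M N \<pi> q \<Longrightarrow> \<phi> q v \<in> vertical M N \<pi> q"
begin

lemma fibre_manifold: "smooth_manifold F" "smooth_map F M id"
  using F by (auto simp: embedded_submanifold_def)

lemma fibre_point: "q \<in> points F \<Longrightarrow> q \<in> points M"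
  using fibre by simp

lemma linear_inclusion: "q \<in> points F \<Longrightarrow> linear (mdiff F M id q)"
  by (rule linear_mdiff[OF fibre_manifold(1) M fibre_manifold(2)])

lemma inj_inclusion: "q \<in> points F \<Longrightarrow> inj (mdiff F M id q)"
  using F by (simp add: embedded_submanifold_def)

text \<open>The submersion is constant on the fibre, so tangent vectors of the fibre are vertical;
  injectivity and the dimension hypothesis give equality.\<close>

lemma range_inclusion:
  assumes q: "q \<in> points F"
  shows "range (mdiff F M id q) = vertical M N \<pi> q"
proof (rule subspace_dim_equal)
  note \<pi> = submersion_smooth[OF M g N g' sub]
  note qM = fibre_point[OF q]
  obtain V d where V: "chart_at N (\<pi> q) = (V, d)" "(V, d) \<in> N" "\<pi> q \<in> V"
    using chart_atE[OF N smooth_map_point[OF M N \<pi> qM]] by blast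
  have sm: "smooth_fun_near M (id q) (\<lambda>x. d (\<pi> x))"
    using smooth_map_pullback[OF M N \<pi> qM smooth_chart[OF N V(2,3)]] by simp
  have ev: "\<forall>\<^sub>F x in nearby F q. d y = d (\<pi> (id x))"
    using nearby_points[OF q] by eventually_elim (simp add: fibre)
  have "mdiff M N \<pi> q (mdiff F M id q u) = 0" for u
  proof -
    have "mdiff M N \<pi> q (mdiff F M id q u) = dfun M (id q) (\<lambda>x. d (\<pi> x)) (mdiff F M id q u)"
      by (simp add: mdiff_def V(1) o_def)
    also have "\<dots> = dfun F q (\<lambda>x. d (\<pi> (id x))) u"
      by (rule dfun_smooth_map[OF fibre_manifold(1) M fibre_manifold(2) q sm, symmetric])
    also have "\<dots> = 0"
      using dfun_cong[OF fibre_manifold(1) q smooth_fun_near_const[OF fibre_manifold(1) q] ev]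
        dfun_const[OF fibre_manifold(1) q] by simp
    finally show ?thesis .
  qed
  then show "range (mdiff F M id q) \<subseteq> vertical M N \<pi> q" by (auto simp: vertical_def)
  have "dim (range (mdiff F M id q)) = DIM('f)"
    using dim_image_eq[OF linear_inclusion[OF q], of UNIV] inj_inclusion[OF q] by simp
  then show "dim (vertical M N \<pi> q) \<le> dim (range (mdiff F M id q))"
    using dim_vertical[OF M g N g' sub qM] dim by simp
  show "subspace (range (mdiff F M id q))"
    by (rule linear_subspace_image[OF linear_inclusion[OF q] subspace_UNIV])
  show "subspace (vertical M N \<pi> q)" by (rule subspace_vertical[OF M g N g' sub qM])
qed

lemma inclusion_restrict_vector:
  assumes "q \<in> points F" "v \<in> vertical M N \<pi> q"
  shows "mdiff F M id q (restrict_vector F M q v) = v"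
  unfolding restrict_vector_def by (rule f_inv_into_f) (simp add: range_inclusion assms)

lemma inclusion_induced_endomorphism:
  assumes "q \<in> points F"
  shows "mdiff F M id q (induced_endomorphism F M \<phi> q u) = \<phi> q (mdiff F M id q u)"
  unfolding induced_endomorphism_def
  using range_inclusion[OF assms] \<phi>_vertical[OF fibre_point[OF assms]]
  by (intro inclusion_restrict_vector[OF assms]) blast

lemma riemannian_metric_induced: "riemannian_metric F (induced_metric F M g)"
  unfolding riemannian_metric_def
proof (intro conjI ballI allI impI)
  fix q assume q: "q \<in> points F"
  note gq = riemannian_metric_inner_form[OF g fibre_point[OF q]]
  note lin = linear_inclusion[OF q]
  show "bilinear (induced_metric F M g q)"
    unfolding bilinear_def induced_metric_def
    by (auto intro!: linearI simp: bilinear_expand[OF inner_form_bilinear[OF gq]] linear_add[OF lin] linear_scale[OF lin])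
  show "induced_metric F M g q u v = induced_metric F M g q v u" for u v
    unfolding induced_metric_def by (rule inner_form_commute[OF gq])
  show "0 < induced_metric F M g q v v" if "v \<noteq> 0" for v
    unfolding induced_metric_def using inj_inclusion[OF q] that linear_injective_0[OF lin]
    by (intro inner_form_pos[OF gq]) blast
next
  fix W X Y assume W: "open_in F W" and XY: "smooth_vf F W X" "smooth_vf F W Y"
  have "smooth_fun_near F q (\<lambda>p. induced_metric F M g p (X p) (Y p))" if "q \<in> W" for q
  proof -
    have q: "q \<in> points F" using that open_in_subset_points[OF W] by blast
    \<comment> \<open>The metric alone is the case of the identity endomorphism in
      \<open>smooth_endomorphism_along\<close>.\<close>
    have id: "smooth_endomorphism M (\<lambda>p v. v)"
      by (simp add: smooth_endomorphism_def linear_ident)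
    have XY': "smooth_vf_near F q X" "smooth_vf_near F q Y"
      using smooth_vf_iff[OF fibre_manifold(1) W] XY that by blast+
    show ?thesis
      using smooth_endomorphism_along[OF fibre_manifold(1) M fibre_manifold(2) q g id XY']
      by (simp add: induced_metric_def)
  qed
  then show "smooth_fun F W (\<lambda>p. induced_metric F M g p (X p) (Y p))"
    using smooth_fun_iff[OF fibre_manifold(1) W] by blast
qed

text \<open>The induced endomorphism is defined through an inverse of the inclusion. Its algebraic
  properties are checked after applying the injective differential, and its smoothness by expanding
  in an orthonormal frame of the fibre.\<close>

lemma skew_endomorphism_induced:
  "skew_endomorphism F (induced_metric F M g) (induced_endomorphism F M \<phi>)"
  unfolding skew_endomorphism_def smooth_endomorphism_def
proof (intro conjI ballI allI impI)
  fix q assume q: "q \<in> points F"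
  note lin = linear_inclusion[OF q] and inj = inj_inclusion[OF q]
  have lin\<phi>: "linear (\<phi> q)"
    using \<phi> fibre_point[OF q] by (simp add: skew_endomorphism_def smooth_endomorphism_def)
  show "linear (induced_endomorphism F M \<phi> q)"
    by (rule linearI; rule injD[OF inj])
      (simp_all add: inclusion_induced_endomorphism[OF q] linear_add[OF lin] linear_scale[OF lin]
        linear_add[OF lin\<phi>] linear_scale[OF lin\<phi>])
  show "induced_metric F M g q u (induced_endomorphism F M \<phi> q v)
      = - induced_metric F M g q (induced_endomorphism F M \<phi> q u) v" for u v
    using \<phi> fibre_point[OF q]
    by (simp add: induced_metric_def inclusion_induced_endomorphism[OF q] skew_endomorphism_def)
next
  fix W X assume W: "open_in F W" and X: "smooth_vf F W X"
  let ?g = "induced_metric F M g" and ?n = "dim (UNIV :: 'f set)"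
  note FM = fibre_manifold(1) M fibre_manifold(2)
  have "smooth_vf_near F q (\<lambda>p. induced_endomorphism F M \<phi> p (X p))" if "q \<in> W" for q
  proof -
    have q: "q \<in> points F" using that open_in_subset_points[OF W] by blast
    have X': "smooth_vf_near F q X" using smooth_vf_iff[OF fibre_manifold(1) W] X that by blast
    obtain e where "smooth_frame F ?g (\<lambda>_. UNIV) q e"
      using smooth_frame_ex[OF fibre_manifold(1) riemannian_metric_induced q
          smooth_distribution_UNIV[OF fibre_manifold(1) riemannian_metric_induced q]] by blast
    then have e: "\<And>i. i < ?n \<Longrightarrow> smooth_vf_near F q (e i)"
      and ev: "\<forall>\<^sub>F x in nearby F q. orthonormal_family (?g x) {..<?n} (\<lambda>i. e i x) \<and>
        span ((\<lambda>i. e i x) ` {..<?n}) = UNIV"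
      by (auto simp: smooth_frame_def)
    \<comment> \<open>The coefficients are computed in \<open>M\<close>, where \<phi> is known to be
      smooth, and the inverse of the inclusion no longer occurs.\<close>
    let ?Y = "\<lambda>x. \<Sum>i<?n. g (id x) (mdiff F M id x (e i x)) (\<phi> (id x) (mdiff F M id x (X x))) *\<^sub>R e i x"
    have "smooth_vf_near F q ?Y"
      using \<phi> by (intro smooth_vf_near_sum[OF fibre_manifold(1) q] smooth_vf_near_scaleR[OF fibre_manifold(1) q]
          smooth_endomorphism_along[OF FM q g _ _ X'] e) (auto simp: skew_endomorphism_def)
    moreover have "\<forall>\<^sub>F x in nearby F q. ?Y x = induced_endomorphism F M \<phi> x (X x)"
      using ev nearby_points[OF q]
    proof eventually_elim
      case (elim x)
      note gx = riemannian_metric_inner_form[OF riemannian_metric_induced elim(2)]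
      have "induced_endomorphism F M \<phi> x (X x)
          = (\<Sum>i<?n. ?g x (induced_endomorphism F M \<phi> x (X x)) (e i x) *\<^sub>R e i x)"
        by (rule orthonormal_expand[OF gx]) (use elim(1) in auto)
      also have "\<dots> = ?Y x"
        unfolding inner_form_commute[OF gx, of "induced_endomorphism F M \<phi> x (X x)"]
        by (simp add: induced_metric_def inclusion_induced_endomorphism[OF elim(2)])
      finally show ?case by simp
    qed
    ultimately show ?thesis by (rule smooth_vf_near_cong[OF fibre_manifold(1) q])
  qed
  then show "smooth_vf F W (\<lambda>p. induced_endomorphism F M \<phi> p (X p))"
    using smooth_vf_iff[OF fibre_manifold(1) W] by blast
qed

text \<open>Here the comparison map is the inclusion, so it runs from the fibre to \<open>M\<close>:
  the whole tangent space of the fibre is matched to the vertical distribution, and v is the image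
  of its restriction.\<close>

lemma codifferential_fibre:
  assumes D: "levi_civita M g D" and DF: "levi_civita F (induced_metric F M g) DF"
    and p: "p \<in> points F" and v: "v \<in> vertical M N \<pi> p"
  shows "codifferential F (induced_metric F M g) DF
      (fundamental_form (induced_metric F M g) (induced_endomorphism F M \<phi>)) p (restrict_vector F M p v)
    = - (\<Sum>i<dim (vertical M N \<pi> p). cov_deriv_form M D (fundamental_form g \<phi>) p
      (local_frame M g (vertical M N \<pi>) p i p) (local_frame M g (vertical M N \<pi>) p i p) v)"
proof -
  let ?g = "induced_metric F M g" and ?V = "vertical M N \<pi>"
  note pM = fibre_point[OF p]
  note distV = smooth_distribution_vertical[OF M g N g' sub pM]
  note distF = smooth_distribution_UNIV[OF fibre_manifold(1) riemannian_metric_induced p]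
  have W: "orthonormal_family (g (id p)) {..<dim (?V p)} (\<lambda>i. local_frame M g ?V p i p)"
    "span ((\<lambda>i. local_frame M g ?V p i p) ` {..<dim (?V p)}) = ?V (id p)"
    using smooth_frame_local_frame[OF M g pM distV] nearby_self[OF pM] by (auto simp: smooth_frame_def)
  have E: "orthonormal_family (?g p) {..<dim (UNIV :: 'f set)} (\<lambda>i. local_frame F ?g (\<lambda>_. UNIV) p i p)"
    "span ((\<lambda>i. local_frame F ?g (\<lambda>_. UNIV) p i p) ` {..<dim (UNIV :: 'f set)}) = UNIV"
    using smooth_frame_local_frame[OF fibre_manifold(1) riemannian_metric_induced p distF] nearby_self[OF p]
    by (auto simp: smooth_frame_def)
  have "(\<Sum>i<dim (UNIV :: 'f set). cov_deriv_form F DF (fundamental_form ?g (induced_endomorphism F M \<phi>)) p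
        (local_frame F ?g (\<lambda>_. UNIV) p i p) (local_frame F ?g (\<lambda>_. UNIV) p i p) (restrict_vector F M p v))
      = (\<Sum>i<dim (?V p). cov_deriv_form M D (fundamental_form g \<phi>) (id p)
        (local_frame M g ?V p i p) (local_frame M g ?V p i p) (mdiff F M id p (restrict_vector F M p v)))"
  proof (rule trace_cov_deriv_related[where S = "\<lambda>_. UNIV" and R = ?V and f = id,
        OF fibre_manifold(1) riemannian_metric_induced DF M g D fibre_manifold(2) p
        skew_endomorphism_induced \<phi> distF _ _ _ _ _ E W])
    show "smooth_distribution M ?V (id p)" using distV by simp
  qed (simp_all add: induced_metric_def inclusion_induced_endomorphism range_inclusion)
  then show ?thesis
    by (simp add: codifferential_def frame_sum_def inclusion_restrict_vector[OF p v])
qed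

end

section \<open>Assembly of the two pure and the two mixed traces\<close>

theorem theorem4p1:
  fixes M :: "('m::{second_countable_topology, t2_space}, 'a::euclidean_space) atlas"
    and N :: "('n::{second_countable_topology, t2_space}, 'b::euclidean_space) atlas"
    and F :: "('m, 'f::euclidean_space) atlas"
    and \<phi> :: "'m \<Rightarrow> 'a \<Rightarrow> 'a" and \<xi> :: "'m \<Rightarrow> 'a" and \<eta> :: "'m \<Rightarrow> 'a \<Rightarrow> real"
    and g :: "'m \<Rightarrow> 'a \<Rightarrow> 'a \<Rightarrow> real"
    and J :: "'n \<Rightarrow> 'b \<Rightarrow> 'b" and g' :: "'n \<Rightarrow> 'b \<Rightarrow> 'b \<Rightarrow> real"
    and \<pi> :: "'m \<Rightarrow> 'n"
    and D :: "'m \<Rightarrow> 'a \<Rightarrow> ('m \<Rightarrow> 'a) \<Rightarrow> 'a"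
    and D' :: "'n \<Rightarrow> 'b \<Rightarrow> ('n \<Rightarrow> 'b) \<Rightarrow> 'b"
    and DF :: "'m \<Rightarrow> 'f \<Rightarrow> ('m \<Rightarrow> 'f) \<Rightarrow> 'f"
    and X :: "'m \<Rightarrow> 'a" and p :: 'm
  assumes "contact_complex_submersion M \<phi> \<xi> \<eta> g N J g' \<pi>"
    and "levi_civita M g D" and "levi_civita N g' D'"
    and "smooth_vf M (points M) X"
    and "p \<in> points M"
    and "embedded_submanifold F M"
    and "points F = {q \<in> points M. \<pi> q = \<pi> p}"
    and "DIM('f) + DIM('b) = DIM('a)"
    and "levi_civita F (induced_metric F M g) DF"
  shows "codifferential M g D (fundamental_form g \<phi>) p (X p)
      = codifferential N g' D' (fundamental_form g' J) (\<pi> p)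
          (mdiff M N \<pi> p (hproj M g N \<pi> p (X p)))
      + codifferential F (induced_metric F M g) DF
          (fundamental_form (induced_metric F M g) (induced_endomorphism F M \<phi>)) p
          (restrict_vector F M p (vproj M g N \<pi> p (X p)))
      + g p (mean_curvature M g D N \<pi> p) (\<phi> p (hproj M g N \<pi> p (X p)))
      + 1 / 2 * g p (trace_Bh M \<phi> g D N \<pi> p) (vproj M g N \<pi> p (X p))"
proof -
  note ccs = assms(1)[unfolded contact_complex_submersion_def]
  have M: "smooth_manifold M" and g: "riemannian_metric M g" and N: "smooth_manifold N"
    and g': "riemannian_metric N g'" and sub: "riemannian_submersion M g N g' \<pi>"
    using ccs by (auto simp: almost_contact_metric_def almost_hermitian_def)
  have \<phi>: "skew_endomorphism M g \<phi>" and J: "skew_endomorphism N g' J"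
    using ccs almost_contact_skew_endomorphism almost_hermitian_skew_endomorphism by blast+
  have intertwine: "mdiff M N \<pi> q (\<phi> q v) = J (\<pi> q) (mdiff M N \<pi> q v)" if "q \<in> points M" for q v
    using ccs that by simp
  note D = assms(2) and D' = assms(3) and p = assms(5)
  note sm = M g D N g' D' sub \<phi> J intertwine p
  let ?X = "hproj M g N \<pi> p (X p)" and ?V = "vproj M g N \<pi> p (X p)"
  let ?E = "\<lambda>i. local_frame M g (horizontal M g N \<pi>) p i p" and ?W = "\<lambda>i. local_frame M g (vertical M N \<pi>) p i p"
  let ?T = "cov_deriv_form M D (fundamental_form g \<phi>) p"
  have X: "?X \<in> horizontal M g N \<pi> p" and V: "?V \<in> vertical M N \<pi> p" and XV: "?X + ?V = X p"
    using hproj_horizontal[OF M g N g' sub p] vproj_vertical[OF M g N g' sub p]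
      hproj_vproj[OF M g N g' sub p] by auto
  \<comment> \<open>With the first slot extended to a field, the third one enters only
    algebraically, through g and \<phi> at \<open>p\<close>, so additivity can be read off.\<close>
  have add: "?T u u (X p) = ?T u u ?X + ?T u u ?V" for u
  proof -
    obtain Y where Y: "smooth_vf_near M p Y" "Y p = u" using smooth_vf_near_ex[OF M p] by blast
    have bl: "bilinear (g p)" using inner_form_bilinear[OF riemannian_metric_inner_form[OF g p]] .
    have lin: "linear (\<phi> p)"
      using \<phi> p by (simp add: skew_endomorphism_def smooth_endomorphism_def)
    have "g p z (X p) = g p z ?X + g p z ?V" for z
      using bilinear_radd[OF bl, of z ?X ?V] by (simp only: XV)
    moreover have "\<phi> p (X p) = \<phi> p ?X + \<phi> p ?V"
      using linear_add[OF lin, of ?X ?V] by (simp only: XV)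
    ultimately show ?thesis
      using cov_deriv_fundamental_form'[OF M g D \<phi> p Y(1), of u] unfolding Y(2)
      by (simp add: bilinear_radd[OF bl])
  qed
  have "codifferential M g D (fundamental_form g \<phi>) p (X p)
      = - (\<Sum>i<dim (horizontal M g N \<pi> p). ?T (?E i) (?E i) (X p))
        - (\<Sum>i<dim (vertical M N \<pi> p). ?T (?W i) (?W i) (X p))"
    using trace_split[OF sm bilinear_cov_deriv[OF M g D \<phi> p]]
    by (simp add: codifferential_def frame_sum_def)
  also have "\<dots> = - (\<Sum>i<dim (horizontal M g N \<pi> p). ?T (?E i) (?E i) ?X)
        - (\<Sum>i<dim (vertical M N \<pi> p). ?T (?W i) (?W i) ?V)
        - (\<Sum>i<dim (vertical M N \<pi> p). ?T (?W i) (?W i) ?X)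
        - (\<Sum>i<dim (horizontal M g N \<pi> p). ?T (?E i) (?E i) ?V)"
    by (simp add: add sum.distrib)
  finally have split: "codifferential M g D (fundamental_form g \<phi>) p (X p)
      = - (\<Sum>i<dim (horizontal M g N \<pi> p). ?T (?E i) (?E i) ?X)
        - (\<Sum>i<dim (vertical M N \<pi> p). ?T (?W i) (?W i) ?V)
        - (\<Sum>i<dim (vertical M N \<pi> p). ?T (?W i) (?W i) ?X)
        - (\<Sum>i<dim (horizontal M g N \<pi> p). ?T (?E i) (?E i) ?V)" .
  have pF: "p \<in> points F" using p assms(7) by simp
  have "codifferential F (induced_metric F M g) DF
      (fundamental_form (induced_metric F M g) (induced_endomorphism F M \<phi>)) p (restrict_vector F M p ?V)
      = - (\<Sum>i<dim (vertical M N \<pi> p). ?T (?W i) (?W i) ?V)"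
    by (rule codifferential_fibre[OF M g N g' sub assms(6,7,8) \<phi> phi_vertical[OF sm] D assms(9) pF V])
  \<comment> \<open>The minus sign of the codifferential turns the mixed traces, - g(H, \<phi> X)
    and - 1/2 g(Tr B, V), into the two positive terms of the formula.\<close>
  then show ?thesis
    using split codifferential_base[OF sm X] trace_vertical[OF sm X] trace_horizontal[OF sm V] by linarith
qed

end
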